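(* Let $(S,\Sigma)$ be a typed signature and let $A$ be any set of classic $(S,\Sigma)$-inequations. Then the category of representations of the 2-signature $((S,\Sigma),A)$, i.e. the full subcategory of $\mathrm{Rep}^{\Delta}(S,\Sigma)$ consisting of those representations that satisfy every inequation in $A$, has an initial object.
   Context: Categories. $\mathsf{Set}$ is the category of sets; $\mathsf{PO}$ is the category of preordered sets and monotone maps. $\Delta:\mathsf{Set}\to\mathsf{PO}$ sends a set to itself with the equality preorder. For a set $T$, $\mathsf{Set}^T$, $\mathsf{PO}^T$ are categories of $T$-indexed families, $\Delta^T$ acts sortwise; hom-sets of $\mathsf{PO}^T$ are preordered pointwise. Relative monads and modules. A relative monad $P$ on $F:\mathcal C\to\mathcal D$: object map $P$, morphisms $\eta_c:Fc\to Pc$, maps $\sigma:\mathcal D(Fc,Pd)\to\mathcal D(Pc,Pd)$ with $\eta;\sigma(f)=f$, $\sigma(\eta)=\mathrm{id}$, $\sigma(f);\sigma(g)=\sigma(f;\sigma(g))$. A reduction monad over $T$ is a relative monad on $\Delta^T$ whose maps $\sigma_{X,Y}:\mathsf{PO}^T(\Delta^TX,PY)\to\mathsf{PO}^T(PX,PY)$ are monotone. A $P$-module $M$ with codomain $\mathcal E$: object map with $\varsigma:\mathcal D(Fc,Pd)\to\mathcal E(Mc,Md)$, $\varsigma(f);\varsigma(g)=\varsigma(f;\sigma(g))$, $\varsigma(\eta)=\mathrm{id}$; module morphisms are families commuting with $\varsigma$. Constructions: tautological module $P$; terminal module $*$; products; fibre $M_t(V)=M(V)(t)$; derivation $M^s(V)=M(V+D(s))$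 ($V$ with one fresh variable $*$ of sort $s$) with substitution through the shifted map sending old variables $v$ to $P(\mathrm{inl})(f(v))$ and $*$ to $\eta(\mathrm{inr}\,* )$; iterated derivation $M^{s_1\dots s_m}$. Signatures for types. An algebraic signature $S:J_S\to\mathbb N$; representations are sets $T$ with operations $T^{S(j)}\to T$; morphisms commute with operations; $\hat S$ is the initial representation. $S(n)$ is the set of type expressions over $S$ in variables $1,\dots,n$, evaluated at $\vec u\in T^n$ as $s(\vec u)\in T$. For $g:T\to T'$, the retyping functor is $(g_!V)(t')=\coprod_{g(t)=t'}V(t)$. Relative $S$-monads: pairs $(T,P)$ of an $S$-representation and a reduction monad over $T$; a morphism $(T,P)\to(T',Q)$ is $(g,f)$ with $g$ a morphism of $S$-representations and $f_V:g_!(PV)\to Q(g_!V)$ in $\mathsf{PO}^{T'}$ satisfying $g_!(\eta^P);f=\eta^Q$ and $g_!(\sigma^P(h));f_W=f_V;\sigma^Q(g_!h;f_W)$. Write $\hat f:P(V)_t\to Q(g_!V)_{g(t)}$ for the induced maps (also on derived modules via $g_!(V+D(s))\cong g_!V+D(g(s))$). Typed signatures and representations. A classic arity of degree $n$ is $[([t_{1,1},\dots,t_{1,m_1}],t_1),\dots,([t_{k,1},\dots,t_{k,m_k}],t_k)]\to t_0$ with $t_{i,j},t_i,t_0\in S(n)$; a typed signature $(S,\Sigma)$ is $S$ with a family $\Sigma$ of classic arities. A representation of $(S,\Sigma)$ is a relative $S$-monad $(T,R)$ together with, for each arity $\alpha$ and each $\vec u\in T^n$, a morphism of $R$-modules $\alpha^R_{\vec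 u}:\prod_i (R^{t_{i,1}(\vec u)\ldots t_{i,m_i}(\vec u)})_{t_i(\vec u)}\to R_{t_0(\vec u)}$ (empty product $=*$). A morphism of representations is a morphism $(g,f)$ of relative $S$-monads with $\hat f(\alpha^P_{\vec u}(x))=\alpha^R_{g(\vec u)}(\hat f(x))$ componentwise for all arities, $\vec u$, contexts and arguments $x$. This is the category $\mathrm{Rep}^{\Delta}(S,\Sigma)$. Inequations. An $(S,\Sigma)$-module $W$ of degree $n$ assigns to each representation $R$ (over types $T$) a module $W^R$ over $R$ of degree $n$ (equivalently a family $(W^R_{\vec u})_{\vec u\in T^n}$ of $R$-modules with codomain $\mathsf{PO}$), functorially in morphisms of representations and compatibly with the forgetful functor to relative $S$-monads. A half-equation $W\to W'$ is a natural transformation between such functors that is the identity after forgetting to relative monads; concretely it gives for each $R$ and $\vec u$ a module morphism $\alpha^R_{\vec u}:W^R_{\vec u}\to W'^R_{\vec u}$, natural in $R$. An $(S,\Sigma)$-inequation $\alpha\le\gamma$ is a pair of parallel half-equations $\alpha,\gamma:W\to W'$. It is classic if its codomain $W'$ is a classic $(S,\Sigma)$-module, i.e. of the form $R\mapsto\prod_{i=1}^k (R^{\tau_{i}}_n)_{\sigma_i}$ — for each $\vec u$, $\prod_i (R^{\tau_{i,1}(\vec u)\dots\tau_{i,m_i}(\vec u)})_{\sigma_i(\vec u)}$ with $\tau_{i,j},\sigma_i\in S(n)$ (the domain form of a classic arity; in particular a single fibre $R_{\sigma(\vec u)}$ of the tautological module). A representation $R$ satisfies $\alpha\le\gamma$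 if $\alpha^R_{\vec u}(y)\le\gamma^R_{\vec u}(y)$ in the preorder of $W'^R_{\vec u}(X)$ for every context $X$, every $\vec u\in T^n$ and every element $y$ of $W^R_{\vec u}(X)$. Examples of inequations: beta reduction $(\mathrm{abs}\times\mathrm{id});\mathrm{app}\le\mathrm{subst}$, where $\mathrm{subst}$ is $(y,z)\mapsto \sigma([\eta,\lambda x.z])(y)$. *)

theory Defs
  imports Main "HOL-Library.FuncSet"
begin

section \<open>The category of sets\<close>

text \<open>
  All sets live in the type \<open>'a univ\<close>, which is closed under finite tuples, so that coproducts
  and finite products of sets are again sets of this type.  The sets that count as objects of
  the category of sets are singled out by a predicate \<open>small\<close>, of which we only ask what is
  recorded in \<open>set_universe\<close>.  It may hold of all sets (lemma \<open>set_universe_all\<close>), or, when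
  \<open>'a\<close> is a type modelling ZFC, of those sets whose cardinality is that of a set of the model.
\<close>

datatype 'a univ = Atom 'a | Tuple "'a univ list"

definition set_universe :: "('a univ set \<Rightarrow> bool) \<Rightarrow> bool" where
  "set_universe small \<longleftrightarrow>
     (\<exists>A. small A \<and> infinite A) \<and>
     (\<forall>A B. small A \<and> B \<subseteq> A \<longrightarrow> small B) \<and>
     (\<forall>A f. small A \<longrightarrow> small (f ` A)) \<and>
     (\<forall>A F. small A \<and> (\<forall>a\<in>A. small (F a)) \<longrightarrow> small (\<Union>a\<in>A. F a))"

lemma infinite_univ: "infinite (UNIV :: 'a univ set)"
proof -
  have "inj (\<lambda>n. Tuple (replicate n (Tuple [])) :: 'a univ)"
    by (auto intro!: injI)
  then show ?thesis
    using finite_imageD finite_subset[OF subset_UNIV] infinite_UNIV_nat by blast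
qed

lemma set_universe_all: "set_universe (\<lambda>_. True)"
  using infinite_univ by (auto simp: set_universe_def)

primrec comps :: "'a univ \<Rightarrow> 'a univ list" where
  "comps (Atom a) = []"
| "comps (Tuple xs) = xs"

text \<open>\<open>pair t v\<close> is the element \<open>v\<close> of the summand with index \<open>t\<close> of a coproduct.\<close>

definition pair :: "'a univ \<Rightarrow> 'a univ \<Rightarrow> 'a univ" where
  "pair t v = Tuple [t, v]"

definition idx :: "'a univ \<Rightarrow> 'a univ" where
  "idx x = comps x ! 0"

definition val :: "'a univ \<Rightarrow> 'a univ" where
  "val x = comps x ! 1"

text \<open>The injections of \<open>V + D(s)\<close>.\<close>

definition old :: "'a univ \<Rightarrow> 'a univ" where
  "old v = Tuple [v]"

definition unold :: "'a univ \<Rightarrow> 'a univ" where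
  "unold x = comps x ! 0"

definition fresh :: "'a univ" where
  "fresh = Tuple []"

definition vecs :: "'a set \<Rightarrow> nat \<Rightarrow> 'a list set" where
  "vecs T n = {u. length u = n \<and> set u \<subseteq> T}"


section \<open>Families of sets and of preordered sets\<close>

text \<open>
  A family indexed by \<open>T\<close> is a function on the whole type that is empty outside \<open>T\<close>.  Morphisms
  are extensional functions, so that equality of morphisms is equality.
\<close>

type_synonym 'a ctx = "'a univ \<Rightarrow> 'a univ set"
type_synonym 'a mor = "'a univ \<Rightarrow> 'a univ \<Rightarrow> 'a univ"

record 'a preo =
  carr :: "'a univ set"
  leq :: "'a univ rel"

type_synonym 'a fam = "'a univ \<Rightarrow> 'a preo"

definition ctx :: "('a univ set \<Rightarrow> bool) \<Rightarrow> 'a univ set \<Rightarrow> 'a ctx \<Rightarrow> bool" where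
  "ctx small T V \<longleftrightarrow> (\<forall>t\<in>T. small (V t)) \<and> (\<forall>t. t \<notin> T \<longrightarrow> V t = {})"

definition preo :: "('a univ set \<Rightarrow> bool) \<Rightarrow> 'a preo \<Rightarrow> bool" where
  "preo small X \<longleftrightarrow> small (carr X) \<and> preorder_on (carr X) (leq X)"

definition po_fam :: "('a univ set \<Rightarrow> bool) \<Rightarrow> 'a univ set \<Rightarrow> 'a fam \<Rightarrow> bool" where
  "po_fam small T F \<longleftrightarrow>
     (\<forall>t\<in>T. preo small (F t)) \<and> (\<forall>t. t \<notin> T \<longrightarrow> F t = \<lparr>carr = {}, leq = {}\<rparr>)"

definition carrs :: "'a fam \<Rightarrow> 'a ctx" where
  "carrs F = (\<lambda>t. carr (F t))"

definition disc :: "'a ctx \<Rightarrow> 'a fam" where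
  "disc V = (\<lambda>t. \<lparr>carr = V t, leq = Id_on (V t)\<rparr>)"

definition phom :: "'a preo \<Rightarrow> 'a preo \<Rightarrow> ('a univ \<Rightarrow> 'a univ) set" where
  "phom X Y = {f \<in> carr X \<rightarrow>\<^sub>E carr Y. \<forall>(x, y) \<in> leq X. (f x, f y) \<in> leq Y}"

definition fhom :: "'a fam \<Rightarrow> 'a fam \<Rightarrow> 'a mor set" where
  "fhom F G = {f. \<forall>t. f t \<in> phom (F t) (G t)}"

definition fhom_le :: "'a fam \<Rightarrow> 'a fam \<Rightarrow> 'a mor \<Rightarrow> 'a mor \<Rightarrow> bool" where
  "fhom_le F G f g \<longleftrightarrow> (\<forall>t. \<forall>x \<in> carr (F t). (f t x, g t x) \<in> leq (G t))"

definition fid :: "'a ctx \<Rightarrow> 'a mor" where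
  "fid V = (\<lambda>t. \<lambda>v\<in>V t. v)"

text \<open>Composition in diagrammatic order; the first argument is the domain of \<open>f\<close>.\<close>

definition fcomp :: "'a ctx \<Rightarrow> 'a mor \<Rightarrow> 'a mor \<Rightarrow> 'a mor" where
  "fcomp V f g = (\<lambda>t. compose (V t) (g t) (f t))"

text \<open>The retyping functor on families of sets, of preordered sets, and on morphisms.\<close>

definition retype :: "('a univ \<Rightarrow> 'a univ) \<Rightarrow> 'a ctx \<Rightarrow> 'a ctx" where
  "retype g V = (\<lambda>t'. {pair t v | t v. g t = t' \<and> v \<in> V t})"

definition retype_fam :: "('a univ \<Rightarrow> 'a univ) \<Rightarrow> 'a fam \<Rightarrow> 'a fam" where
  "retype_fam g F = (\<lambda>t'.
     \<lparr>carr = {pair t x | t x. g t = t' \<and> x \<in> carr (F t)},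
      leq = {(pair t x, pair t y) | t x y. g t = t' \<and> (x, y) \<in> leq (F t)}\<rparr>)"

definition retype_mor :: "('a univ \<Rightarrow> 'a univ) \<Rightarrow> 'a ctx \<Rightarrow> 'a mor \<Rightarrow> 'a mor" where
  "retype_mor g V h = (\<lambda>t'. \<lambda>x\<in>retype g V t'. pair (idx x) (h (idx x) (val x)))"

text \<open>The canonical maps from \<open>V\<close> to its retyping along the identity, and from an iterated
  retyping to the retyping along the composite.\<close>

definition retype_unit :: "'a ctx \<Rightarrow> 'a mor" where
  "retype_unit V = (\<lambda>t. \<lambda>v\<in>V t. pair t v)"

definition retype_assoc ::
  "('a univ \<Rightarrow> 'a univ) \<Rightarrow> ('a univ \<Rightarrow> 'a univ) \<Rightarrow> 'a ctx \<Rightarrow> 'a mor" where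
  "retype_assoc g g' V = (\<lambda>t. \<lambda>x\<in>retype g' (retype g V) t. val x)"

text \<open>\<open>addvar s V\<close> is \<open>V + D(s)\<close>.\<close>

definition addvar :: "'a univ \<Rightarrow> 'a ctx \<Rightarrow> 'a ctx" where
  "addvar s V = (\<lambda>t. old ` V t \<union> (if t = s then {fresh} else {}))"

definition addvar_inl :: "'a ctx \<Rightarrow> 'a mor" where
  "addvar_inl V = (\<lambda>t. \<lambda>v\<in>V t. old v)"

text \<open>The canonical map from the retyping of \<open>V + D(s)\<close> to the extension by \<open>D(g(s))\<close> of the
  retyping of \<open>V\<close>.\<close>

definition retype_addvar :: "('a univ \<Rightarrow> 'a univ) \<Rightarrow> 'a univ \<Rightarrow> 'a ctx \<Rightarrow> 'a mor" where
  "retype_addvar g s V = (\<lambda>t'. \<lambda>x\<in>retype g (addvar s V) t'.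
     if val x = fresh then fresh else old (pair (idx x) (unold (val x))))"


section \<open>Signatures for types\<close>

datatype 'a texp = TVar nat | TOp "'a univ" "'a texp list"

record 'a ssig =
  tops :: "'a univ set"
  tar :: "'a univ \<Rightarrow> nat"

record 'a srep =
  tys :: "'a univ set"
  tyop :: "'a univ \<Rightarrow> 'a univ list \<Rightarrow> 'a univ"

definition srep :: "('a univ set \<Rightarrow> bool) \<Rightarrow> ('a, 's) ssig_scheme \<Rightarrow> ('a, 'r) srep_scheme \<Rightarrow> bool"
where
  "srep small S R \<longleftrightarrow> small (tys R) \<and>
     (\<forall>j\<in>tops S. \<forall>us\<in>vecs (tys R) (tar S j). tyop R j us \<in> tys R)"

definition srep_mor ::
  "('a, 's) ssig_scheme \<Rightarrow> ('a, 'r) srep_scheme \<Rightarrow> ('a, 'q) srep_scheme \<Rightarrow>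
   ('a univ \<Rightarrow> 'a univ) \<Rightarrow> bool" where
  "srep_mor S R Q g \<longleftrightarrow> g \<in> tys R \<rightarrow>\<^sub>E tys Q \<and>
     (\<forall>j\<in>tops S. \<forall>us\<in>vecs (tys R) (tar S j). g (tyop R j us) = tyop Q j (map g us))"

text \<open>\<open>texps S n\<close> is \<open>S(n)\<close>; the variables are numbered from 0.\<close>

inductive_set texps :: "('a, 's) ssig_scheme \<Rightarrow> nat \<Rightarrow> 'a texp set"
  for S :: "('a, 's) ssig_scheme" and n :: nat where
  "i < n \<Longrightarrow> TVar i \<in> texps S n"
| "j \<in> tops S \<Longrightarrow> length es = tar S j \<Longrightarrow> (\<And>e. e \<in> set es \<Longrightarrow> e \<in> texps S n) \<Longrightarrow>
   TOp j es \<in> texps S n"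

primrec teval :: "('a, 'r) srep_scheme \<Rightarrow> 'a univ list \<Rightarrow> 'a texp \<Rightarrow> 'a univ" where
  "teval R u (TVar i) = u ! i"
| "teval R u (TOp j es) = tyop R j (map (teval R u) es)"


section \<open>Reduction monads and their modules\<close>

record 'a relmonad = "'a srep" +
  obj :: "'a ctx \<Rightarrow> 'a fam"
  unit :: "'a ctx \<Rightarrow> 'a mor"
  bind :: "'a ctx \<Rightarrow> 'a ctx \<Rightarrow> 'a mor \<Rightarrow> 'a mor"

definition reduction_monad ::
  "('a univ set \<Rightarrow> bool) \<Rightarrow> ('a, 'r) relmonad_scheme \<Rightarrow> bool" where
  "reduction_monad small P \<longleftrightarrow>
     (\<forall>V. ctx small (tys P) V \<longrightarrow>
        po_fam small (tys P) (obj P V) \<and>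
        unit P V \<in> fhom (disc V) (obj P V) \<and>
        bind P V V (unit P V) = fid (carrs (obj P V))) \<and>
     (\<forall>V W. ctx small (tys P) V \<and> ctx small (tys P) W \<longrightarrow>
        (\<forall>f \<in> fhom (disc V) (obj P W).
           bind P V W f \<in> fhom (obj P V) (obj P W) \<and>
           fcomp V (unit P V) (bind P V W f) = f) \<and>
        (\<forall>f \<in> fhom (disc V) (obj P W). \<forall>g \<in> fhom (disc V) (obj P W).
           fhom_le (disc V) (obj P W) f g \<longrightarrow>
           fhom_le (obj P V) (obj P W) (bind P V W f) (bind P V W g))) \<and>
     (\<forall>V W X. ctx small (tys P) V \<and> ctx small (tys P) W \<and> ctx small (tys P) X \<longrightarrow>
        (\<forall>f \<in> fhom (disc V) (obj P W). \<forall>g \<in> fhom (disc W) (obj P X).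
           fcomp (carrs (obj P V)) (bind P V W f) (bind P W X g) =
           bind P V X (fcomp V f (bind P W X g))))"

definition relative_S_monad ::
  "('a univ set \<Rightarrow> bool) \<Rightarrow> ('a, 's) ssig_scheme \<Rightarrow> ('a, 'r) relmonad_scheme \<Rightarrow> bool" where
  "relative_S_monad small S P \<longleftrightarrow> srep small S P \<and> reduction_monad small P"

definition lift ::
  "('a, 'r) relmonad_scheme \<Rightarrow> 'a ctx \<Rightarrow> 'a ctx \<Rightarrow> 'a mor \<Rightarrow> 'a mor" where
  "lift P V W h = bind P V W (fcomp V h (unit P W))"

text \<open>Modules with codomain preordered sets.\<close>

record 'a pmod =
  mobj :: "'a ctx \<Rightarrow> 'a preo"
  mbind :: "'a ctx \<Rightarrow> 'a ctx \<Rightarrow> 'a mor \<Rightarrow> 'a univ \<Rightarrow> 'a univ"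

definition pmod ::
  "('a univ set \<Rightarrow> bool) \<Rightarrow> ('a, 'r) relmonad_scheme \<Rightarrow> 'a pmod \<Rightarrow> bool" where
  "pmod small P M \<longleftrightarrow>
     (\<forall>V. ctx small (tys P) V \<longrightarrow>
        preo small (mobj M V) \<and>
        mbind M V V (unit P V) = (\<lambda>x\<in>carr (mobj M V). x)) \<and>
     (\<forall>V W. ctx small (tys P) V \<and> ctx small (tys P) W \<longrightarrow>
        (\<forall>f \<in> fhom (disc V) (obj P W). mbind M V W f \<in> phom (mobj M V) (mobj M W))) \<and>
     (\<forall>V W X. ctx small (tys P) V \<and> ctx small (tys P) W \<and> ctx small (tys P) X \<longrightarrow>
        (\<forall>f \<in> fhom (disc V) (obj P W). \<forall>g \<in> fhom (disc W) (obj P X).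
           compose (carr (mobj M V)) (mbind M W X g) (mbind M V W f) =
           mbind M V X (fcomp V f (bind P W X g))))"

definition pmod_mor ::
  "('a univ set \<Rightarrow> bool) \<Rightarrow> ('a, 'r) relmonad_scheme \<Rightarrow> 'a pmod \<Rightarrow> 'a pmod \<Rightarrow>
   ('a ctx \<Rightarrow> 'a univ \<Rightarrow> 'a univ) \<Rightarrow> bool" where
  "pmod_mor small P M N \<phi> \<longleftrightarrow>
     (\<forall>V. ctx small (tys P) V \<longrightarrow> \<phi> V \<in> phom (mobj M V) (mobj N V)) \<and>
     (\<forall>V W. ctx small (tys P) V \<and> ctx small (tys P) W \<longrightarrow>
        (\<forall>f \<in> fhom (disc V) (obj P W).
           compose (carr (mobj M V)) (\<phi> W) (mbind M V W f) =
           compose (carr (mobj M V)) (mbind N V W f) (\<phi> V)))"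

definition pmod_lift ::
  "('a, 'r) relmonad_scheme \<Rightarrow> 'a pmod \<Rightarrow> 'a ctx \<Rightarrow> 'a ctx \<Rightarrow> 'a mor \<Rightarrow> 'a univ \<Rightarrow> 'a univ" where
  "pmod_lift P M V W h = mbind M V W (fcomp V h (unit P W))"

text \<open>Modules with codomain families of preordered sets: the tautological module and
  its derivatives.\<close>

record 'a fmod =
  fobj :: "'a ctx \<Rightarrow> 'a fam"
  fbind :: "'a ctx \<Rightarrow> 'a ctx \<Rightarrow> 'a mor \<Rightarrow> 'a mor"

definition taut :: "('a, 'r) relmonad_scheme \<Rightarrow> 'a fmod" where
  "taut P = \<lparr>fobj = obj P, fbind = bind P\<rparr>"

definition shift ::
  "('a, 'r) relmonad_scheme \<Rightarrow> 'a univ \<Rightarrow> 'a ctx \<Rightarrow> 'a ctx \<Rightarrow> 'a mor \<Rightarrow> 'a mor" where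
  "shift P s V W f = (\<lambda>t. \<lambda>x\<in>addvar s V t.
     if x = fresh then unit P (addvar s W) t fresh
     else lift P W (addvar s W) (addvar_inl W) t (f t (unold x)))"

definition deriv_mod ::
  "('a, 'r) relmonad_scheme \<Rightarrow> 'a univ \<Rightarrow> 'a fmod \<Rightarrow> 'a fmod" where
  "deriv_mod P s M =
     \<lparr>fobj = (\<lambda>V. fobj M (addvar s V)),
      fbind = (\<lambda>V W f. fbind M (addvar s V) (addvar s W) (shift P s V W f))\<rparr>"

primrec derivs ::
  "('a, 'r) relmonad_scheme \<Rightarrow> 'a univ list \<Rightarrow> 'a fmod \<Rightarrow> 'a fmod" where
  "derivs P [] M = M"
| "derivs P (s # ss) M = deriv_mod P s (derivs P ss M)"

definition fmod_lift ::
  "('a, 'r) relmonad_scheme \<Rightarrow> 'a fmod \<Rightarrow> 'a ctx \<Rightarrow> 'a ctx \<Rightarrow> 'a mor \<Rightarrow> 'a mor" where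
  "fmod_lift P M V W h = fbind M V W (fcomp V h (unit P W))"

definition fibre :: "'a fmod \<Rightarrow> 'a univ \<Rightarrow> 'a pmod" where
  "fibre M t = \<lparr>mobj = (\<lambda>V. fobj M V t), mbind = (\<lambda>V W f. fbind M V W f t)\<rparr>"

text \<open>Finite products; the product of the empty list is the terminal module.\<close>

definition prod_preo :: "'a preo list \<Rightarrow> 'a preo" where
  "prod_preo Xs =
     \<lparr>carr = {Tuple xs | xs. list_all2 (\<lambda>x X. x \<in> carr X) xs Xs},
      leq = {(Tuple xs, Tuple ys) | xs ys. length xs = length Xs \<and> length ys = length Xs \<and>
               (\<forall>i < length Xs. (xs ! i, ys ! i) \<in> leq (Xs ! i))}\<rparr>"

definition prod_mod :: "'a pmod list \<Rightarrow> 'a pmod" where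
  "prod_mod Ms =
     \<lparr>mobj = (\<lambda>V. prod_preo (map (\<lambda>M. mobj M V) Ms)),
      mbind = (\<lambda>V W f. \<lambda>x\<in>carr (prod_preo (map (\<lambda>M. mobj M V) Ms)).
                 Tuple (map2 (\<lambda>M. mbind M V W f) Ms (comps x)))\<rparr>"


section \<open>Morphisms of relative monads over a signature for types\<close>

record 'a monad_mor =
  tmap :: "'a univ \<Rightarrow> 'a univ"
  cmap :: "'a ctx \<Rightarrow> 'a mor"

definition relative_S_monad_mor ::
  "('a univ set \<Rightarrow> bool) \<Rightarrow> ('a, 's) ssig_scheme \<Rightarrow>
   ('a, 'r) relmonad_scheme \<Rightarrow> ('a, 'q) relmonad_scheme \<Rightarrow> 'a monad_mor \<Rightarrow> bool" where
  "relative_S_monad_mor small S P Q m \<longleftrightarrow>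
     srep_mor S P Q (tmap m) \<and>
     cmap m \<in> extensional {V. ctx small (tys P) V} \<and>
     (\<forall>V. ctx small (tys P) V \<longrightarrow>
        cmap m V \<in> fhom (retype_fam (tmap m) (obj P V)) (obj Q (retype (tmap m) V)) \<and>
        fcomp (retype (tmap m) V) (retype_mor (tmap m) V (unit P V)) (cmap m V) =
        unit Q (retype (tmap m) V)) \<and>
     (\<forall>V W. ctx small (tys P) V \<and> ctx small (tys P) W \<longrightarrow>
        (\<forall>h \<in> fhom (disc V) (obj P W).
           fcomp (retype (tmap m) (carrs (obj P V)))
             (retype_mor (tmap m) (carrs (obj P V)) (bind P V W h)) (cmap m W) =
           fcomp (retype (tmap m) (carrs (obj P V)))
             (cmap m V)
             (bind Q (retype (tmap m) V) (retype (tmap m) W)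
                (fcomp (retype (tmap m) V) (retype_mor (tmap m) V h) (cmap m W)))))"

text \<open>Identity and composition.  The retyping along the identity, resp. along a composite, is
  only canonically isomorphic to the identity, resp. to the iterated retyping, so the underlying
  maps are composed with the renaming along these isomorphisms.\<close>

definition id_mor ::
  "('a univ set \<Rightarrow> bool) \<Rightarrow> ('a, 'r) relmonad_scheme \<Rightarrow> 'a monad_mor" where
  "id_mor small P = (let g = (\<lambda>t\<in>tys P. t) in
     \<lparr>tmap = g,
      cmap = (\<lambda>V\<in>{V. ctx small (tys P) V}. \<lambda>t. \<lambda>x\<in>retype g (carrs (obj P V)) t.
                lift P V (retype g V) (retype_unit V) t (val x))\<rparr>)"

definition comp_mor ::
  "('a univ set \<Rightarrow> bool) \<Rightarrow> ('a, 'p) relmonad_scheme \<Rightarrow> ('a, 'r) relmonad_scheme \<Rightarrow>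
   'a monad_mor \<Rightarrow> 'a monad_mor \<Rightarrow> 'a monad_mor" where
  "comp_mor small P R m m' =
     (let g = tmap m; g' = tmap m'; gg = compose (tys P) g' g in
     \<lparr>tmap = gg,
      cmap = (\<lambda>V\<in>{V. ctx small (tys P) V}. \<lambda>t. \<lambda>x\<in>retype gg (carrs (obj P V)) t.
                lift R (retype g' (retype g V)) (retype gg V) (retype_assoc g g' V) t
                  (cmap m' (retype g V) t (pair (g (idx x)) (cmap m V (g (idx x)) x))))\<rparr>)"

text \<open>The map induced by a morphism \<open>m\<close> into \<open>Q\<close> on the derivative of the tautological
  module by the sorts \<open>ss\<close>, in context \<open>V\<close> and at sort \<open>t\<close>.\<close>

primrec hat ::
  "('a, 'q) relmonad_scheme \<Rightarrow> 'a monad_mor \<Rightarrow> 'a univ list \<Rightarrow> 'a ctx \<Rightarrow> 'a mor" where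
  "hat Q m [] V t x = cmap m V (tmap m t) (pair t x)"
| "hat Q m (s # ss) V t x =
     fmod_lift Q (derivs Q (map (tmap m) ss) (taut Q))
       (retype (tmap m) (addvar s V)) (addvar (tmap m s) (retype (tmap m) V))
       (retype_addvar (tmap m) s V) (tmap m t)
       (hat Q m ss (addvar s V) t x)"

text \<open>A module over the target of \<open>m\<close> pulled back to a module over its source.\<close>

definition pull_mod :: "'a monad_mor \<Rightarrow> 'a pmod \<Rightarrow> 'a pmod" where
  "pull_mod m N =
     \<lparr>mobj = (\<lambda>V. mobj N (retype (tmap m) V)),
      mbind = (\<lambda>V W h. mbind N (retype (tmap m) V) (retype (tmap m) W)
                 (fcomp (retype (tmap m) V) (retype_mor (tmap m) V h) (cmap m W)))\<rparr>"


section \<open>Typed signatures and their representations\<close>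

type_synonym 'a dom_arity = "('a texp list \<times> 'a texp) list"

record 'a tsig = "'a ssig" +
  ars :: "'a univ set"
  deg :: "'a univ \<Rightarrow> nat"
  ar_dom :: "'a univ \<Rightarrow> 'a dom_arity"
  ar_cod :: "'a univ \<Rightarrow> 'a texp"

definition dom_arity :: "('a, 's) ssig_scheme \<Rightarrow> nat \<Rightarrow> 'a dom_arity \<Rightarrow> bool" where
  "dom_arity S n ds \<longleftrightarrow> (\<forall>(bs, t) \<in> set ds. set bs \<subseteq> texps S n \<and> t \<in> texps S n)"

definition typed_signature :: "('a univ set \<Rightarrow> bool) \<Rightarrow> 'a tsig \<Rightarrow> bool" where
  "typed_signature small \<Sigma> \<longleftrightarrow> small (tops \<Sigma>) \<and> small (ars \<Sigma>) \<and>
     (\<forall>k\<in>ars \<Sigma>. dom_arity \<Sigma> (deg \<Sigma> k) (ar_dom \<Sigma> k) \<and> ar_cod \<Sigma> k \<in> texps \<Sigma> (deg \<Sigma> k))"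

definition classic_mod ::
  "('a, 'r) relmonad_scheme \<Rightarrow> 'a dom_arity \<Rightarrow> 'a univ list \<Rightarrow> 'a pmod" where
  "classic_mod R ds u = prod_mod
     (map (\<lambda>(bs, t). fibre (derivs R (map (teval R u) bs) (taut R)) (teval R u t)) ds)"

text \<open>The componentwise action of a morphism \<open>m\<close> from \<open>P\<close> to \<open>Q\<close> on such a product.\<close>

definition classic_hat ::
  "('a, 'p) relmonad_scheme \<Rightarrow> ('a, 'q) relmonad_scheme \<Rightarrow> 'a monad_mor \<Rightarrow>
   'a dom_arity \<Rightarrow> 'a univ list \<Rightarrow> 'a ctx \<Rightarrow> 'a univ \<Rightarrow> 'a univ" where
  "classic_hat P Q m ds u V = (\<lambda>x\<in>carr (mobj (classic_mod P ds u) V).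
     Tuple (map2 (\<lambda>(bs, t). hat Q m (map (teval P u) bs) V (teval P u t)) ds (comps x)))"

record 'a rep = "'a relmonad" +
  oper :: "'a univ \<Rightarrow> 'a univ list \<Rightarrow> 'a ctx \<Rightarrow> 'a univ \<Rightarrow> 'a univ"

definition rep :: "('a univ set \<Rightarrow> bool) \<Rightarrow> 'a tsig \<Rightarrow> 'a rep \<Rightarrow> bool" where
  "rep small \<Sigma> R \<longleftrightarrow> relative_S_monad small \<Sigma> R \<and>
     (\<forall>k\<in>ars \<Sigma>. \<forall>u\<in>vecs (tys R) (deg \<Sigma> k).
        pmod_mor small R (classic_mod R (ar_dom \<Sigma> k) u)
          (fibre (taut R) (teval R u (ar_cod \<Sigma> k))) (oper R k u))"

definition rep_mor ::
  "('a univ set \<Rightarrow> bool) \<Rightarrow> 'a tsig \<Rightarrow> 'a rep \<Rightarrow> 'a rep \<Rightarrow> 'a monad_mor \<Rightarrow> bool" where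
  "rep_mor small \<Sigma> P R m \<longleftrightarrow> relative_S_monad_mor small \<Sigma> P R m \<and>
     (\<forall>k\<in>ars \<Sigma>. \<forall>u\<in>vecs (tys P) (deg \<Sigma> k). \<forall>V. ctx small (tys P) V \<longrightarrow>
        (\<forall>x \<in> carr (mobj (classic_mod P (ar_dom \<Sigma> k) u) V).
           hat R m [] V (teval P u (ar_cod \<Sigma> k)) (oper P k u V x) =
           oper R k (map (tmap m) u) (retype (tmap m) V)
             (classic_hat P R m (ar_dom \<Sigma> k) u V x)))"


section \<open>Inequations\<close>

text \<open>A functor from representations to modules of some degree \<open>n\<close> lying over the forgetful
  functor to relative monads: \<open>smod W R u\<close> is the \<open>R\<close>-module with index \<open>u\<close>, and
  \<open>smor W R R' m u\<close> is the module morphism into the pullback along \<open>m\<close> of the module with index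
  \<open>g(u)\<close> over \<open>R'\<close>.\<close>

record 'a sigmod =
  smod :: "'a rep \<Rightarrow> 'a univ list \<Rightarrow> 'a pmod"
  smor :: "'a rep \<Rightarrow> 'a rep \<Rightarrow> 'a monad_mor \<Rightarrow> 'a univ list \<Rightarrow> 'a ctx \<Rightarrow> 'a univ \<Rightarrow> 'a univ"

definition sigmod :: "('a univ set \<Rightarrow> bool) \<Rightarrow> 'a tsig \<Rightarrow> nat \<Rightarrow> 'a sigmod \<Rightarrow> bool" where
  "sigmod small \<Sigma> n W \<longleftrightarrow>
     (\<forall>R. rep small \<Sigma> R \<longrightarrow> (\<forall>u\<in>vecs (tys R) n.
        pmod small R (smod W R u) \<and>
        (\<forall>V. ctx small (tys R) V \<longrightarrow>
           smor W R R (id_mor small R) u V =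
           pmod_lift R (smod W R u) V (retype (tmap (id_mor small R)) V) (retype_unit V)))) \<and>
     (\<forall>R R' m. rep small \<Sigma> R \<and> rep small \<Sigma> R' \<and> rep_mor small \<Sigma> R R' m \<longrightarrow>
        (\<forall>u\<in>vecs (tys R) n.
           pmod_mor small R (smod W R u) (pull_mod m (smod W R' (map (tmap m) u)))
             (smor W R R' m u))) \<and>
     (\<forall>R R' R'' m m'. rep small \<Sigma> R \<and> rep small \<Sigma> R' \<and> rep small \<Sigma> R'' \<and>
        rep_mor small \<Sigma> R R' m \<and> rep_mor small \<Sigma> R' R'' m' \<longrightarrow>
        (\<forall>u\<in>vecs (tys R) n. \<forall>V. ctx small (tys R) V \<longrightarrow>
           (\<forall>y \<in> carr (mobj (smod W R u) V).
              smor W R R'' (comp_mor small R R'' m m') u V y =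
              pmod_lift R'' (smod W R'' (map (tmap m') (map (tmap m) u)))
                (retype (tmap m') (retype (tmap m) V))
                (retype (tmap (comp_mor small R R'' m m')) V)
                (retype_assoc (tmap m) (tmap m') V)
                (smor W R' R'' m' (map (tmap m) u) (retype (tmap m) V)
                   (smor W R R' m u V y)))))"

definition classic_sigmod :: "'a dom_arity \<Rightarrow> 'a sigmod" where
  "classic_sigmod ds =
     \<lparr>smod = (\<lambda>R. classic_mod R ds), smor = (\<lambda>R R' m. classic_hat R R' m ds)\<rparr>"

type_synonym 'a half_eq = "'a rep \<Rightarrow> 'a univ list \<Rightarrow> 'a ctx \<Rightarrow> 'a univ \<Rightarrow> 'a univ"

definition half_equation ::
  "('a univ set \<Rightarrow> bool) \<Rightarrow> 'a tsig \<Rightarrow> nat \<Rightarrow> 'a sigmod \<Rightarrow> 'a sigmod \<Rightarrow> 'a half_eq \<Rightarrow> bool" where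
  "half_equation small \<Sigma> n W W' \<alpha> \<longleftrightarrow>
     (\<forall>R. rep small \<Sigma> R \<longrightarrow>
        (\<forall>u\<in>vecs (tys R) n. pmod_mor small R (smod W R u) (smod W' R u) (\<alpha> R u))) \<and>
     (\<forall>R R' m. rep small \<Sigma> R \<and> rep small \<Sigma> R' \<and> rep_mor small \<Sigma> R R' m \<longrightarrow>
        (\<forall>u\<in>vecs (tys R) n. \<forall>V. ctx small (tys R) V \<longrightarrow>
           (\<forall>y \<in> carr (mobj (smod W R u) V).
              smor W' R R' m u V (\<alpha> R u V y) =
              \<alpha> R' (map (tmap m) u) (retype (tmap m) V) (smor W R R' m u V y))))"

record 'a ineq =
  ideg :: nat
  idom :: "'a sigmod"
  icod :: "'a sigmod"
  ilhs :: "'a half_eq"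
  irhs :: "'a half_eq"

definition inequation :: "('a univ set \<Rightarrow> bool) \<Rightarrow> 'a tsig \<Rightarrow> 'a ineq \<Rightarrow> bool" where
  "inequation small \<Sigma> q \<longleftrightarrow>
     sigmod small \<Sigma> (ideg q) (idom q) \<and> sigmod small \<Sigma> (ideg q) (icod q) \<and>
     half_equation small \<Sigma> (ideg q) (idom q) (icod q) (ilhs q) \<and>
     half_equation small \<Sigma> (ideg q) (idom q) (icod q) (irhs q)"

definition classic_inequation :: "('a univ set \<Rightarrow> bool) \<Rightarrow> 'a tsig \<Rightarrow> 'a ineq \<Rightarrow> bool" where
  "classic_inequation small \<Sigma> q \<longleftrightarrow> inequation small \<Sigma> q \<and>
     (\<exists>ds. dom_arity \<Sigma> (ideg q) ds \<and> icod q = classic_sigmod ds)"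

definition satisfies :: "('a univ set \<Rightarrow> bool) \<Rightarrow> 'a rep \<Rightarrow> 'a ineq \<Rightarrow> bool" where
  "satisfies small R q \<longleftrightarrow>
     (\<forall>u\<in>vecs (tys R) (ideg q). \<forall>V. ctx small (tys R) V \<longrightarrow>
        (\<forall>y \<in> carr (mobj (smod (idom q) R u) V).
           (ilhs q R u V y, irhs q R u V y) \<in> leq (mobj (smod (icod q) R u) V)))"

definition rep_2sig ::
  "('a univ set \<Rightarrow> bool) \<Rightarrow> 'a tsig \<Rightarrow> 'a ineq set \<Rightarrow> 'a rep \<Rightarrow> bool" where
  "rep_2sig small \<Sigma> A R \<longleftrightarrow> rep small \<Sigma> R \<and> (\<forall>q\<in>A. satisfies small R q)"

end

theory Submission
  imports Defs
begin

text \<open>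
  The initial object carries the terms of the signature in nested contexts, with substitution as
  its \<open>bind\<close>.  Every representation \<open>R\<close> interprets these terms, by a unique map compatible with
  units and operations; a term is below another if this holds for their interpretations in every
  representation satisfying \<open>A\<close>.  Substitution and the operations are then monotone because their
  interpretations are.  Since half-equations are natural and the canonical maps on classic modules
  are interpretations followed by renamings along bijections, hence reflect the preorder, the terms
  satisfy \<open>A\<close> themselves.

  Substitution lemmas, compatibility of interpretation with substitution, and compatibility of
  interpretation with \<open>bind\<close> of \<open>R\<close> are all instances of one fusion law for structural recursion
  on terms.
\<close>


section \<open>Small sets\<close>

text \<open>A representation carries a preorder, so no quotient of terms is needed: \<open>A\<close>
  enters through \<open>term_le\<close> alone, while carriers, substitution and operations are those
  of the bare signature. There is no circularity in using half-equations to show that the terms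
  satisfy \<open>A\<close>: naturality ranges over all representations of the signature, so it
  applies to the canonical morphism out of the terms as soon as these form a representation.

  Binding is the obstacle. Interpretation lands in a retyped context, and
  \<open>retype g (addvar s V)\<close> is merely isomorphic to
  \<open>addvar (g s) (retype g V)\<close>. A term under binders thus has two interpretations:
  \<open>interp\<close>, in the retyping of the extended context, by which \<open>term_le\<close> is
  defined, and \<open>hat\<close>, in the extension of the retyped context, which the operations of
  \<open>R\<close> take as arguments. Monotone operations need the step from \<open>interp\<close>
  to \<open>hat\<close> to preserve the order; the inequations need it to reflect the order.

  Substitution under a binder needs weakening, which would itself be a substitution; renaming comes
  first to break this circle.\<close>

inductive_set tuple_closure :: "'a univ set \<Rightarrow> 'a univ set" for B where
  base: "b \<in> B \<Longrightarrow> b \<in> tuple_closure B"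
| Tuple: "(\<And>x. x \<in> set xs \<Longrightarrow> x \<in> tuple_closure B) \<Longrightarrow> Tuple xs \<in> tuple_closure B"

primrec tuple_level :: "'a univ set \<Rightarrow> nat \<Rightarrow> 'a univ set" where
  "tuple_level B 0 = B"
| "tuple_level B (Suc n) = tuple_level B n \<union> Tuple ` lists (tuple_level B n)"

lemma tuple_level_mono: "m \<le> n \<Longrightarrow> tuple_level B m \<subseteq> tuple_level B n"
  by (induction n) (auto simp: le_Suc_eq)

lemma tuple_closure_subset_levels: "tuple_closure B \<subseteq> (\<Union>n. tuple_level B n)"
proof
  fix x assume "x \<in> tuple_closure B"
  then show "x \<in> (\<Union>n. tuple_level B n)"
  proof induction
    case (base b)
    then show ?case by (auto intro: exI[of _ 0])
  next
    case (Tuple xs)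
    then have "\<forall>x\<in>set xs. \<exists>n. x \<in> tuple_level B n" by blast
    then obtain f where f: "\<forall>x\<in>set xs. x \<in> tuple_level B (f x)" by metis
    define N where "N = Max (insert 0 (f ` set xs))"
    have "x \<in> tuple_level B N" if "x \<in> set xs" for x
      using f that tuple_level_mono[of "f x" N B] by (auto simp: N_def)
    then have "Tuple xs \<in> tuple_level B (Suc N)" by auto
    then show ?case by blast
  qed
qed

context
  fixes small :: "'a univ set \<Rightarrow> bool"
  assumes univ: "set_universe small"
begin

lemma small_subset: "small A \<Longrightarrow> B \<subseteq> A \<Longrightarrow> small B"
  using univ by (auto simp: set_universe_def)

lemma small_image: "small A \<Longrightarrow> small (f ` A)"
  using univ by (auto simp: set_universe_def)

lemma small_UNION: "small A \<Longrightarrow> (\<And>a. a \<in> A \<Longrightarrow> small (F a)) \<Longrightarrow> small (\<Union>a\<in>A. F a)"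
  using univ unfolding set_universe_def by blast

text \<open>The axioms speak of small index sets only. An infinite small set contains a copy of the
  natural numbers, and that copy serves as index set.\<close>

lemma small_UNION_nat:
  assumes "\<And>n::nat. small (F n)"
  shows "small (\<Union>n. F n)"
proof -
  obtain A where A: "small A" "infinite A"
    using univ by (auto simp: set_universe_def)
  then obtain c :: "nat \<Rightarrow> 'a univ" where c: "inj c" "range c \<subseteq> A"
    using infinite_countable_subset by blast
  have "small (\<Union>a\<in>range c. F (inv c a))"
    using small_subset[OF A(1) c(2)] assms by (rule small_UNION)
  then show ?thesis using c(1) by simp
qed

lemma small_Un:
  assumes "small A" "small B"
  shows "small (A \<union> B)"
proof -
  have "small (\<Union>n::nat. if n = 0 then A else B)"
    using assms by (intro small_UNION_nat) auto
  moreover have "A \<union> B \<subseteq> (\<Union>n::nat. if n = 0 then A else B)"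
    by (auto split: if_splits intro: exI[of _ "0::nat"] exI[of _ "1::nat"])
  ultimately show ?thesis by (rule small_subset)
qed

lemma small_singleton: "small {a}"
proof -
  obtain A where A: "small A" "infinite A"
    using univ by (auto simp: set_universe_def)
  then have "A \<noteq> {}" by auto
  then have "(\<lambda>_. a) ` A = {a}" by auto
  then show ?thesis using small_image[OF A(1)] by metis
qed

text \<open>By length: the tuples of length \<open>Suc n\<close> are covered by the union, over
  their first component, of images of the tuples of length \<open>n\<close>.\<close>

lemma small_Tuple_lists:
  assumes "small A"
  shows "small (Tuple ` lists A)"
proof -
  have "small (Tuple ` vecs A n)" for n
  proof (induction n)
    case 0
    have "Tuple ` vecs A 0 \<subseteq> {Tuple []}" by (auto simp: vecs_def)
    then show ?case using small_singleton small_subset by blast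
  next
    case (Suc n)
    have "small (\<Union>a\<in>A. (\<lambda>x. Tuple (a # comps x)) ` Tuple ` vecs A n)"
      using assms Suc by (intro small_UNION small_image)
    moreover have "Tuple ` vecs A (Suc n) \<subseteq> (\<Union>a\<in>A. (\<lambda>x. Tuple (a # comps x)) ` Tuple ` vecs A n)"
      by (force simp: vecs_def length_Suc_conv image_iff)
    ultimately show ?case by (rule small_subset)
  qed
  then have "small (\<Union>n. Tuple ` vecs A n)" by (rule small_UNION_nat)
  moreover have "Tuple ` lists A \<subseteq> (\<Union>n. Tuple ` vecs A n)"
    by (auto simp: vecs_def)
  ultimately show ?thesis by (rule small_subset)
qed

text \<open>Bounds the set of closed types and each set of terms, both of which consist of
  hereditary tuples over a small set. The closure is exhausted by countably many stages.\<close>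

lemma small_tuple_closure:
  assumes "small B"
  shows "small (tuple_closure B)"
proof -
  have "small (tuple_level B n)" for n
    by (induction n) (auto intro: assms small_Un small_Tuple_lists)
  then show ?thesis
    by (intro small_subset[OF small_UNION_nat tuple_closure_subset_levels])
qed

text \<open>One fibre of the retyped family may collect variables from all sorts sent to
  \<open>t'\<close>, hence the appeal to smallness of \<open>T\<close>.\<close>

lemma ctx_retype:
  assumes g: "g \<in> T \<rightarrow>\<^sub>E T'" and T: "small T" and V: "ctx small T V"
  shows "ctx small T' (retype g V)"
proof -
  have "small (retype g V t')" for t'
  proof (rule small_subset)
    show "small (\<Union>t\<in>T. pair t ` V t)"
      using T V by (intro small_UNION small_image) (auto simp: ctx_def)
    show "retype g V t' \<subseteq> (\<Union>t\<in>T. pair t ` V t)"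
      using V by (force simp: retype_def ctx_def)
  qed
  moreover have "retype g V t' = {}" if "t' \<notin> T'" for t'
    using g V that by (force simp: retype_def ctx_def)
  ultimately show ?thesis by (auto simp: ctx_def)
qed

lemma ctx_addvar: "ctx small T V \<Longrightarrow> s \<in> T \<Longrightarrow> ctx small T (addvar s V)"
  unfolding ctx_def addvar_def
  by (auto simp del: Un_insert_right intro!: small_Un small_image small_singleton)

end


section \<open>Closed types and terms\<close>

lemma idx_val_pair [simp]: "idx (pair t v) = t" "val (pair t v) = v"
  by (auto simp: idx_def val_def pair_def)

lemma pair_eq_iff [simp]: "pair t v = pair t' v' \<longleftrightarrow> t = t' \<and> v = v'"
  by (auto simp: pair_def)

lemma old_simps [simp]: "unold (old v) = v" "old v \<noteq> fresh" "fresh \<noteq> old v"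
  by (auto simp: old_def unold_def fresh_def)

lemma old_eq_iff [simp]: "old v = old w \<longleftrightarrow> v = w"
  by (auto simp: old_def)

text \<open>The head of the list is adjoined first; this is the order in which \<open>derivs\<close>
  unfolds (\<open>fobj_derivs\<close>).\<close>

primrec addvars :: "'a univ list \<Rightarrow> 'a ctx \<Rightarrow> 'a ctx" where
  "addvars [] V = V"
| "addvars (s # ss) V = addvars ss (addvar s V)"

lemma addvar_cases:
  assumes "x \<in> addvar s V t"
  obtains v where "x = old v" "v \<in> V t" | "x = fresh" "t = s"
  using assms by (auto simp: addvar_def split: if_splits)

lemma old_in_addvar [simp]: "old v \<in> addvar s V t \<longleftrightarrow> v \<in> V t"
  by (auto simp: addvar_def)

lemma fresh_in_addvar [simp]: "fresh \<in> addvar s V t \<longleftrightarrow> t = s"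
  by (auto simp: addvar_def)

text \<open>The initial representation of the signature for types, each type coded as a tuple headed
  by its operation symbol.\<close>

inductive_set ctys :: "('a, 's) ssig_scheme \<Rightarrow> 'a univ set" for S where
  "j \<in> tops S \<Longrightarrow> length us = tar S j \<Longrightarrow> (\<And>u. u \<in> set us \<Longrightarrow> u \<in> ctys S) \<Longrightarrow>
   Tuple (j # us) \<in> ctys S"

text \<open>This is \<open>teval\<close> for the initial representation
  (\<open>teval_tuple\<close>), made available before the term representation is defined.\<close>

primrec tinst :: "'a univ list \<Rightarrow> 'a texp \<Rightarrow> 'a univ" where
  "tinst u (TVar i) = u ! i"
| "tinst u (TOp j es) = Tuple (j # map (tinst u) es)"

lemma tinst_ctys:
  assumes "e \<in> texps S n" "u \<in> vecs (ctys S) n"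
  shows "tinst u e \<in> ctys S"
  using assms by induction (auto simp: vecs_def intro!: ctys.intros)

lemma teval_tuple: "tyop R = (\<lambda>j us. Tuple (j # us)) \<Longrightarrow> teval R u e = tinst u e"
  by (induction e) (auto cong: map_cong)

fun cty_eval :: "('a, 'r) srep_scheme \<Rightarrow> 'a univ \<Rightarrow> 'a univ" where
  "cty_eval R (Tuple (j # us)) = tyop R j (map (cty_eval R) us)"
| "cty_eval R _ = undefined"

text \<open>The initial morphism on types; the restriction makes it extensional, as
  \<open>srep_mor\<close> requires.\<close>

definition ty_map :: "('a, 's) ssig_scheme \<Rightarrow> ('a, 'r) srep_scheme \<Rightarrow> 'a univ \<Rightarrow> 'a univ" where
  "ty_map S R = (\<lambda>t\<in>ctys S. cty_eval R t)"

lemma cty_eval_tys: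
  assumes "srep small S R" "t \<in> ctys S"
  shows "cty_eval R t \<in> tys R"
  using assms(2)
proof induction
  case (1 j us)
  then have "map (cty_eval R) us \<in> vecs (tys R) (tar S j)" by (auto simp: vecs_def)
  then show ?case using 1(1) assms(1) by (auto simp: srep_def)
qed

lemma ty_map_tys: "srep small S R \<Longrightarrow> t \<in> ctys S \<Longrightarrow> ty_map S R t \<in> tys R"
  by (simp add: ty_map_def cty_eval_tys)

lemma ty_map_tinst:
  assumes "e \<in> texps S n" "u \<in> vecs (ctys S) n"
  shows "ty_map S R (tinst u e) = teval R (map (ty_map S R) u) e"
  using assms
proof induction
  case (2 j es)
  have "tinst u (TOp j es) \<in> ctys S"
    using 2 by (intro tinst_ctys) (auto intro: texps.intros)
  moreover have "cty_eval R (tinst u e) = teval R (map (ty_map S R) u) e" if "e \<in> set es" for e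
    using 2(4)[OF that 2(5)] tinst_ctys[OF 2(3)[OF that] 2(5)]
    by (subst (asm) ty_map_def) simp
  ultimately show ?case by (simp add: ty_map_def cong: map_cong)
qed (auto simp: vecs_def)

text \<open>Variables are tuples of length one and operations have length at least two, so the two
  never clash, even for an operation without arguments. The instantiating types \<open>u\<close> are
  stored next to \<open>k\<close>. The sort is not stored, and a variable does not determine it
  because different fibres of a context may overlap; this is why \<open>ev\<close> and assignments
  take the sort as an argument.\<close>

inductive tm :: "'a tsig \<Rightarrow> 'a ctx \<Rightarrow> 'a univ \<Rightarrow> 'a univ \<Rightarrow> bool" for \<Sigma> where
  var: "t \<in> ctys \<Sigma> \<Longrightarrow> v \<in> V t \<Longrightarrow> tm \<Sigma> V t (Tuple [v])"
| op: "k \<in> ars \<Sigma> \<Longrightarrow> u \<in> vecs (ctys \<Sigma>) (deg \<Sigma> k) \<Longrightarrow>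
    list_all2 (\<lambda>d x. tm \<Sigma> (addvars (map (tinst u) (fst d)) V) (tinst u (snd d)) x)
      (ar_dom \<Sigma> k) xs \<Longrightarrow>
    tm \<Sigma> V (tinst u (ar_cod \<Sigma> k)) (Tuple (k # Tuple u # xs))"

text \<open>A model interprets terms in \<open>mcar\<close>, but only those of \<open>menv\<close> may be assigned to variables:
  this lets renamings, which have no weakening of arbitrary terms yet, be a model.
  All sorts are closed types.\<close>

record 'a model =
  mctx :: "'a ctx set"
  mext :: "'a univ \<Rightarrow> 'a ctx \<Rightarrow> 'a ctx"
  mfresh :: "'a univ \<Rightarrow> 'a ctx \<Rightarrow> 'a univ"
  mwk :: "'a univ \<Rightarrow> 'a ctx \<Rightarrow> 'a mor"
  mop :: "'a univ \<Rightarrow> 'a univ list \<Rightarrow> 'a ctx \<Rightarrow> 'a univ list \<Rightarrow> 'a univ"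
  menv :: "'a ctx \<Rightarrow> 'a ctx"
  mcar :: "'a ctx \<Rightarrow> 'a ctx"

primrec mexts :: "'a model \<Rightarrow> 'a univ list \<Rightarrow> 'a ctx \<Rightarrow> 'a ctx" where
  "mexts M [] W = W"
| "mexts M (s # ss) W = mexts M ss (mext M s W)"

definition mshift :: "'a model \<Rightarrow> 'a univ \<Rightarrow> 'a ctx \<Rightarrow> 'a mor \<Rightarrow> 'a mor" where
  "mshift M s W \<rho> t x = (if x = fresh then mfresh M s W else mwk M s W t (\<rho> t (unold x)))"

primrec mshifts :: "'a model \<Rightarrow> 'a univ list \<Rightarrow> 'a ctx \<Rightarrow> 'a mor \<Rightarrow> 'a mor" where
  "mshifts M [] W \<rho> = \<rho>"
| "mshifts M (s # ss) W \<rho> = mshifts M ss (mext M s W) (mshift M s W \<rho>)"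

text \<open>Termination of \<open>ev\<close>, whose recursive calls reach the arguments through a
  \<open>zip\<close> with the arity.\<close>

lemma size_zip_Tuple [termination_simp]:
  assumes "(d, y) \<in> set (zip ds xs)"
  shows "size y < Suc (Suc (Suc (Suc (a + (b + size_list size xs)))))"
  using size_list_estimation'[OF set_zip_rightD[OF assms], of "size y" size] by simp

fun ev :: "'a tsig \<Rightarrow> 'a model \<Rightarrow> 'a ctx \<Rightarrow> 'a mor \<Rightarrow> 'a mor" where
  "ev \<Sigma> M W \<rho> t (Tuple [v]) = \<rho> t v"
| "ev \<Sigma> M W \<rho> t (Tuple (k # Tuple u # xs)) = mop M k u W
     (map2 (\<lambda>d x. ev \<Sigma> M (mexts M (map (tinst u) (fst d)) W)
        (mshifts M (map (tinst u) (fst d)) W \<rho>) (tinst u (snd d)) x) (ar_dom \<Sigma> k) xs)"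
| "ev \<Sigma> M W \<rho> t _ = undefined"

lemma mshift_simps [simp]:
  "mshift M s W \<rho> t fresh = mfresh M s W"
  "mshift M s W \<rho> t (old v) = mwk M s W t (\<rho> t v)"
  by (auto simp: mshift_def)

definition model :: "'a tsig \<Rightarrow> 'a model \<Rightarrow> bool" where
  "model \<Sigma> M \<longleftrightarrow> (\<forall>W\<in>mctx M.
     (\<forall>s\<in>ctys \<Sigma>. mext M s W \<in> mctx M \<and> mfresh M s W \<in> menv M (mext M s W) s \<and>
        (\<forall>t\<in>ctys \<Sigma>. \<forall>y\<in>menv M W t. mwk M s W t y \<in> menv M (mext M s W) t)) \<and>
     (\<forall>t\<in>ctys \<Sigma>. menv M W t \<subseteq> mcar M W t) \<and>
     (\<forall>k\<in>ars \<Sigma>. \<forall>u\<in>vecs (ctys \<Sigma>) (deg \<Sigma> k). \<forall>xs.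
        list_all2 (\<lambda>d x. x \<in> mcar M (mexts M (map (tinst u) (fst d)) W) (tinst u (snd d)))
          (ar_dom \<Sigma> k) xs \<longrightarrow>
        mop M k u W xs \<in> mcar M W (tinst u (ar_cod \<Sigma> k))))"

lemma modelD:
  assumes "model \<Sigma> M" "W \<in> mctx M"
  shows "s \<in> ctys \<Sigma> \<Longrightarrow> mext M s W \<in> mctx M"
    and "s \<in> ctys \<Sigma> \<Longrightarrow> mfresh M s W \<in> menv M (mext M s W) s"
    and "s \<in> ctys \<Sigma> \<Longrightarrow> t \<in> ctys \<Sigma> \<Longrightarrow> y \<in> menv M W t \<Longrightarrow>
      mwk M s W t y \<in> menv M (mext M s W) t"
    and "t \<in> ctys \<Sigma> \<Longrightarrow> y \<in> menv M W t \<Longrightarrow> y \<in> mcar M W t"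
    and "k \<in> ars \<Sigma> \<Longrightarrow> u \<in> vecs (ctys \<Sigma>) (deg \<Sigma> k) \<Longrightarrow>
      list_all2 (\<lambda>d x. x \<in> mcar M (mexts M (map (tinst u) (fst d)) W) (tinst u (snd d)))
        (ar_dom \<Sigma> k) xs \<Longrightarrow>
      mop M k u W xs \<in> mcar M W (tinst u (ar_cod \<Sigma> k))"
  using assms unfolding model_def by blast+

definition menvs :: "'a tsig \<Rightarrow> 'a model \<Rightarrow> 'a ctx \<Rightarrow> 'a ctx \<Rightarrow> 'a mor set" where
  "menvs \<Sigma> M V W = {\<rho>. \<forall>t\<in>ctys \<Sigma>. \<forall>v\<in>V t. \<rho> t v \<in> menv M W t}"

lemma map2_cong_all2:
  "list_all2 P ds xs \<Longrightarrow> (\<And>d x. d \<in> set ds \<Longrightarrow> P d x \<Longrightarrow> f d x = g d x) \<Longrightarrow>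
   map2 f ds xs = map2 g ds xs"
  by (induction rule: list_all2_induct) auto

lemma map2_map2: "map2 f ds (map2 g ds xs) = map2 (\<lambda>d x. f d (g d x)) ds xs"
  by (induction ds xs rule: list_induct2') auto

lemma list_all2_map2:
  "list_all2 P ds xs \<Longrightarrow> (\<And>d x. d \<in> set ds \<Longrightarrow> P d x \<Longrightarrow> Q d (f d x)) \<Longrightarrow>
   list_all2 Q ds (map2 f ds xs)"
  by (induction rule: list_all2_induct) auto

lemma mshift_cong:
  assumes "\<forall>t\<in>T. \<forall>v\<in>V t. \<rho> t v = \<rho>' t v"
  shows "\<forall>t\<in>T. \<forall>v\<in>addvar s V t. mshift M s W \<rho> t v = mshift M s W \<rho>' t v"
  using assms by (auto elim!: addvar_cases)

lemma mshifts_cong: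
  assumes "\<forall>t\<in>T. \<forall>v\<in>V t. \<rho> t v = \<rho>' t v"
  shows "\<forall>t\<in>T. \<forall>v\<in>addvars ss V t. mshifts M ss W \<rho> t v = mshifts M ss W \<rho>' t v"
  using assms
proof (induction ss arbitrary: V W \<rho> \<rho>')
  case (Cons s ss)
  from Cons.IH[OF mshift_cong[OF Cons.prems]] show ?case by simp
qed simp

text \<open>Assignments are total functions, so two of them can be expected to agree only on the
  variables of the context. All later exchanges of assignments go through this lemma.\<close>

lemma ev_cong:
  assumes "tm \<Sigma> V t x" "\<forall>t\<in>ctys \<Sigma>. \<forall>v\<in>V t. \<rho> t v = \<rho>' t v"
  shows "ev \<Sigma> M W \<rho> t x = ev \<Sigma> M W \<rho>' t x"
  using assms
proof (induction arbitrary: W \<rho> \<rho>')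
  case (op k u V xs)
  have "map2 (\<lambda>d x. ev \<Sigma> M (mexts M (map (tinst u) (fst d)) W)
        (mshifts M (map (tinst u) (fst d)) W \<rho>) (tinst u (snd d)) x) (ar_dom \<Sigma> k) xs =
      map2 (\<lambda>d x. ev \<Sigma> M (mexts M (map (tinst u) (fst d)) W)
        (mshifts M (map (tinst u) (fst d)) W \<rho>') (tinst u (snd d)) x) (ar_dom \<Sigma> k) xs"
    using op.IH by (rule map2_cong_all2) (use mshifts_cong[OF op.prems] in blast)
  then show ?case by (simp only: ev.simps)
qed auto

context
  fixes \<Sigma> :: "'a tsig" and small
  assumes sig: "typed_signature small \<Sigma>"
begin

lemma arity_sorts:
  assumes "k \<in> ars \<Sigma>" "u \<in> vecs (ctys \<Sigma>) (deg \<Sigma> k)"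
  shows "d \<in> set (ar_dom \<Sigma> k) \<Longrightarrow> set (map (tinst u) (fst d)) \<subseteq> ctys \<Sigma>"
    and "d \<in> set (ar_dom \<Sigma> k) \<Longrightarrow> tinst u (snd d) \<in> ctys \<Sigma>"
    and "tinst u (ar_cod \<Sigma> k) \<in> ctys \<Sigma>"
proof -
  have "dom_arity \<Sigma> (deg \<Sigma> k) (ar_dom \<Sigma> k)" "ar_cod \<Sigma> k \<in> texps \<Sigma> (deg \<Sigma> k)"
    using sig assms(1) by (auto simp: typed_signature_def)
  then show "d \<in> set (ar_dom \<Sigma> k) \<Longrightarrow> set (map (tinst u) (fst d)) \<subseteq> ctys \<Sigma>"
    and "d \<in> set (ar_dom \<Sigma> k) \<Longrightarrow> tinst u (snd d) \<in> ctys \<Sigma>"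
    and "tinst u (ar_cod \<Sigma> k) \<in> ctys \<Sigma>"
    using assms(2) by (fastforce simp: dom_arity_def intro: tinst_ctys)+
qed

lemma tm_sort: "tm \<Sigma> V t x \<Longrightarrow> t \<in> ctys \<Sigma>"
  by (induction rule: tm.induct) (auto intro: arity_sorts)

lemma mexts_mctx:
  "model \<Sigma> M \<Longrightarrow> set ss \<subseteq> ctys \<Sigma> \<Longrightarrow> W \<in> mctx M \<Longrightarrow> mexts M ss W \<in> mctx M"
  by (induction ss arbitrary: W) (auto dest: modelD(1))

lemma mshift_menvs:
  "model \<Sigma> M \<Longrightarrow> s \<in> ctys \<Sigma> \<Longrightarrow> W \<in> mctx M \<Longrightarrow> \<rho> \<in> menvs \<Sigma> M V W \<Longrightarrow>
   mshift M s W \<rho> \<in> menvs \<Sigma> M (addvar s V) (mext M s W)"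
  by (auto simp: menvs_def elim!: addvar_cases intro!: modelD(2,3))

lemma mshifts_menvs:
  "model \<Sigma> M \<Longrightarrow> set ss \<subseteq> ctys \<Sigma> \<Longrightarrow> W \<in> mctx M \<Longrightarrow> \<rho> \<in> menvs \<Sigma> M V W \<Longrightarrow>
   mshifts M ss W \<rho> \<in> menvs \<Sigma> M (addvars ss V) (mexts M ss W)"
proof (induction ss arbitrary: W V \<rho>)
  case (Cons s ss)
  then show ?case using mshift_menvs[of M s W \<rho> V] by (auto dest: modelD(1))
qed simp

lemma ev_mcar:
  assumes "tm \<Sigma> V t x" "model \<Sigma> M" "W \<in> mctx M" "\<rho> \<in> menvs \<Sigma> M V W"
  shows "ev \<Sigma> M W \<rho> t x \<in> mcar M W t"
  using assms
proof (induction arbitrary: W \<rho>)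
  case (var t v V)
  then show ?case by (auto simp: menvs_def intro: modelD(4))
next
  case (op k u V xs)
  note d = arity_sorts[OF op.hyps]
  have "list_all2 (\<lambda>d x. x \<in> mcar M (mexts M (map (tinst u) (fst d)) W) (tinst u (snd d)))
      (ar_dom \<Sigma> k) (map2 (\<lambda>d x. ev \<Sigma> M (mexts M (map (tinst u) (fst d)) W)
        (mshifts M (map (tinst u) (fst d)) W \<rho>) (tinst u (snd d)) x) (ar_dom \<Sigma> k) xs)"
    using op.IH op.prems d
    by (elim list_all2_map2) (blast intro: mexts_mctx mshifts_menvs)
  then show ?case using op.hyps op.prems by (simp only: ev.simps modelD(5))
qed

text \<open>An index \<open>i\<close> records a stage of a comparison \<open>H i\<close> from
  \<open>A\<close> in context \<open>WA i\<close> to \<open>B\<close> in context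
  \<open>WB i\<close>; \<open>nxt s\<close> is the stage reached under a binder of sort
  \<open>s\<close>. The conditions on fresh variables and on weakening say exactly that shifting an
  assignment commutes with transporting it along \<open>H\<close>, and this iterates over a list of
  binders.\<close>

lemma fusion_mshifts:
  assumes A: "model \<Sigma> A"
    and nxt: "\<And>i s. i \<in> K \<Longrightarrow> s \<in> ctys \<Sigma> \<Longrightarrow> nxt s i \<in> K \<and>
      WA (nxt s i) = mext A s (WA i) \<and> WB (nxt s i) = mext B s (WB i) \<and>
      H (nxt s i) s (mfresh A s (WA i)) = mfresh B s (WB i)"
    and ctx: "\<And>i. i \<in> K \<Longrightarrow> WA i \<in> mctx A"
    and wk: "\<And>i s t y. i \<in> K \<Longrightarrow> s \<in> ctys \<Sigma> \<Longrightarrow> t \<in> ctys \<Sigma> \<Longrightarrow> y \<in> menv A (WA i) t \<Longrightarrow>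
      H (nxt s i) t (mwk A s (WA i) t y) = mwk B s (WB i) t (H i t y)"
    and "i \<in> K" "set ss \<subseteq> ctys \<Sigma>" "\<rho> \<in> menvs \<Sigma> A V (WA i)"
  shows "fold nxt ss i \<in> K \<and> WA (fold nxt ss i) = mexts A ss (WA i) \<and>
    WB (fold nxt ss i) = mexts B ss (WB i) \<and>
    (\<forall>t\<in>ctys \<Sigma>. \<forall>v\<in>addvars ss V t. mshifts B ss (WB i) (\<lambda>t v. H i t (\<rho> t v)) t v =
       H (fold nxt ss i) t (mshifts A ss (WA i) \<rho> t v))"
  using assms(5-)
proof (induction ss arbitrary: i V \<rho>)
  case (Cons s ss)
  have s: "s \<in> ctys \<Sigma>" using Cons.prems by simp
  note n = nxt[OF Cons.prems(1) s]
  have env: "mshift A s (WA i) \<rho> \<in> menvs \<Sigma> A (addvar s V) (WA (nxt s i))"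
    using mshift_menvs[OF A s ctx Cons.prems(3)] Cons.prems(1) n by simp
  note IH = Cons.IH[OF _ _ env]
  have "\<forall>t\<in>ctys \<Sigma>. \<forall>v\<in>addvar s V t. mshift B s (WB i) (\<lambda>t v. H i t (\<rho> t v)) t v =
      H (nxt s i) t (mshift A s (WA i) \<rho> t v)"
    using n wk[OF Cons.prems(1) s] Cons.prems(3)
    by (auto simp: menvs_def elim!: addvar_cases)
  from mshifts_cong[OF this] show ?case
    using IH n Cons.prems by simp
qed simp

text \<open>A family \<open>H\<close> that respects fresh variables, weakening and operations acts
  like a homomorphism of models, and homomorphisms commute with evaluation. Indexing by
  \<open>K\<close> is essential because \<open>H\<close> itself changes under binders, for instance
  when \<open>H\<close> is a substitution. Weakening has to be respected on \<open>menv\<close>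
  only, operations on \<open>mcar\<close>.\<close>

lemma fusion:
  assumes A: "model \<Sigma> A"
    and nxt: "\<And>i s. i \<in> K \<Longrightarrow> s \<in> ctys \<Sigma> \<Longrightarrow> nxt s i \<in> K \<and>
      WA (nxt s i) = mext A s (WA i) \<and> WB (nxt s i) = mext B s (WB i) \<and>
      H (nxt s i) s (mfresh A s (WA i)) = mfresh B s (WB i)"
    and ctx: "\<And>i. i \<in> K \<Longrightarrow> WA i \<in> mctx A"
    and wk: "\<And>i s t y. i \<in> K \<Longrightarrow> s \<in> ctys \<Sigma> \<Longrightarrow> t \<in> ctys \<Sigma> \<Longrightarrow> y \<in> menv A (WA i) t \<Longrightarrow>
      H (nxt s i) t (mwk A s (WA i) t y) = mwk B s (WB i) t (H i t y)"
    and hop: "\<And>i k u xs. i \<in> K \<Longrightarrow> k \<in> ars \<Sigma> \<Longrightarrow> u \<in> vecs (ctys \<Sigma>) (deg \<Sigma> k) \<Longrightarrow>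
      list_all2 (\<lambda>d x. x \<in> mcar A (mexts A (map (tinst u) (fst d)) (WA i)) (tinst u (snd d)))
        (ar_dom \<Sigma> k) xs \<Longrightarrow>
      H i (tinst u (ar_cod \<Sigma> k)) (mop A k u (WA i) xs) = mop B k u (WB i)
        (map2 (\<lambda>d x. H (fold nxt (map (tinst u) (fst d)) i) (tinst u (snd d)) x) (ar_dom \<Sigma> k) xs)"
    and tm: "tm \<Sigma> V t x"
    and "i \<in> K" "\<rho> \<in> menvs \<Sigma> A V (WA i)"
  shows "ev \<Sigma> B (WB i) (\<lambda>t v. H i t (\<rho> t v)) t x = H i t (ev \<Sigma> A (WA i) \<rho> t x)"
  using tm assms(7-)
proof (induction arbitrary: i \<rho>)
  case (op k u V xs)
  note d = arity_sorts[OF op.hyps]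
  let ?ss = "\<lambda>d. map (tinst u) (fst d)"
  let ?a = "\<lambda>d x. ev \<Sigma> A (mexts A (?ss d) (WA i)) (mshifts A (?ss d) (WA i) \<rho>) (tinst u (snd d)) x"
  have sh: "fold nxt (?ss d) i \<in> K \<and> WA (fold nxt (?ss d) i) = mexts A (?ss d) (WA i) \<and>
    WB (fold nxt (?ss d) i) = mexts B (?ss d) (WB i) \<and>
    (\<forall>t\<in>ctys \<Sigma>. \<forall>v\<in>addvars (?ss d) V t. mshifts B (?ss d) (WB i) (\<lambda>t v. H i t (\<rho> t v)) t v =
       H (fold nxt (?ss d) i) t (mshifts A (?ss d) (WA i) \<rho> t v))" if "d \<in> set (ar_dom \<Sigma> k)" for d
    by (rule fusion_mshifts[where K=K and nxt=nxt and WA=WA and WB=WB and H=H and A=A and B=B,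
          OF A nxt ctx wk op.prems(1) d(1)[OF that] op.prems(2)])
  have env: "mshifts A (?ss d) (WA i) \<rho> \<in> menvs \<Sigma> A (addvars (?ss d) V) (mexts A (?ss d) (WA i))"
    if "d \<in> set (ar_dom \<Sigma> k)" for d
    using that d A op.prems ctx by (intro mshifts_menvs) auto
  have all: "list_all2 (\<lambda>d x. x \<in> mcar A (mexts A (?ss d) (WA i)) (tinst u (snd d)))
      (ar_dom \<Sigma> k) (map2 ?a (ar_dom \<Sigma> k) xs)"
    using op.IH
  proof (rule list_all2_map2, elim conjE)
    fix d x assume dx: "d \<in> set (ar_dom \<Sigma> k)"
      and x: "tm \<Sigma> (addvars (?ss d) V) (tinst u (snd d)) x"
    show "?a d x \<in> mcar A (mexts A (?ss d) (WA i)) (tinst u (snd d))"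
      using A mexts_mctx[OF A d(1)[OF dx] ctx[OF op.prems(1)]] env[OF dx] by (rule ev_mcar[OF x])
  qed
  have "map2 (\<lambda>d x. ev \<Sigma> B (mexts B (?ss d) (WB i)) (mshifts B (?ss d) (WB i) (\<lambda>t v. H i t (\<rho> t v)))
          (tinst u (snd d)) x) (ar_dom \<Sigma> k) xs =
        map2 (\<lambda>d x. H (fold nxt (?ss d) i) (tinst u (snd d)) (?a d x)) (ar_dom \<Sigma> k) xs"
    using op.IH
  proof (rule map2_cong_all2)
    fix d x assume dx: "d \<in> set (ar_dom \<Sigma> k)"
      and IH: "tm \<Sigma> (addvars (?ss d) V) (tinst u (snd d)) x \<and>
        (\<forall>i. i \<in> K \<longrightarrow> (\<forall>\<rho>. \<rho> \<in> menvs \<Sigma> A (addvars (?ss d) V) (WA i) \<longrightarrow>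
          ev \<Sigma> B (WB i) (\<lambda>t v. H i t (\<rho> t v)) (tinst u (snd d)) x =
          H i (tinst u (snd d)) (ev \<Sigma> A (WA i) \<rho> (tinst u (snd d)) x)))"
    \<comment> \<open>The induction hypothesis is needed at the stage reached after the binders of
      the argument \<open>d\<close>, with the shifted assignment.\<close>
    let ?i = "fold nxt (?ss d) i"
    have i: "?i \<in> K" "WA ?i = mexts A (?ss d) (WA i)" "WB ?i = mexts B (?ss d) (WB i)"
      using sh[OF dx] by blast+
    have "ev \<Sigma> B (mexts B (?ss d) (WB i)) (mshifts B (?ss d) (WB i) (\<lambda>t v. H i t (\<rho> t v)))
        (tinst u (snd d)) x = ev \<Sigma> B (mexts B (?ss d) (WB i))
        (\<lambda>t v. H ?i t (mshifts A (?ss d) (WA i) \<rho> t v)) (tinst u (snd d)) x"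
      using IH sh[OF dx] by (blast intro: ev_cong)
    also have "\<dots> = H ?i (tinst u (snd d)) (?a d x)"
      using IH[THEN conjunct2, rule_format, OF i(1), of "mshifts A (?ss d) (WA i) \<rho>"] env[OF dx]
      by (simp only: i(2,3))
    finally show "ev \<Sigma> B (mexts B (?ss d) (WB i)) (mshifts B (?ss d) (WB i) (\<lambda>t v. H i t (\<rho> t v)))
          (tinst u (snd d)) x = H ?i (tinst u (snd d)) (?a d x)" .
  qed
  then show ?case
    unfolding ev.simps hop[OF op.prems(1) op.hyps all] map2_map2 by (rule arg_cong)
qed simp

end


section \<open>Renaming and substitution\<close>

text \<open>Assigned values are variables \<open>Tuple [v]\<close>, so \<open>comps y ! 0\<close>
  reads back the variable to be weakened.\<close>

definition ren_model :: "'a tsig \<Rightarrow> 'a model" where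
  "ren_model \<Sigma> =
     \<lparr>mctx = UNIV, mext = addvar, mfresh = (\<lambda>s W. Tuple [fresh]),
      mwk = (\<lambda>s W t y. Tuple [old (comps y ! 0)]),
      mop = (\<lambda>k u W xs. Tuple (k # Tuple u # xs)),
      menv = (\<lambda>W t. {Tuple [v] | v. v \<in> W t}),
      mcar = (\<lambda>W t. {x. tm \<Sigma> W t x})\<rparr>"

definition sub_model :: "'a tsig \<Rightarrow> 'a model" where
  "sub_model \<Sigma> =
     \<lparr>mctx = UNIV, mext = addvar, mfresh = (\<lambda>s W. Tuple [fresh]),
      mwk = (\<lambda>s W. ev \<Sigma> (ren_model \<Sigma>) (addvar s W) (\<lambda>t v. Tuple [old v])),
      mop = (\<lambda>k u W xs. Tuple (k # Tuple u # xs)),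
      menv = (\<lambda>W t. {x. tm \<Sigma> W t x}),
      mcar = (\<lambda>W t. {x. tm \<Sigma> W t x})\<rparr>"

lemma ren_model_simps [simp]:
  "mctx (ren_model \<Sigma>) = UNIV"
  "mext (ren_model \<Sigma>) = addvar"
  "mfresh (ren_model \<Sigma>) s W = Tuple [fresh]"
  "mwk (ren_model \<Sigma>) s W t y = Tuple [old (comps y ! 0)]"
  "mop (ren_model \<Sigma>) k u W xs = Tuple (k # Tuple u # xs)"
  "menv (ren_model \<Sigma>) W t = {Tuple [v] | v. v \<in> W t}"
  "mcar (ren_model \<Sigma>) W t = {x. tm \<Sigma> W t x}"
  by (simp_all add: ren_model_def)

lemma sub_model_simps [simp]:
  "mctx (sub_model \<Sigma>) = UNIV"
  "mext (sub_model \<Sigma>) = addvar"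
  "mfresh (sub_model \<Sigma>) s W = Tuple [fresh]"
  "mwk (sub_model \<Sigma>) s W = ev \<Sigma> (ren_model \<Sigma>) (addvar s W) (\<lambda>t v. Tuple [old v])"
  "mop (sub_model \<Sigma>) k u W xs = Tuple (k # Tuple u # xs)"
  "menv (sub_model \<Sigma>) W t = {x. tm \<Sigma> W t x}"
  "mcar (sub_model \<Sigma>) W t = {x. tm \<Sigma> W t x}"
  by (simp_all add: sub_model_def)

lemma mexts_addvars:
  assumes "mext M = addvar"
  shows "mexts M ss W = addvars ss W"
  by (induction ss arbitrary: W) (simp_all add: assms)

lemma mexts_ren [simp]: "mexts (ren_model \<Sigma>) = addvars"
  by (intro ext mexts_addvars) simp

lemma mexts_sub [simp]: "mexts (sub_model \<Sigma>) = addvars"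
  by (intro ext mexts_addvars) simp

lemma fold_nxt_env:
  "fold (\<lambda>s (W, W', \<rho>). (addvar s W, mext B s W', mshift B s W' \<rho>)) ss (W, W', \<rho>) =
   (addvars ss W, mexts B ss W', mshifts B ss W' \<rho>)"
  by (induction ss arbitrary: W W' \<rho>) auto

text \<open>Kept apart from \<open>model\<close> because \<open>ren_model\<close>, which weakens
  only variables sensibly, must remain a model. It is what \<open>ev_sub\<close> demands of its
  target.\<close>

definition wk_natural :: "'a tsig \<Rightarrow> 'a model \<Rightarrow> bool" where
  "wk_natural \<Sigma> M \<longleftrightarrow> (\<forall>V W \<rho> s t x. W \<in> mctx M \<and> \<rho> \<in> menvs \<Sigma> M V W \<and> s \<in> ctys \<Sigma> \<and> tm \<Sigma> V t x \<longrightarrow>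
     ev \<Sigma> M (mext M s W) (\<lambda>t v. mwk M s W t (\<rho> t v)) t x = mwk M s W t (ev \<Sigma> M W \<rho> t x))"

lemma map2_snd: "list_all2 P ds xs \<Longrightarrow> map2 (\<lambda>d x. x) ds xs = xs"
  by (induction rule: list_all2_induct) auto

context
  fixes \<Sigma> :: "'a tsig" and small
  assumes sig: "typed_signature small \<Sigma>"
begin

lemma model_ren: "model \<Sigma> (ren_model \<Sigma>)"
  unfolding model_def by (auto intro: tm.intros)

lemma model_sub: "model \<Sigma> (sub_model \<Sigma>)"
proof -
  have "tm \<Sigma> (addvar s W) t (ev \<Sigma> (ren_model \<Sigma>) (addvar s W) (\<lambda>t v. Tuple [old v]) t y)"
    if "tm \<Sigma> W t y" for s W t y
    using ev_mcar[OF sig that model_ren, of "addvar s W" "\<lambda>t v. Tuple [old v]"]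
    by (auto simp: menvs_def)
  then show ?thesis unfolding model_def by (auto intro: tm.intros)
qed

text \<open>Fusion with \<open>H\<close> itself an evaluation, in \<open>C\<close>, out of a model
  \<open>A\<close> made of syntax. The models \<open>B\<close> and \<open>C\<close> agree up to
  weakening, carriers and admissible contexts and values; separating them allows \<open>C\<close> to
  be renaming while \<open>B\<close> is substitution, as in \<open>ren_sub\<close>.\<close>

lemma fusion_ev:
  assumes A: "model \<Sigma> A" "mctx A = UNIV" "mext A = addvar" "mfresh A = (\<lambda>s W. Tuple [fresh])"
      "mop A = (\<lambda>k u W xs. Tuple (k # Tuple u # xs))"
    and C: "mext C = mext B" "mfresh C = mfresh B" "mop C = mop B"
    and K: "\<And>W W' \<rho>' s. (W, W', \<rho>') \<in> K \<Longrightarrow> s \<in> ctys \<Sigma> \<Longrightarrow>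
      (addvar s W, mext B s W', mshift C s W' \<rho>') \<in> K"
    and wk: "\<And>W W' \<rho>' s t y. (W, W', \<rho>') \<in> K \<Longrightarrow> s \<in> ctys \<Sigma> \<Longrightarrow> t \<in> ctys \<Sigma> \<Longrightarrow> y \<in> menv A W t \<Longrightarrow>
      ev \<Sigma> C (mext B s W') (mshift C s W' \<rho>') t (mwk A s W t y) = mwk B s W' t (ev \<Sigma> C W' \<rho>' t y)"
    and x: "tm \<Sigma> V t x" and i: "(W, W', \<rho>') \<in> K" and \<rho>: "\<rho> \<in> menvs \<Sigma> A V W"
  shows "ev \<Sigma> C W' \<rho>' t (ev \<Sigma> A W \<rho> t x) = ev \<Sigma> B W' (\<lambda>t v. ev \<Sigma> C W' \<rho>' t (\<rho> t v)) t x"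
proof -
  let ?nxt = "\<lambda>s (W, W', \<rho>'). (addvar s W, mext C s W', mshift C s W' \<rho>')"
  let ?H = "\<lambda>(W, W', \<rho>'). ev \<Sigma> C W' \<rho>'"
  have "ev \<Sigma> B ((fst \<circ> snd) (W, W', \<rho>')) (\<lambda>t v. ?H (W, W', \<rho>') t (\<rho> t v)) t x =
      ?H (W, W', \<rho>') t (ev \<Sigma> A (fst (W, W', \<rho>')) \<rho> t x)"
  proof (rule fusion[OF sig A(1), where K=K and nxt="?nxt" and H="?H", OF _ _ _ _ x i])
    fix i :: "'a ctx \<times> 'a ctx \<times> 'a mor" and k u xs
    assume i: "i \<in> K"
    obtain W W' \<rho>' where [simp]: "i = (W, W', \<rho>')" by (cases i)
    show "?H i (tinst u (ar_cod \<Sigma> k)) (mop A k u (fst i) xs) = mop B k u ((fst \<circ> snd) i)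
        (map2 (\<lambda>d x. ?H (fold ?nxt (map (tinst u) (fst d)) i) (tinst u (snd d)) x) (ar_dom \<Sigma> k) xs)"
      by (simp add: A C(3) fold_nxt_env)
  qed (use K wk \<rho> in \<open>auto simp: A C\<close>)
  then show ?thesis by simp
qed

text \<open>Here the weakening condition of fusion concerns variables alone and is the equation
  defining \<open>mshift\<close> on old variables. Hence \<open>B\<close> is arbitrary, and the
  lemma can serve to establish the weakening conditions of the next fusions.\<close>

lemma ev_ren:
  assumes "tm \<Sigma> V t x" "\<rho> \<in> menvs \<Sigma> (ren_model \<Sigma>) V W"
  shows "ev \<Sigma> B W' \<rho>' t (ev \<Sigma> (ren_model \<Sigma>) W \<rho> t x) =
    ev \<Sigma> B W' (\<lambda>t v. ev \<Sigma> B W' \<rho>' t (\<rho> t v)) t x"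
  by (rule fusion_ev[where K=UNIV, OF model_ren _ _ _ _ _ _ _ _ _ assms(1) _ assms(2)])
    (auto simp: fun_eq_iff)

text \<open>Fusion with the identity as \<open>H\<close>: the two models differ in weakening, but on
  variables their weakenings coincide.\<close>

lemma ev_sub_eq_ren:
  assumes "tm \<Sigma> V t x" "\<rho> \<in> menvs \<Sigma> (ren_model \<Sigma>) V W"
  shows "ev \<Sigma> (sub_model \<Sigma>) W \<rho> t x = ev \<Sigma> (ren_model \<Sigma>) W \<rho> t x"
proof -
  show ?thesis
    using fusion[OF sig model_ren, where K=UNIV and B="sub_model \<Sigma>" and nxt = addvar and
        WA = "\<lambda>W. W" and WB = "\<lambda>W. W" and H = "\<lambda>W t x. x" and i = W and \<rho>=\<rho>,
        OF _ _ _ _ assms(1)] assms(2)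
    by (force simp: map2_snd)
qed

text \<open>The bridge from renaming to substitution; with \<open>r\<close> the inclusion of old
  variables it says that weakening commutes with substitution.\<close>

lemma ren_sub:
  assumes "tm \<Sigma> V t x" "\<rho> \<in> menvs \<Sigma> (sub_model \<Sigma>) V W" "r \<in> menvs \<Sigma> (ren_model \<Sigma>) W W'"
  shows "ev \<Sigma> (ren_model \<Sigma>) W' r t (ev \<Sigma> (sub_model \<Sigma>) W \<rho> t x) =
    ev \<Sigma> (sub_model \<Sigma>) W' (\<lambda>t v. ev \<Sigma> (ren_model \<Sigma>) W' r t (\<rho> t v)) t x"
proof -
  let ?R = "ren_model \<Sigma>"
  have wk: "ev \<Sigma> ?R (addvar s W') (mshift ?R s W' r) t
        (ev \<Sigma> ?R (addvar s W) (\<lambda>t v. Tuple [old v]) t y) =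
      ev \<Sigma> ?R (addvar s W') (\<lambda>t v. Tuple [old v]) t (ev \<Sigma> ?R W' r t y)"
    if r: "r \<in> menvs \<Sigma> ?R W W'" and y: "tm \<Sigma> W t y" for W W' r s t y
  proof -
    have "(\<lambda>t v. Tuple [old v]) \<in> menvs \<Sigma> ?R W (addvar s W)" by (auto simp: menvs_def)
    then show ?thesis
      \<comment> \<open>By \<open>ev_ren\<close>, both sides evaluate \<open>y\<close> under the
        assignment that sends \<open>v\<close> to the weakening of \<open>r t v\<close>.\<close>
      unfolding ev_ren[OF y r] using ev_ren[OF y, of _ "addvar s W"]
      using r by (fastforce intro!: ev_cong[OF y] simp: menvs_def)
  qed
  show ?thesis
    by (rule fusion_ev[where K="{(W, W', r). r \<in> menvs \<Sigma> ?R W W'}",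
          OF model_sub _ _ _ _ _ _ _ _ _ assms(1) _ assms(2)])
      (use assms(3) mshift_menvs[OF sig model_ren] wk in \<open>auto simp: fun_eq_iff\<close>)
qed

lemma wk_natural_sub: "wk_natural \<Sigma> (sub_model \<Sigma>)"
  unfolding wk_natural_def
proof (intro allI impI, elim conjE)
  fix V W \<rho> s t x
  assume \<rho>: "\<rho> \<in> menvs \<Sigma> (sub_model \<Sigma>) V W" and x: "tm \<Sigma> V t x"
  have "(\<lambda>t v. Tuple [old v]) \<in> menvs \<Sigma> (ren_model \<Sigma>) W (addvar s W)"
    by (auto simp: menvs_def)
  from ren_sub[OF x \<rho> this]
  show "ev \<Sigma> (sub_model \<Sigma>) (mext (sub_model \<Sigma>) s W) (\<lambda>t v. mwk (sub_model \<Sigma>) s W t (\<rho> t v)) t x =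
    mwk (sub_model \<Sigma>) s W t (ev \<Sigma> (sub_model \<Sigma>) W \<rho> t x)" by simp
qed

text \<open>The general substitution lemma. With \<open>B\<close> the substitution model it gives
  associativity of \<open>bind\<close> on terms, with \<open>B\<close> a representation it gives
  compatibility of interpretation with substitution. The weakening condition of fusion follows from
  \<open>ev_ren\<close> and \<open>wk_natural\<close>.\<close>

lemma ev_sub:
  assumes B: "model \<Sigma> B" "wk_natural \<Sigma> B" and x: "tm \<Sigma> V t x"
    and \<rho>: "\<rho> \<in> menvs \<Sigma> (sub_model \<Sigma>) V W" and \<rho>': "\<rho>' \<in> menvs \<Sigma> B W W'" "W' \<in> mctx B"
  shows "ev \<Sigma> B W' \<rho>' t (ev \<Sigma> (sub_model \<Sigma>) W \<rho> t x) =
    ev \<Sigma> B W' (\<lambda>t v. ev \<Sigma> B W' \<rho>' t (\<rho> t v)) t x"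
proof -
  have wk: "ev \<Sigma> B (mext B s W') (mshift B s W' \<rho>') t
        (ev \<Sigma> (ren_model \<Sigma>) (addvar s W) (\<lambda>t v. Tuple [old v]) t y) =
      mwk B s W' t (ev \<Sigma> B W' \<rho>' t y)"
    if "W' \<in> mctx B" "\<rho>' \<in> menvs \<Sigma> B W W'" "s \<in> ctys \<Sigma>" "tm \<Sigma> W t y" for W W' \<rho>' s t y
  proof -
    have "(\<lambda>t v. Tuple [old v]) \<in> menvs \<Sigma> (ren_model \<Sigma>) W (addvar s W)" by (auto simp: menvs_def)
    from ev_ren[OF that(4) this, of B "mext B s W'" "mshift B s W' \<rho>'"] show ?thesis
      using B(2)[unfolded wk_natural_def] that by simp
  qed
  show ?thesis
    by (rule fusion_ev[where K="{(W, W', \<rho>'). W' \<in> mctx B \<and> \<rho>' \<in> menvs \<Sigma> B W W'}",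
          OF model_sub _ _ _ _ _ _ _ _ _ x _ \<rho>])
      (use \<rho>' mshift_menvs[OF sig B(1)] modelD(1)[OF B(1)] wk in \<open>auto simp: fun_eq_iff\<close>)
qed

lemma mshifts_sub_var:
  assumes "\<forall>t\<in>ctys \<Sigma>. \<forall>v\<in>V t. \<rho> t v = Tuple [v]"
  shows "\<forall>t\<in>ctys \<Sigma>. \<forall>v\<in>addvars ss V t. mshifts (sub_model \<Sigma>) ss V \<rho> t v = Tuple [v]"
  using assms
proof (induction ss arbitrary: V \<rho>)
  case (Cons s ss)
  have "\<forall>t\<in>ctys \<Sigma>. \<forall>v\<in>addvar s V t. mshift (sub_model \<Sigma>) s V \<rho> t v = Tuple [v]"
    using Cons.prems by (auto elim!: addvar_cases)
  from Cons.IH[OF this] show ?case by simp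
qed simp

lemma ev_sub_var:
  assumes "tm \<Sigma> V t x" "\<forall>t\<in>ctys \<Sigma>. \<forall>v\<in>V t. \<rho> t v = Tuple [v]"
  shows "ev \<Sigma> (sub_model \<Sigma>) V \<rho> t x = x"
  using assms
proof (induction arbitrary: \<rho>)
  case (op k u V xs)
  have "map2 (\<lambda>d x. ev \<Sigma> (sub_model \<Sigma>) (addvars (map (tinst u) (fst d)) V)
        (mshifts (sub_model \<Sigma>) (map (tinst u) (fst d)) V \<rho>) (tinst u (snd d)) x) (ar_dom \<Sigma> k) xs =
      map2 (\<lambda>d x. x) (ar_dom \<Sigma> k) xs"
    using op.IH by (rule map2_cong_all2) (use mshifts_sub_var[OF op.prems] in blast)
  also have "\<dots> = xs" using op.IH by (rule map2_snd)
  finally show ?case by simp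
qed simp

end


section \<open>Reduction monads\<close>

text \<open>\<open>bind\<close> is only specified on extensional maps; \<open>rbind\<close> accepts arbitrary ones.\<close>

definition rbind ::
  "('a, 'r) relmonad_scheme \<Rightarrow> 'a ctx \<Rightarrow> 'a ctx \<Rightarrow> 'a mor \<Rightarrow> 'a mor" where
  "rbind R V W f = bind R V W (\<lambda>t. restrict (f t) (V t))"

definition kleisli :: "('a, 'r) relmonad_scheme \<Rightarrow> 'a ctx \<Rightarrow> 'a ctx \<Rightarrow> 'a mor set" where
  "kleisli R V W = {f. \<forall>t. \<forall>v\<in>V t. f t v \<in> carr (obj R W t)}"

definition wk :: "('a, 'r) relmonad_scheme \<Rightarrow> 'a univ \<Rightarrow> 'a ctx \<Rightarrow> 'a mor" where
  "wk R s W = rbind R W (addvar s W) (\<lambda>t v. unit R (addvar s W) t (old v))"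

text \<open>Agrees with \<open>shift\<close> on the extended context
  (\<open>shift_eq_rshift\<close>) but carries no restriction, so it can be iterated without
  tracking the source context.\<close>

definition rshift :: "('a, 'r) relmonad_scheme \<Rightarrow> 'a univ \<Rightarrow> 'a ctx \<Rightarrow> 'a mor \<Rightarrow> 'a mor" where
  "rshift R s W f t x =
     (if x = fresh then unit R (addvar s W) t fresh else wk R s W t (f t (unold x)))"

primrec rshifts :: "('a, 'r) relmonad_scheme \<Rightarrow> 'a univ list \<Rightarrow> 'a ctx \<Rightarrow> 'a mor \<Rightarrow> 'a mor" where
  "rshifts R [] W f = f"
| "rshifts R (s # ss) W f = rshifts R ss (addvar s W) (rshift R s W f)"

lemma rshift_simps [simp]:
  "rshift R s W f t fresh = unit R (addvar s W) t fresh"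
  "rshift R s W f t (old v) = wk R s W t (f t v)"
  by (auto simp: rshift_def)

lemma rbind_cong:
  "(\<And>t v. v \<in> V t \<Longrightarrow> f t v = f' t v) \<Longrightarrow> rbind R V W f = rbind R V W f'"
  unfolding rbind_def by (intro arg_cong[of _ _ "bind R V W"] ext) (auto simp: restrict_def)

lemma bind_eq_rbind:
  "(\<And>t. f t \<in> extensional (V t)) \<Longrightarrow> bind R V W f = rbind R V W f"
  by (simp add: rbind_def extensional_restrict)

lemma lift_eq_rbind: "lift R V W h = rbind R V W (\<lambda>t v. unit R W t (h t v))"
  by (simp add: lift_def rbind_def fcomp_def compose_def)

lemma lift_addvar_inl: "lift R W (addvar s W) (addvar_inl W) = wk R s W"
  unfolding lift_eq_rbind wk_def by (rule rbind_cong) (simp add: addvar_inl_def)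

lemma shift_eq_rshift: "x \<in> addvar s V t \<Longrightarrow> shift R s V W f t x = rshift R s W f t x"
  by (simp add: shift_def rshift_def lift_addvar_inl)

lemma rshift_cong:
  "(\<And>t v. v \<in> V t \<Longrightarrow> f t v = f' t v) \<Longrightarrow> x \<in> addvar s V t \<Longrightarrow>
   rshift R s W f t x = rshift R s W f' t x"
  by (auto elim!: addvar_cases)

lemma rshifts_cong:
  assumes "\<And>t v. v \<in> V t \<Longrightarrow> f t v = f' t v" "x \<in> addvars ss V t"
  shows "rshifts R ss W f t x = rshifts R ss W f' t x"
  using assms
proof (induction ss arbitrary: V W f f')
  case (Cons s ss)
  show ?case
    using Cons.IH[of "addvar s V" "rshift R s W f" "rshift R s W f'" "addvar s W"] Cons.prems
    by (simp add: rshift_cong[of V f f'])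
qed simp

lemma fobj_derivs [simp]: "fobj (derivs R ss (taut R)) V = obj R (addvars ss V)"
  by (induction ss arbitrary: V) (simp_all add: taut_def deriv_mod_def)

lemma fbind_derivs:
  "(\<And>t. f t \<in> extensional (V t)) \<Longrightarrow> fbind (derivs R ss (taut R)) V W f =
   rbind R (addvars ss V) (addvars ss W) (rshifts R ss W f)"
proof (induction ss arbitrary: V W f)
  case Nil
  then show ?case by (simp add: taut_def bind_eq_rbind)
next
  case (Cons s ss)
  have "shift R s V W f t \<in> extensional (addvar s V t)" for t
    by (simp add: shift_def)
  then have "fbind (derivs R (s # ss) (taut R)) V W f =
      rbind R (addvars ss (addvar s V)) (addvars ss (addvar s W))
        (rshifts R ss (addvar s W) (shift R s V W f))"
    by (simp add: deriv_mod_def Cons.IH)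
  also have "\<dots> = rbind R (addvars ss (addvar s V)) (addvars ss (addvar s W))
        (rshifts R ss (addvar s W) (rshift R s W f))"
    by (rule rbind_cong, rule rshifts_cong) (auto simp: shift_eq_rshift)
  finally show ?case by simp
qed

section \<open>Classic modules in coordinates\<close>

lemma list_all2_map_right: "list_all2 P xs (map f ds) \<longleftrightarrow> list_all2 (\<lambda>d x. P x (f d)) ds xs"
  by (auto simp: list_all2_conv_all_nth)

lemma carr_classic_mod:
  "carr (mobj (classic_mod R ds u) V) = {Tuple xs | xs. list_all2 (\<lambda>d x. x \<in>
     carr (obj R (addvars (map (teval R u) (fst d)) V) (teval R u (snd d)))) ds xs}"
  by (simp add: classic_mod_def prod_mod_def prod_preo_def fibre_def list_all2_map_right split_beta)

lemma leq_classic_mod: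
  "leq (mobj (classic_mod R ds u) V) = {(Tuple xs, Tuple ys) | xs ys.
     length xs = length ds \<and> length ys = length ds \<and> (\<forall>i < length ds. (xs ! i, ys ! i) \<in>
     leq (obj R (addvars (map (teval R u) (fst (ds ! i))) V) (teval R u (snd (ds ! i)))))}"
  by (simp add: classic_mod_def prod_mod_def prod_preo_def fibre_def split_beta cong: conj_cong)

lemma mbind_classic_mod:
  assumes "\<And>t. f t \<in> extensional (V t)" "Tuple xs \<in> carr (mobj (classic_mod R ds u) V)"
  shows "mbind (classic_mod R ds u) V W f (Tuple xs) =
    Tuple (map2 (\<lambda>d. rbind R (addvars (map (teval R u) (fst d)) V)
      (addvars (map (teval R u) (fst d)) W) (rshifts R (map (teval R u) (fst d)) W f)
      (teval R u (snd d))) ds xs)"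
  using assms(2)
  by (simp add: classic_mod_def prod_mod_def fibre_def split_beta zip_map1 fbind_derivs[OF assms(1)]
      comp_def)

section \<open>Elementwise laws of a reduction monad\<close>

locale red_monad =
  fixes small :: "'a univ set \<Rightarrow> bool" and R :: "('a, 'r) relmonad_scheme"
  assumes univ: "set_universe small" and R: "reduction_monad small R"
begin

abbreviation "cx \<equiv> ctx small (tys R)"

lemma cx_addvar: "cx V \<Longrightarrow> s \<in> tys R \<Longrightarrow> cx (addvar s V)"
  by (rule ctx_addvar[OF univ])

lemma cx_addvars: "cx V \<Longrightarrow> set ss \<subseteq> tys R \<Longrightarrow> cx (addvars ss V)"
  by (induction ss arbitrary: V) (simp_all add: cx_addvar)

lemma obj_po_fam: "cx V \<Longrightarrow> po_fam small (tys R) (obj R V)"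
  using R unfolding reduction_monad_def by blast

lemma obj_preorder: "cx V \<Longrightarrow> preorder_on (carr (obj R V t)) (leq (obj R V t))"
  using obj_po_fam[of V]
  by (cases "t \<in> tys R") (auto simp: po_fam_def preo_def preorder_on_def refl_on_def)

lemma leq_refl: "cx V \<Longrightarrow> x \<in> carr (obj R V t) \<Longrightarrow> (x, x) \<in> leq (obj R V t)"
  using obj_preorder[of V t] by (auto simp: preorder_on_def refl_on_def)

lemma leq_trans:
  "cx V \<Longrightarrow> (x, y) \<in> leq (obj R V t) \<Longrightarrow> (y, z) \<in> leq (obj R V t) \<Longrightarrow> (x, z) \<in> leq (obj R V t)"
  using obj_preorder[of V t] by (auto simp: preorder_on_def dest: transD)

lemma unit_carr: "cx V \<Longrightarrow> v \<in> V t \<Longrightarrow> unit R V t v \<in> carr (obj R V t)"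
  using R unfolding reduction_monad_def by (auto simp: fhom_def phom_def disc_def)

text \<open>The source is discrete, so monotonicity amounts to reflexivity in the target.\<close>

lemma restrict_fhom:
  assumes "cx W" "f \<in> kleisli R V W"
  shows "(\<lambda>t. restrict (f t) (V t)) \<in> fhom (disc V) (obj R W)"
  using assms leq_refl by (auto simp: fhom_def phom_def disc_def kleisli_def)

lemma fhom_extensional: "f \<in> fhom (disc V) (obj R W) \<Longrightarrow> f t \<in> extensional (V t)"
  by (auto simp: fhom_def phom_def disc_def PiE_def)

lemma rbind_fhom:
  "cx V \<Longrightarrow> cx W \<Longrightarrow> f \<in> kleisli R V W \<Longrightarrow> rbind R V W f \<in> fhom (obj R V) (obj R W)"
  using R restrict_fhom[of W f V] unfolding reduction_monad_def rbind_def by blast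

lemma rbind_carr:
  "cx V \<Longrightarrow> cx W \<Longrightarrow> f \<in> kleisli R V W \<Longrightarrow> x \<in> carr (obj R V t) \<Longrightarrow>
   rbind R V W f t x \<in> carr (obj R W t)"
  using rbind_fhom[of V W f] by (auto simp: fhom_def phom_def)

lemma rbind_mono:
  "cx V \<Longrightarrow> cx W \<Longrightarrow> f \<in> kleisli R V W \<Longrightarrow> (x, y) \<in> leq (obj R V t) \<Longrightarrow>
   (rbind R V W f t x, rbind R V W f t y) \<in> leq (obj R W t)"
  using rbind_fhom[of V W f] by (auto simp: fhom_def phom_def)

lemma rbind_unit:
  assumes "cx V" "cx W" "f \<in> kleisli R V W" "v \<in> V t"
  shows "rbind R V W f t (unit R V t v) = f t v"
proof -
  have "fcomp V (unit R V) (rbind R V W f) = (\<lambda>t. restrict (f t) (V t))"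
    using R restrict_fhom[of W f V] assms unfolding reduction_monad_def rbind_def by blast
  then have "fcomp V (unit R V) (rbind R V W f) t v = f t v" using assms(4) by simp
  then show ?thesis using assms(4) by (simp add: fcomp_def compose_def)
qed

lemma rbind_le:
  assumes "cx V" "cx W" "f \<in> kleisli R V W" "f' \<in> kleisli R V W"
    and "\<And>t v. v \<in> V t \<Longrightarrow> (f t v, f' t v) \<in> leq (obj R W t)" "x \<in> carr (obj R V t)"
  shows "(rbind R V W f t x, rbind R V W f' t x) \<in> leq (obj R W t)"
proof -
  have "fhom_le (disc V) (obj R W) (\<lambda>t. restrict (f t) (V t)) (\<lambda>t. restrict (f' t) (V t))"
    using assms(5) by (auto simp: fhom_le_def disc_def)
  then have "fhom_le (obj R V) (obj R W) (rbind R V W f) (rbind R V W f')"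
    using R assms(1,2) restrict_fhom[OF assms(2,3)] restrict_fhom[OF assms(2,4)]
    unfolding reduction_monad_def rbind_def by blast
  then show ?thesis using assms(6) by (auto simp: fhom_le_def)
qed

lemma rbind_id:
  assumes "cx V" "\<And>t v. v \<in> V t \<Longrightarrow> f t v = unit R V t v" "x \<in> carr (obj R V t)"
  shows "rbind R V V f t x = x"
proof -
  have "unit R V \<in> fhom (disc V) (obj R V)"
    using R assms(1) unfolding reduction_monad_def by blast
  then have "rbind R V V f = bind R V V (unit R V)"
    using fhom_extensional by (simp add: bind_eq_rbind assms(2) cong: rbind_cong)
  then have "rbind R V V f = fid (carrs (obj R V))"
    using R assms(1) unfolding reduction_monad_def by simp
  then show ?thesis using assms(3) by (simp add: fid_def carrs_def)
qed

lemma rbind_rbind: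
  assumes "cx V" "cx W" "cx X" "f \<in> kleisli R V W" "h \<in> kleisli R W X" "x \<in> carr (obj R V t)"
  shows "rbind R W X h t (rbind R V W f t x) = rbind R V X (\<lambda>t v. rbind R W X h t (f t v)) t x"
proof -
  have "fcomp (carrs (obj R V)) (rbind R V W f) (rbind R W X h) =
      bind R V X (fcomp V (\<lambda>t. restrict (f t) (V t)) (rbind R W X h))"
    using R assms(1-3) restrict_fhom[OF assms(2,4)] restrict_fhom[OF assms(3,5)]
    unfolding reduction_monad_def rbind_def by blast
  also have "fcomp V (\<lambda>t. restrict (f t) (V t)) (rbind R W X h) =
      (\<lambda>t. restrict (\<lambda>v. rbind R W X h t (f t v)) (V t))"
    by (auto simp: fcomp_def compose_def restrict_def fun_eq_iff)
  also have "bind R V X \<dots> = rbind R V X (\<lambda>t v. rbind R W X h t (f t v))"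
    by (simp only: rbind_def[of R V X])
  finally have "fcomp (carrs (obj R V)) (rbind R V W f) (rbind R W X h) t x =
      rbind R V X (\<lambda>t v. rbind R W X h t (f t v)) t x" by (rule fun_cong[OF fun_cong])
  then show ?thesis using assms(6) by (simp add: fcomp_def carrs_def compose_def)
qed

lemma wk_kleisli:
  "cx W \<Longrightarrow> s \<in> tys R \<Longrightarrow> (\<lambda>t v. unit R (addvar s W) t (old v)) \<in> kleisli R W (addvar s W)"
  by (auto simp: kleisli_def intro: unit_carr cx_addvar)

lemma wk_carr: "cx W \<Longrightarrow> s \<in> tys R \<Longrightarrow> x \<in> carr (obj R W t) \<Longrightarrow> wk R s W t x \<in> carr (obj R (addvar s W) t)"
  unfolding wk_def by (intro rbind_carr wk_kleisli cx_addvar)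

lemma wk_unit: "cx W \<Longrightarrow> s \<in> tys R \<Longrightarrow> v \<in> W t \<Longrightarrow> wk R s W t (unit R W t v) = unit R (addvar s W) t (old v)"
  unfolding wk_def by (subst rbind_unit) (auto intro: wk_kleisli cx_addvar)

lemma rshift_kleisli:
  "cx V \<Longrightarrow> cx W \<Longrightarrow> s \<in> tys R \<Longrightarrow> f \<in> kleisli R V W \<Longrightarrow>
   rshift R s W f \<in> kleisli R (addvar s V) (addvar s W)"
  by (auto simp: kleisli_def elim!: addvar_cases intro!: wk_carr unit_carr cx_addvar)

lemma rshifts_kleisli:
  "cx V \<Longrightarrow> cx W \<Longrightarrow> set ss \<subseteq> tys R \<Longrightarrow> f \<in> kleisli R V W \<Longrightarrow>
   rshifts R ss W f \<in> kleisli R (addvars ss V) (addvars ss W)"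
  by (induction ss arbitrary: V W f) (simp_all add: cx_addvar rshift_kleisli)

text \<open>By associativity both sides are the bind of \<open>x\<close> along the map sending
  \<open>v\<close> to the weakening of \<open>f t v\<close>.\<close>

lemma rbind_rshift_wk:
  assumes "cx V" "cx W" "s \<in> tys R" "f \<in> kleisli R V W" "x \<in> carr (obj R V t)"
  shows "rbind R (addvar s V) (addvar s W) (rshift R s W f) t (wk R s V t x) =
    wk R s W t (rbind R V W f t x)"
proof -
  note cx = assms(1-3) cx_addvar[OF assms(1,3)] cx_addvar[OF assms(2,3)]
  note sh = rshift_kleisli[OF assms(1-4)]
  have "rbind R (addvar s V) (addvar s W) (rshift R s W f) t (wk R s V t x) =
      rbind R V (addvar s W) (\<lambda>t v. rbind R (addvar s V) (addvar s W) (rshift R s W f) t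
        (unit R (addvar s V) t (old v))) t x"
    unfolding wk_def[of R s V] using cx sh assms(5) by (intro rbind_rbind wk_kleisli)
  also have "\<dots> = rbind R V (addvar s W) (\<lambda>t v. wk R s W t (f t v)) t x"
    using cx sh by (subst rbind_cong) (auto simp: rbind_unit)
  also have "\<dots> = wk R s W t (rbind R V W f t x)"
    unfolding wk_def[of R s W] using cx assms(4,5) by (intro rbind_rbind[symmetric] wk_kleisli)
  finally show ?thesis .
qed

text \<open>Being a left inverse in the Kleisli sense survives passage under a binder. Iterated in
  \<open>rshifts_inverse\<close>, this lets a renaming be undone on derived modules, which is how
  the order is reflected in \<open>hat_reflects\<close>.\<close>

lemma rshift_inverse:
  assumes "cx V" "cx W" "s \<in> tys R" "f \<in> kleisli R V W" "h \<in> kleisli R W V"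
    and "\<And>t v. v \<in> V t \<Longrightarrow> rbind R W V h t (f t v) = unit R V t v"
    and "x \<in> addvar s V t"
  shows "rbind R (addvar s W) (addvar s V) (rshift R s V h) t (rshift R s W f t x) =
    unit R (addvar s V) t x"
  using assms(7)
proof (cases rule: addvar_cases)
  case (1 v)
  have "f t v \<in> carr (obj R W t)" using assms(4) 1 by (auto simp: kleisli_def)
  then show ?thesis using 1 assms by (simp add: rbind_rshift_wk wk_unit)
next
  case 2
  then show ?thesis
    using assms rshift_kleisli[of W V s h] by (simp add: rbind_unit cx_addvar)
qed

lemma rshifts_inverse:
  assumes "cx V" "cx W" "set ss \<subseteq> tys R" "f \<in> kleisli R V W" "h \<in> kleisli R W V"
    and "\<And>t v. v \<in> V t \<Longrightarrow> rbind R W V h t (f t v) = unit R V t v"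
    and "x \<in> carr (obj R (addvars ss V) t)"
  shows "rbind R (addvars ss W) (addvars ss V) (rshifts R ss V h) t
    (rbind R (addvars ss V) (addvars ss W) (rshifts R ss W f) t x) = x"
  using assms
proof (induction ss arbitrary: V W f h)
  case Nil
  then show ?case by (simp add: rbind_rbind rbind_id)
next
  case (Cons s ss)
  show ?case
    using Cons.IH[of "addvar s V" "addvar s W" "rshift R s W f" "rshift R s V h"] Cons.prems
    by (simp add: cx_addvar rshift_kleisli rshift_inverse)
qed

end


section \<open>Interpretation of terms in a representation\<close>

lemma ctys_tuple_closure: "t \<in> ctys S \<Longrightarrow> t \<in> tuple_closure (tops S)"
proof (induction rule: ctys.induct)
  case (1 j us)
  then show ?case by (auto intro: tuple_closure.base intro!: tuple_closure.Tuple)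
qed

lemma small_ctys: "set_universe small \<Longrightarrow> small (tops S) \<Longrightarrow> small (ctys S)"
  by (rule small_subset[OF _ small_tuple_closure]) (auto dest: ctys_tuple_closure)

text \<open>The sorts of a model are closed types, whence the translation by \<open>g\<close> in
  every component.\<close>

definition rep_model :: "('a univ set \<Rightarrow> bool) \<Rightarrow> 'a tsig \<Rightarrow> 'a rep \<Rightarrow> 'a model" where
  "rep_model small \<Sigma> R = (let g = ty_map \<Sigma> R in
     \<lparr>mctx = {W. ctx small (tys R) W}, mext = (\<lambda>s. addvar (g s)),
      mfresh = (\<lambda>s W. unit R (addvar (g s) W) (g s) fresh),
      mwk = (\<lambda>s W t. wk R (g s) W (g t)),
      mop = (\<lambda>k u W xs. oper R k (map g u) W (Tuple xs)),
      menv = (\<lambda>W t. carr (obj R W (g t))),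
      mcar = (\<lambda>W t. carr (obj R W (g t)))\<rparr>)"

lemma rep_model_simps [simp]:
  "mctx (rep_model small \<Sigma> R) = {W. ctx small (tys R) W}"
  "mext (rep_model small \<Sigma> R) s = addvar (ty_map \<Sigma> R s)"
  "mfresh (rep_model small \<Sigma> R) s W = unit R (addvar (ty_map \<Sigma> R s) W) (ty_map \<Sigma> R s) fresh"
  "mwk (rep_model small \<Sigma> R) s W t = wk R (ty_map \<Sigma> R s) W (ty_map \<Sigma> R t)"
  "mop (rep_model small \<Sigma> R) k u W xs = oper R k (map (ty_map \<Sigma> R) u) W (Tuple xs)"
  "menv (rep_model small \<Sigma> R) W t = carr (obj R W (ty_map \<Sigma> R t))"
  "mcar (rep_model small \<Sigma> R) W t = carr (obj R W (ty_map \<Sigma> R t))"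
  by (simp_all add: rep_model_def Let_def)

lemma mexts_rep [simp]:
  "mexts (rep_model small \<Sigma> R) ss W = addvars (map (ty_map \<Sigma> R) ss) W"
  by (induction ss arbitrary: W) simp_all

locale representation = red_monad small R for small :: "'a univ set \<Rightarrow> bool" and R :: "'a rep" +
  fixes \<Sigma> :: "'a tsig"
  assumes sig: "typed_signature small \<Sigma>" and rep: "rep small \<Sigma> R"
begin

abbreviation "g \<equiv> ty_map \<Sigma> R"
abbreviation "M \<equiv> rep_model small \<Sigma> R"

lemma srep: "srep small \<Sigma> R"
  using rep by (simp add: rep_def relative_S_monad_def)

lemma g_tys: "t \<in> ctys \<Sigma> \<Longrightarrow> g t \<in> tys R"
  using srep by (rule ty_map_tys)

lemma g_funcset: "g \<in> ctys \<Sigma> \<rightarrow>\<^sub>E tys R"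
  using g_tys by (auto simp: ty_map_def)

lemma map_g_tys: "set ss \<subseteq> ctys \<Sigma> \<Longrightarrow> set (map g ss) \<subseteq> tys R"
  using g_tys by auto

lemma map_g_vecs: "u \<in> vecs (ctys \<Sigma>) n \<Longrightarrow> map g u \<in> vecs (tys R) n"
  using g_tys by (auto simp: vecs_def)

lemma cx_retype: "ctx small (ctys \<Sigma>) V \<Longrightarrow> cx (retype g V)"
  using ctx_retype[OF univ g_funcset] small_ctys[OF univ] sig by (auto simp: typed_signature_def)

lemma teval_dom:
  assumes "dom_arity \<Sigma> n ds" "u \<in> vecs (ctys \<Sigma>) n" "d \<in> set ds"
  shows "map (teval R (map g u)) (fst d) = map g (map (tinst u) (fst d))"
    "teval R (map g u) (snd d) = g (tinst u (snd d))"
  using assms ty_map_tinst[OF _ assms(2), of _ R]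
  by (auto simp: dom_arity_def split_beta subset_iff)

lemma carr_classic:
  assumes "dom_arity \<Sigma> n ds" "u \<in> vecs (ctys \<Sigma>) n"
  shows "Tuple xs \<in> carr (mobj (classic_mod R ds (map g u)) W) \<longleftrightarrow>
    list_all2 (\<lambda>d x. x \<in> carr (obj R (addvars (map g (map (tinst u) (fst d))) W) (g (tinst u (snd d)))))
      ds xs"
  unfolding carr_classic_mod
  by (auto simp: list_all2_conv_all_nth teval_dom[OF assms] simp del: map_map)

lemma leq_classic:
  assumes "dom_arity \<Sigma> n ds" "u \<in> vecs (ctys \<Sigma>) n"
  shows "(Tuple xs, Tuple ys) \<in> leq (mobj (classic_mod R ds (map g u)) W) \<longleftrightarrow>
    length xs = length ds \<and> length ys = length ds \<and> (\<forall>i < length ds. (xs ! i, ys ! i) \<in>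
     leq (obj R (addvars (map g (map (tinst u) (fst (ds ! i)))) W) (g (tinst u (snd (ds ! i))))))"
  unfolding leq_classic_mod
  by (auto simp: teval_dom[OF assms] simp del: map_map)

lemma arity:
  assumes "k \<in> ars \<Sigma>"
  shows "dom_arity \<Sigma> (deg \<Sigma> k) (ar_dom \<Sigma> k)" "ar_cod \<Sigma> k \<in> texps \<Sigma> (deg \<Sigma> k)"
  using sig assms by (auto simp: typed_signature_def)

context
  fixes k u
  assumes k: "k \<in> ars \<Sigma>" and u: "u \<in> vecs (ctys \<Sigma>) (deg \<Sigma> k)"
begin

lemma oper_mor:
  "pmod_mor small R (classic_mod R (ar_dom \<Sigma> k) (map g u))
     (fibre (taut R) (g (tinst u (ar_cod \<Sigma> k)))) (oper R k (map g u))"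
  using rep k map_g_vecs[OF u] ty_map_tinst[OF arity(2)[OF k] u, of R] by (simp add: rep_def)

lemma oper_phom:
  "cx W \<Longrightarrow> oper R k (map g u) W \<in>
     phom (mobj (classic_mod R (ar_dom \<Sigma> k) (map g u)) W) (obj R W (g (tinst u (ar_cod \<Sigma> k))))"
  using oper_mor by (auto simp: pmod_mor_def fibre_def taut_def)

lemma rbind_oper:
  assumes "cx W" "cx W'" "h \<in> kleisli R W W'"
    and "Tuple xs \<in> carr (mobj (classic_mod R (ar_dom \<Sigma> k) (map g u)) W)"
  shows "rbind R W W' h (g (tinst u (ar_cod \<Sigma> k))) (oper R k (map g u) W (Tuple xs)) =
    oper R k (map g u) W' (Tuple (map2 (\<lambda>d.
      rbind R (addvars (map g (map (tinst u) (fst d))) W) (addvars (map g (map (tinst u) (fst d))) W')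
        (rshifts R (map g (map (tinst u) (fst d))) W' h) (g (tinst u (snd d)))) (ar_dom \<Sigma> k) xs))"
proof -
  let ?h = "\<lambda>t. restrict (h t) (W t)" and ?C = "classic_mod R (ar_dom \<Sigma> k) (map g u)"
  have "compose (carr (mobj ?C W)) (oper R k (map g u) W') (mbind ?C W W' ?h) (Tuple xs) =
      compose (carr (mobj ?C W)) (bind R W W' ?h (g (tinst u (ar_cod \<Sigma> k)))) (oper R k (map g u) W)
        (Tuple xs)"
    using oper_mor restrict_fhom[OF assms(2,3)] assms(1,2)
    by (simp add: pmod_mor_def fibre_def taut_def)
  then have "rbind R W W' h (g (tinst u (ar_cod \<Sigma> k))) (oper R k (map g u) W (Tuple xs)) =
      oper R k (map g u) W' (mbind ?C W W' ?h (Tuple xs))"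
    using assms(4) by (simp add: rbind_def compose_def)
  also have "mbind ?C W W' ?h (Tuple xs) = Tuple (map2 (\<lambda>d.
      rbind R (addvars (map (teval R (map g u)) (fst d)) W) (addvars (map (teval R (map g u)) (fst d)) W')
        (rshifts R (map (teval R (map g u)) (fst d)) W' ?h) (teval R (map g u) (snd d))) (ar_dom \<Sigma> k) xs)"
    using assms(4) by (intro mbind_classic_mod) auto
  also have "\<dots> = Tuple (map2 (\<lambda>d.
      rbind R (addvars (map g (map (tinst u) (fst d))) W) (addvars (map g (map (tinst u) (fst d))) W')
        (rshifts R (map g (map (tinst u) (fst d))) W' h) (g (tinst u (snd d)))) (ar_dom \<Sigma> k) xs)"
    using assms(4)[unfolded carr_classic[OF arity(1)[OF k] u]]
  proof (intro arg_cong[of _ _ Tuple], elim map2_cong_all2)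
    fix d x assume d: "d \<in> set (ar_dom \<Sigma> k)"
    let ?s = "map g (map (tinst u) (fst d))"
    \<comment> \<open>The module law speaks of the restricted map \<open>?h\<close>; its shifts
      agree with those of \<open>h\<close> on the extended context.\<close>
    have "rbind R (addvars ?s W) (addvars ?s W') (rshifts R ?s W' ?h) =
        rbind R (addvars ?s W) (addvars ?s W') (rshifts R ?s W' h)"
      by (rule rbind_cong, rule rshifts_cong[of W]) auto
    then show "rbind R (addvars (map (teval R (map g u)) (fst d)) W)
        (addvars (map (teval R (map g u)) (fst d)) W')
        (rshifts R (map (teval R (map g u)) (fst d)) W' ?h) (teval R (map g u) (snd d)) x =
      rbind R (addvars ?s W) (addvars ?s W') (rshifts R ?s W' h) (g (tinst u (snd d))) x"
      unfolding teval_dom[OF arity(1)[OF k] u d] by simp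
  qed
  finally show ?thesis .
qed

end

lemma model_rep: "model \<Sigma> M"
  unfolding model_def
proof (intro ballI conjI allI impI)
  fix W k u xs
  assume W: "W \<in> mctx M" and k: "k \<in> ars \<Sigma>" "u \<in> vecs (ctys \<Sigma>) (deg \<Sigma> k)"
    and xs: "list_all2 (\<lambda>d x. x \<in> mcar M (mexts M (map (tinst u) (fst d)) W) (tinst u (snd d)))
      (ar_dom \<Sigma> k) xs"
  have "Tuple xs \<in> carr (mobj (classic_mod R (ar_dom \<Sigma> k) (map g u)) W)"
    using xs unfolding carr_classic[OF arity(1)[OF k(1)] k(2)] by simp
  then show "mop M k u W xs \<in> mcar M W (tinst u (ar_cod \<Sigma> k))"
    using oper_phom[OF k] W by (auto simp: phom_def)
qed (auto intro!: cx_addvar g_tys unit_carr wk_carr)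

text \<open>The index set of a fusion whose comparison map is \<open>rbind\<close>: a Kleisli map
  together with its source and target contexts, shifted by \<open>next_kleisli\<close> under a
  binder.\<close>

definition kleislis :: "('a ctx \<times> 'a ctx \<times> 'a mor) set" where
  "kleislis = {(W, W', h). cx W \<and> cx W' \<and> h \<in> kleisli R W W'}"

definition next_kleisli ::
  "'a univ \<Rightarrow> 'a ctx \<times> 'a ctx \<times> 'a mor \<Rightarrow> 'a ctx \<times> 'a ctx \<times> 'a mor" where
  "next_kleisli s = (\<lambda>(W, W', h). (addvar (g s) W, addvar (g s) W', rshift R (g s) W' h))"

lemma fold_next_kleisli:
  "fold next_kleisli ss (W, W', h) =
   (addvars (map g ss) W, addvars (map g ss) W', rshifts R (map g ss) W' h)"
  by (induction ss arbitrary: W W' h) (auto simp: next_kleisli_def)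

lemma next_kleisli_kleislis:
  assumes "i \<in> kleislis" "s \<in> ctys \<Sigma>"
  shows "next_kleisli s i \<in> kleislis \<and>
    fst (next_kleisli s i) = mext M s (fst i) \<and>
    fst (snd (next_kleisli s i)) = mext M s (fst (snd i)) \<and>
    (\<lambda>(W, W', h) t. rbind R W W' h (g t)) (next_kleisli s i) s (mfresh M s (fst i)) =
      mfresh M s (fst (snd i))"
  using assms g_tys[OF assms(2)]
  by (auto simp: kleislis_def next_kleisli_def cx_addvar rshift_kleisli rbind_unit)

lemma next_kleisli_wk:
  assumes "i \<in> kleislis" "s \<in> ctys \<Sigma>" "y \<in> menv M (fst i) t"
  shows "(\<lambda>(W, W', h) t. rbind R W W' h (g t)) (next_kleisli s i) t (mwk M s (fst i) t y) =
    mwk M s (fst (snd i)) t ((\<lambda>(W, W', h) t. rbind R W W' h (g t)) i t y)"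
  using assms g_tys[OF assms(2)]
  by (auto simp: kleislis_def next_kleisli_def rbind_rshift_wk)

text \<open>The operations of \<open>R\<close> are module morphisms, so \<open>bind\<close> of
  \<open>R\<close> respects them (\<open>rbind_oper\<close>) and fusion applies with the model of
  \<open>R\<close> on both sides.\<close>

lemma rbind_ev:
  assumes "tm \<Sigma> V t x" "cx W" "cx W'" "h \<in> kleisli R W W'" "\<rho> \<in> menvs \<Sigma> M V W"
  shows "rbind R W W' h (g t) (ev \<Sigma> M W \<rho> t x) =
    ev \<Sigma> M W' (\<lambda>t v. rbind R W W' h (g t) (\<rho> t v)) t x"
proof -
  let ?H = "\<lambda>(W, W', h) t. rbind R W W' h (g t)"
  have i: "(W, W', h) \<in> kleislis" using assms by (simp add: kleislis_def)
  have "ev \<Sigma> M (fst (snd (W, W', h))) (\<lambda>t v. ?H (W, W', h) t (\<rho> t v)) t x =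
      ?H (W, W', h) t (ev \<Sigma> M (fst (W, W', h)) \<rho> t x)"
  proof (rule fusion[OF sig model_rep, where H="?H" and nxt=next_kleisli and K=kleislis, OF
        next_kleisli_kleislis _ next_kleisli_wk _ assms(1) i])
    fix i k u xs
    assume i: "i \<in> kleislis" and k: "k \<in> ars \<Sigma>" "u \<in> vecs (ctys \<Sigma>) (deg \<Sigma> k)"
      and xs: "list_all2 (\<lambda>d x. x \<in> mcar M (mexts M (map (tinst u) (fst d)) (fst i)) (tinst u (snd d)))
        (ar_dom \<Sigma> k) xs"
    obtain W W' h where [simp]: "i = (W, W', h)" by (cases i)
    have "Tuple xs \<in> carr (mobj (classic_mod R (ar_dom \<Sigma> k) (map g u)) W)"
      using xs unfolding carr_classic[OF arity(1)[OF k(1)] k(2)] by simp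
    from rbind_oper[OF k _ _ _ this, of W' h] i
    show "?H i (tinst u (ar_cod \<Sigma> k)) (mop M k u (fst i) xs) = mop M k u (fst (snd i))
        (map2 (\<lambda>d x. ?H (fold next_kleisli (map (tinst u) (fst d)) i) (tinst u (snd d)) x)
          (ar_dom \<Sigma> k) xs)"
      by (simp add: fold_next_kleisli kleislis_def)
  qed (use assms in \<open>auto simp: kleislis_def\<close>)
  then show ?thesis by simp
qed

lemma rbind_mshifts:
  assumes "set ss \<subseteq> ctys \<Sigma>" "cx W" "cx W'" "h \<in> kleisli R W W'" "\<rho> \<in> menvs \<Sigma> M V W"
    and "t \<in> ctys \<Sigma>" "v \<in> addvars ss V t"
  shows "rbind R (addvars (map g ss) W) (addvars (map g ss) W') (rshifts R (map g ss) W' h) (g t)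
      (mshifts M ss W \<rho> t v) = mshifts M ss W' (\<lambda>t v. rbind R W W' h (g t) (\<rho> t v)) t v"
proof -
  let ?H = "\<lambda>(W, W', h) t. rbind R W W' h (g t)"
  have i: "(W, W', h) \<in> kleislis" using assms by (simp add: kleislis_def)
  have "\<forall>t\<in>ctys \<Sigma>. \<forall>v\<in>addvars ss V t.
      mshifts M ss (fst (snd (W, W', h))) (\<lambda>t v. ?H (W, W', h) t (\<rho> t v)) t v =
      ?H (fold next_kleisli ss (W, W', h)) t (mshifts M ss (fst (W, W', h)) \<rho> t v)"
    using fusion_mshifts[OF sig model_rep, where H="?H" and nxt=next_kleisli and K=kleislis, OF
        next_kleisli_kleislis _ next_kleisli_wk i assms(1), of \<rho> V] assms(5)
    by (auto simp: kleislis_def)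
  then show ?thesis using assms(6,7) by (simp add: fold_next_kleisli)
qed

text \<open>Weakening in \<open>R\<close> is itself a bind, so this is an instance of
  \<open>rbind_ev\<close>.\<close>

lemma wk_natural_rep: "wk_natural \<Sigma> M"
  unfolding wk_natural_def
  by (auto simp: wk_def rbind_ev wk_kleisli cx_addvar g_tys)

definition var_env :: "'a ctx \<Rightarrow> 'a mor" where
  "var_env V t v = unit R (retype g V) (g t) (pair t v)"

definition interp :: "'a ctx \<Rightarrow> 'a mor" where
  "interp V = ev \<Sigma> M (retype g V) (var_env V)"

lemma var_env_menvs: "ctx small (ctys \<Sigma>) V \<Longrightarrow> var_env V \<in> menvs \<Sigma> M V (retype g V)"
  using unit_carr[OF cx_retype] by (auto simp: menvs_def var_env_def retype_def)

lemma interp_carr: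
  assumes "ctx small (ctys \<Sigma>) V" "tm \<Sigma> V t x"
  shows "interp V t x \<in> carr (obj R (retype g V) (g t))"
  using ev_mcar[OF sig assms(2) model_rep _ var_env_menvs[OF assms(1)]] cx_retype[OF assms(1)]
  by (simp add: interp_def)

text \<open>Both sides evaluate \<open>x\<close> under the assignment of
  \<open>interp W t (f t v)\<close> to \<open>v\<close>: the left one by \<open>ev_sub\<close>, the
  right one by \<open>rbind_ev\<close> and the unit law.\<close>

lemma interp_sub:
  assumes V: "ctx small (ctys \<Sigma>) V" and W: "ctx small (ctys \<Sigma>) W" and x: "tm \<Sigma> V t x"
    and f: "f \<in> menvs \<Sigma> (sub_model \<Sigma>) V W"
  shows "interp W t (ev \<Sigma> (sub_model \<Sigma>) W f t x) =
    rbind R (retype g V) (retype g W) (\<lambda>t' p. interp W (idx p) (f (idx p) (val p))) (g t)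
      (interp V t x)"
    (is "_ = rbind R _ _ ?h _ _")
proof -
  have h: "?h \<in> kleisli R (retype g V) (retype g W)"
    using f interp_carr[OF W] V
    by (force simp: kleisli_def retype_def menvs_def ctx_def)
  have "rbind R (retype g V) (retype g W) ?h (g t) (interp V t x) =
      ev \<Sigma> M (retype g W) (\<lambda>t v. rbind R (retype g V) (retype g W) ?h (g t) (var_env V t v)) t x"
    unfolding interp_def[of V] by (intro rbind_ev[OF x] cx_retype V W h var_env_menvs)
  also have "\<dots> = ev \<Sigma> M (retype g W) (\<lambda>t v. interp W t (f t v)) t x"
  proof (intro ev_cong[OF x] ballI)
    fix t v assume "v \<in> V t"
    then have "pair t v \<in> retype g V (g t)" by (auto simp: retype_def)
    then show "rbind R (retype g V) (retype g W) ?h (g t) (var_env V t v) = interp W t (f t v)"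
      unfolding var_env_def using rbind_unit[OF cx_retype[OF V] cx_retype[OF W] h] by simp
  qed
  also have "\<dots> = interp W t (ev \<Sigma> (sub_model \<Sigma>) W f t x)"
    unfolding interp_def
    using ev_sub[OF sig model_rep wk_natural_rep x f var_env_menvs[OF W]] cx_retype[OF W] by simp
  finally show ?thesis by simp
qed

end


section \<open>Induced maps on derived modules\<close>

lemma fmod_lift_derivs:
  "fmod_lift R (derivs R ss (taut R)) V W r =
   rbind R (addvars ss V) (addvars ss W) (rshifts R ss W (\<lambda>t v. unit R W t (r t v)))"
proof -
  have "fmod_lift R (derivs R ss (taut R)) V W r =
      rbind R (addvars ss V) (addvars ss W) (rshifts R ss W (fcomp V r (unit R W)))"
    unfolding fmod_lift_def by (rule fbind_derivs) (simp add: fcomp_def)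
  also have "\<dots> = rbind R (addvars ss V) (addvars ss W) (rshifts R ss W (\<lambda>t v. unit R W t (r t v)))"
    by (rule rbind_cong, rule rshifts_cong[of V]) (auto simp: fcomp_def compose_def)
  finally show ?thesis .
qed

lemma retype_addvar_pair:
  "z \<in> addvar s V t \<Longrightarrow> retype_addvar g s V (g t) (pair t z) = (if z = fresh then fresh else old (pair t (unold z)))"
  by (auto simp: retype_addvar_def retype_def)

text \<open>Apart from the map on types, \<open>hat\<close> consults the morphism only once, in the
  fully extended context; what follows are renamings in the target. This makes an induction
  hypothesis about \<open>cmap\<close> usable in the proof of uniqueness.\<close>

lemma hat_cong:
  assumes "tmap m = tmap m'"
    and "cmap m (addvars ss V) (tmap m t) (pair t x) = cmap m' (addvars ss V) (tmap m t) (pair t x)"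
  shows "hat Q m ss V t x = hat Q m' ss V t x"
  using assms(2) by (induction ss arbitrary: V) (simp_all add: assms(1))

context representation
begin

lemma kleisli_retype_addvar:
  assumes "ctx small (ctys \<Sigma>) V" "s \<in> ctys \<Sigma>"
  shows "(\<lambda>t v. unit R (addvar (g s) (retype g V)) t (retype_addvar g s V t v)) \<in>
    kleisli R (retype g (addvar s V)) (addvar (g s) (retype g V))"
proof -
  have "retype_addvar g s V t' p \<in> addvar (g s) (retype g V) t'"
    if p': "p \<in> retype g (addvar s V) t'" for t' p
  proof -
    obtain t z where z: "p = pair t z" "t' = g t" "z \<in> addvar s V t"
      using p' unfolding retype_def by blast
    from z(3) show ?thesis
      by (cases rule: addvar_cases) (auto simp: z(1,2) retype_addvar_pair, auto simp: retype_def)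
  qed
  then show ?thesis
    using assms by (auto simp: kleisli_def intro!: unit_carr cx_addvar cx_retype g_tys)
qed

context
  fixes m :: "'a monad_mor"
  assumes tmap: "tmap m = g"
    and cmap: "\<And>V t x. ctx small (ctys \<Sigma>) V \<Longrightarrow> tm \<Sigma> V t x \<Longrightarrow> cmap m V (g t) (pair t x) = interp V t x"
begin

text \<open>Identifies \<open>hat\<close> with the evaluation that \<open>ev\<close> performs on an
  argument under the binders \<open>ss\<close>. Each binder contributes one renaming along
  \<open>retype_addvar\<close>, which \<open>rbind_ev\<close> and \<open>rbind_mshifts\<close> push
  into the assignment.\<close>

lemma hat_eq_ev:
  assumes "ctx small (ctys \<Sigma>) V" "set ss \<subseteq> ctys \<Sigma>" "tm \<Sigma> (addvars ss V) t x"
  shows "hat R m ss V t x =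
    ev \<Sigma> M (addvars (map g ss) (retype g V)) (mshifts M ss (retype g V) (var_env V)) t x"
  using assms
proof (induction ss arbitrary: V)
  case Nil
  then show ?case by (simp add: tmap cmap interp_def)
next
  case (Cons s ss)
  have s: "s \<in> ctys \<Sigma>" and ss: "set ss \<subseteq> ctys \<Sigma>" using Cons.prems(2) by auto
  have V': "ctx small (ctys \<Sigma>) (addvar s V)" using Cons.prems(1) s by (rule ctx_addvar[OF univ])
  have x: "tm \<Sigma> (addvars ss (addvar s V)) t x" using Cons.prems(3) by simp
  let ?W = "retype g (addvar s V)" and ?W' = "addvar (g s) (retype g V)"
  let ?r = "\<lambda>t v. unit R ?W' t (retype_addvar g s V t v)"
  let ?ss = "map g ss"
  have cx: "cx ?W" "cx ?W'" using V' Cons.prems(1) s by (auto intro!: cx_addvar cx_retype g_tys)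
  have cxs: "cx (addvars ?ss ?W)" "cx (addvars ?ss ?W')"
    using cx map_g_tys[OF ss] by (auto intro!: cx_addvars)
  have r: "?r \<in> kleisli R ?W ?W'" using Cons.prems(1) s by (rule kleisli_retype_addvar)
  have env: "mshifts M ss ?W (var_env (addvar s V)) \<in> menvs \<Sigma> M (addvars ss (addvar s V)) (addvars ?ss ?W)"
    using mshifts_menvs[OF sig model_rep ss _ var_env_menvs[OF V']] cx by simp
  have "hat R m (s # ss) V t x = rbind R (addvars ?ss ?W) (addvars ?ss ?W') (rshifts R ?ss ?W' ?r) (g t)
      (ev \<Sigma> M (addvars ?ss ?W) (mshifts M ss ?W (var_env (addvar s V))) t x)"
    by (simp add: fmod_lift_derivs tmap Cons.IH[OF V' ss x])
  also have "\<dots> = ev \<Sigma> M (addvars ?ss ?W') (\<lambda>t v. rbind R (addvars ?ss ?W) (addvars ?ss ?W')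
      (rshifts R ?ss ?W' ?r) (g t) (mshifts M ss ?W (var_env (addvar s V)) t v)) t x"
    by (rule rbind_ev[OF x cxs rshifts_kleisli[OF cx map_g_tys[OF ss] r] env])
  also have "\<dots> = ev \<Sigma> M (addvars ?ss ?W')
      (mshifts M ss ?W' (\<lambda>t v. rbind R ?W ?W' ?r (g t) (var_env (addvar s V) t v))) t x"
    by (intro ev_cong[OF x] ballI) (rule rbind_mshifts[OF ss cx r var_env_menvs[OF V']])
  also have "\<dots> = ev \<Sigma> M (addvars ?ss ?W')
      (mshifts M ss ?W' (mshift M s (retype g V) (var_env V))) t x"
  proof (intro ev_cong[OF x] mshifts_cong ballI)
    fix t v assume v: "v \<in> addvar s V t"
    then have "pair t v \<in> ?W (g t)" by (auto simp: retype_def)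
    then have "rbind R ?W ?W' ?r (g t) (var_env (addvar s V) t v) =
        unit R ?W' (g t) (retype_addvar g s V (g t) (pair t v))"
      unfolding var_env_def by (rule rbind_unit[OF cx r])
    \<comment> \<open>The renaming takes the fresh variable to the fresh variable, and an old one to
      a weakened unit.\<close>
    also have "\<dots> = mshift M s (retype g V) (var_env V) t v"
      using v
    proof (cases rule: addvar_cases)
      case (1 w)
      then have "pair t w \<in> retype g V (g t)" by (auto simp: retype_def)
      from wk_unit[OF cx_retype[OF Cons.prems(1)] g_tys[OF s] this] show ?thesis
        using 1 by (simp add: retype_addvar_pair var_env_def)
    qed (simp add: retype_addvar_pair)
    finally show "rbind R ?W ?W' ?r (g t) (var_env (addvar s V) t v) =
        mshift M s (retype g V) (var_env V) t v" .
  qed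
  finally show ?case by simp
qed

lemma hat_carr:
  assumes "ctx small (ctys \<Sigma>) V" "set ss \<subseteq> ctys \<Sigma>" "tm \<Sigma> (addvars ss V) t x"
  shows "hat R m ss V t x \<in> carr (obj R (addvars (map g ss) (retype g V)) (g t))"
  unfolding hat_eq_ev[OF assms]
  using ev_mcar[OF sig assms(3) model_rep _
      mshifts_menvs[OF sig model_rep assms(2) _ var_env_menvs[OF assms(1)]]]
    mexts_mctx[OF sig model_rep assms(2)] cx_retype[OF assms(1)]
  by simp

text \<open>Starting from \<open>interp\<close> in the extended context, \<open>hat\<close> only
  applies binds of \<open>R\<close>, and these are monotone.\<close>

lemma hat_mono:
  assumes "ctx small (ctys \<Sigma>) V" "set ss \<subseteq> ctys \<Sigma>"
    and "tm \<Sigma> (addvars ss V) t x" "tm \<Sigma> (addvars ss V) t y"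
    and "(interp (addvars ss V) t x, interp (addvars ss V) t y) \<in>
      leq (obj R (retype g (addvars ss V)) (g t))"
  shows "(hat R m ss V t x, hat R m ss V t y) \<in> leq (obj R (addvars (map g ss) (retype g V)) (g t))"
  using assms
proof (induction ss arbitrary: V)
  case Nil
  then show ?case by (simp add: tmap cmap)
next
  case (Cons s ss)
  have s: "s \<in> ctys \<Sigma>" and ss: "set ss \<subseteq> ctys \<Sigma>" using Cons.prems(2) by auto
  have V': "ctx small (ctys \<Sigma>) (addvar s V)" using Cons.prems(1) s by (rule ctx_addvar[OF univ])
  have cx: "cx (retype g (addvar s V))" "cx (addvar (g s) (retype g V))"
    using V' Cons.prems(1) s by (auto intro!: cx_addvar cx_retype g_tys)
  show ?case
    using Cons.IH[OF V' ss] Cons.prems cx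
      kleisli_retype_addvar[OF Cons.prems(1) s] map_g_tys[OF ss]
    by (auto simp: fmod_lift_derivs tmap intro!: rbind_mono cx_addvars rshifts_kleisli)
qed

text \<open>The renamings between \<open>interp\<close> and \<open>hat\<close> have inverse
  renamings, whose binds are monotone as well. Being classic, the codomain of an inequation is
  compared through exactly such maps.\<close>

lemma hat_reflects:
  assumes "ctx small (ctys \<Sigma>) V" "set ss \<subseteq> ctys \<Sigma>"
    and "tm \<Sigma> (addvars ss V) t x" "tm \<Sigma> (addvars ss V) t y"
    and "(hat R m ss V t x, hat R m ss V t y) \<in> leq (obj R (addvars (map g ss) (retype g V)) (g t))"
  shows "(interp (addvars ss V) t x, interp (addvars ss V) t y) \<in>
    leq (obj R (retype g (addvars ss V)) (g t))"
  using assms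
proof (induction ss arbitrary: V)
  case Nil
  then show ?case by (simp add: tmap cmap)
next
  case (Cons s ss)
  have s: "s \<in> ctys \<Sigma>" and ss: "set ss \<subseteq> ctys \<Sigma>" using Cons.prems(2) by auto
  have V': "ctx small (ctys \<Sigma>) (addvar s V)" using Cons.prems(1) s by (rule ctx_addvar[OF univ])
  have xy: "tm \<Sigma> (addvars ss (addvar s V)) t x" "tm \<Sigma> (addvars ss (addvar s V)) t y"
    using Cons.prems(3,4) by auto
  let ?W = "retype g (addvar s V)" and ?W' = "addvar (g s) (retype g V)"
  let ?r = "\<lambda>t v. unit R ?W' t (retype_addvar g s V t v)"
  \<comment> \<open>\<open>?j\<close> inverts \<open>retype_addvar g s V\<close>;
    \<open>fresh\<close> returns to the fresh variable in the summand with index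
    \<open>s\<close>.\<close>
  let ?j = "\<lambda>z. if z = fresh then pair s fresh else pair (idx (unold z)) (old (val (unold z)))"
  let ?h = "\<lambda>t z. unit R ?W t (?j z)"
  let ?ss = "map g ss"
  have cx: "cx ?W" "cx ?W'" using V' Cons.prems(1) s by (auto intro!: cx_addvar cx_retype g_tys)
  have r: "?r \<in> kleisli R ?W ?W'" using Cons.prems(1) s by (rule kleisli_retype_addvar)
  have j: "?j z \<in> ?W t'" if "z \<in> ?W' t'" for z t'
    using that by (cases rule: addvar_cases) (auto simp: retype_def)
  then have h: "?h \<in> kleisli R ?W' ?W" 
    unfolding kleisli_def using unit_carr[OF cx(1)] by blast
  have inv: "rbind R ?W' ?W ?h t' (?r t' p) = unit R ?W t' p" if p': "p \<in> ?W t'" for t' p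
  proof -
    obtain t z where p: "p = pair t z" "t' = g t" and z: "z \<in> addvar s V t"
      using p' unfolding retype_def by blast
    have "retype_addvar g s V t' p \<in> ?W' t' \<and> ?j (retype_addvar g s V t' p) = p"
      using z by (cases rule: addvar_cases) (auto simp: p retype_addvar_pair, auto simp: retype_def)
    then show ?thesis by (simp add: rbind_unit[OF cx(2,1) h])
  qed
  note mono = rbind_mono[OF cx_addvars[OF cx(2)] cx_addvars[OF cx(1)]
      rshifts_kleisli[OF cx(2,1) _ h]]
  \<comment> \<open>Binding along the shifted \<open>?h\<close> undoes the renaming contributed by
    \<open>s\<close>.\<close>
  have "(hat R m ss (addvar s V) t x, hat R m ss (addvar s V) t y) \<in> leq (obj R (addvars ?ss ?W) (g t))"
    using mono[OF map_g_tys[OF ss] map_g_tys[OF ss] map_g_tys[OF ss], of _ _ "g t"] Cons.prems(5)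
      rshifts_inverse[OF cx map_g_tys[OF ss] r h inv hat_carr[OF V' ss xy(1)]]
      rshifts_inverse[OF cx map_g_tys[OF ss] r h inv hat_carr[OF V' ss xy(2)]]
    by (force simp: fmod_lift_derivs tmap)
  then show ?case using Cons.IH[OF V' ss xy] by simp
qed

text \<open>Unfolding \<open>ev\<close> once leaves the arguments evaluated under their binders, and
  \<open>hat_eq_ev\<close> recognises these as values of \<open>hat\<close>.\<close>

lemma interp_op:
  assumes V: "ctx small (ctys \<Sigma>) V" and k: "k \<in> ars \<Sigma>" and u: "u \<in> vecs (ctys \<Sigma>) (deg \<Sigma> k)"
    and xs: "list_all2 (\<lambda>d x. tm \<Sigma> (addvars (map (tinst u) (fst d)) V) (tinst u (snd d)) x)
      (ar_dom \<Sigma> k) xs"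
  shows "interp V t (Tuple (k # Tuple u # xs)) = oper R k (map g u) (retype g V)
    (Tuple (map2 (\<lambda>d. hat R m (map (tinst u) (fst d)) V (tinst u (snd d))) (ar_dom \<Sigma> k) xs))"
proof -
  have "map2 (\<lambda>d. hat R m (map (tinst u) (fst d)) V (tinst u (snd d))) (ar_dom \<Sigma> k) xs =
    map2 (\<lambda>d. ev \<Sigma> M (mexts M (map (tinst u) (fst d)) (retype g V))
      (mshifts M (map (tinst u) (fst d)) (retype g V) (var_env V)) (tinst u (snd d))) (ar_dom \<Sigma> k) xs"
    using xs by (rule map2_cong_all2) (use hat_eq_ev[OF V arity_sorts(1)[OF sig k u]] in simp)
  then show ?thesis by (simp only: interp_def ev.simps rep_model_simps(5))
qed

end

end


section \<open>The representation on terms\<close>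

lemma tuple_closure_mono:
  assumes "B \<subseteq> C"
  shows "tuple_closure B \<subseteq> tuple_closure C"
proof
  fix x assume "x \<in> tuple_closure B"
  then show "x \<in> tuple_closure C"
    by induction (use assms in \<open>auto intro: tuple_closure.intros\<close>)
qed

lemma addvars_tuple_closure:
  assumes "\<And>t. V t \<subseteq> tuple_closure B"
  shows "addvars ss V t \<subseteq> tuple_closure B"
  using assms
proof (induction ss arbitrary: V)
  case (Cons s ss)
  have "addvar s V t \<subseteq> tuple_closure B" for t
    using Cons.prems[of t]
    by (auto simp: addvar_def old_def fresh_def split: if_splits intro!: tuple_closure.Tuple)
  then show ?case using Cons.IH by simp
qed simp

text \<open>The bound \<open>B\<close> stays the same under binders because \<open>old v\<close> and
  \<open>fresh\<close> are again tuples over the closure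
  (\<open>addvars_tuple_closure\<close>).\<close>

lemma tm_tuple_closure:
  assumes "tm \<Sigma> V t x" "ars \<Sigma> \<subseteq> B" "tops \<Sigma> \<subseteq> B" "\<And>t. V t \<subseteq> tuple_closure B"
  shows "x \<in> tuple_closure B"
  using assms
proof (induction)
  case (var t v V)
  then have "v \<in> tuple_closure B" by blast
  then show ?case by (auto intro!: tuple_closure.Tuple)
next
  case (op k u V xs)
  have "k \<in> tuple_closure B" using op by (auto intro: tuple_closure.base)
  moreover have "Tuple u \<in> tuple_closure B"
    using op.hyps(2) ctys_tuple_closure[of _ \<Sigma>] tuple_closure_mono[OF op.prems(2)]
    by (intro tuple_closure.Tuple) (auto simp: vecs_def)
  moreover have "x \<in> tuple_closure B" if x: "x \<in> set xs" for x
  proof -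
    obtain i where "i < length xs" "x = xs ! i" using x by (auto simp: in_set_conv_nth)
    then show ?thesis
      using op.IH op.prems addvars_tuple_closure[OF op.prems(3)]
      by (auto simp: list_all2_conv_all_nth)
  qed
  ultimately show ?case by (intro tuple_closure.Tuple) auto
qed

lemma small_tm:
  assumes "set_universe small" "typed_signature small \<Sigma>" "ctx small (ctys \<Sigma>) V"
  shows "small {x. tm \<Sigma> V t x}"
proof -
  let ?B = "ars \<Sigma> \<union> tops \<Sigma> \<union> (\<Union>t\<in>ctys \<Sigma>. V t)"
  have "small (\<Union>t\<in>ctys \<Sigma>. V t)"
    using assms small_ctys[OF assms(1), of \<Sigma>]
    by (intro small_UNION[OF assms(1)]) (auto simp: typed_signature_def ctx_def)
  then have "small ?B"
    using assms(2) by (intro small_Un[OF assms(1)]) (auto simp: typed_signature_def)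
  moreover have "{x. tm \<Sigma> V t x} \<subseteq> tuple_closure ?B"
  proof safe
    fix x assume "tm \<Sigma> V t x"
    moreover have "V t \<subseteq> tuple_closure ?B" for t
      using assms(3) by (cases "t \<in> ctys \<Sigma>") (auto simp: ctx_def intro: tuple_closure.base)
    ultimately show "x \<in> tuple_closure ?B" by (intro tm_tuple_closure[of \<Sigma> V t]) auto
  qed
  ultimately show ?thesis
    using small_subset[OF assms(1) small_tuple_closure[OF assms(1)]] by blast
qed

text \<open>The largest relation for which interpretation in every representation of the 2-signature
  is monotone.\<close>

definition term_le ::
  "('a univ set \<Rightarrow> bool) \<Rightarrow> 'a tsig \<Rightarrow> 'a ineq set \<Rightarrow> 'a ctx \<Rightarrow> 'a univ \<Rightarrow> 'a univ rel" where
  "term_le small \<Sigma> A V t = {(x, y). tm \<Sigma> V t x \<and> tm \<Sigma> V t y \<and>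
     (\<forall>R. rep_2sig small \<Sigma> A R \<longrightarrow>
        (representation.interp small R \<Sigma> V t x, representation.interp small R \<Sigma> V t y) \<in>
        leq (obj R (retype (ty_map \<Sigma> R) V) (ty_map \<Sigma> R t)))}"

definition term_rep :: "('a univ set \<Rightarrow> bool) \<Rightarrow> 'a tsig \<Rightarrow> 'a ineq set \<Rightarrow> 'a rep" where
  "term_rep small \<Sigma> A =
     \<lparr>tys = ctys \<Sigma>, tyop = (\<lambda>j us. Tuple (j # us)),
      obj = (\<lambda>V t. \<lparr>carr = {x. tm \<Sigma> V t x}, leq = term_le small \<Sigma> A V t\<rparr>),
      unit = (\<lambda>V t. \<lambda>v\<in>V t. Tuple [v]),
      bind = (\<lambda>V W f t. \<lambda>x\<in>{x. tm \<Sigma> V t x}. ev \<Sigma> (sub_model \<Sigma>) W f t x),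
      oper = (\<lambda>k u V. \<lambda>x\<in>{Tuple xs | xs. list_all2 (\<lambda>d x.
          tm \<Sigma> (addvars (map (tinst u) (fst d)) V) (tinst u (snd d)) x) (ar_dom \<Sigma> k) xs}.
        Tuple (k # Tuple u # comps x))\<rparr>"

lemma term_rep_simps [simp]:
  "tys (term_rep small \<Sigma> A) = ctys \<Sigma>"
  "tyop (term_rep small \<Sigma> A) = (\<lambda>j us. Tuple (j # us))"
  "obj (term_rep small \<Sigma> A) V t = \<lparr>carr = {x. tm \<Sigma> V t x}, leq = term_le small \<Sigma> A V t\<rparr>"
  "unit (term_rep small \<Sigma> A) V t = (\<lambda>v\<in>V t. Tuple [v])"
  "bind (term_rep small \<Sigma> A) V W f t = (\<lambda>x\<in>{x. tm \<Sigma> V t x}. ev \<Sigma> (sub_model \<Sigma>) W f t x)"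
  "oper (term_rep small \<Sigma> A) k u V = (\<lambda>x\<in>{Tuple xs | xs. list_all2 (\<lambda>d x.
      tm \<Sigma> (addvars (map (tinst u) (fst d)) V) (tinst u (snd d)) x) (ar_dom \<Sigma> k) xs}.
    Tuple (k # Tuple u # comps x))"
  by (simp_all add: term_rep_def)

lemma teval_term_rep [simp]: "teval (term_rep small \<Sigma> A) u = tinst u"
  by (rule ext, rule teval_tuple) simp

section \<open>The reduction monad of terms\<close>

locale term_representation =
  fixes small :: "'a univ set \<Rightarrow> bool" and \<Sigma> :: "'a tsig" and A :: "'a ineq set"
  assumes univ: "set_universe small" and sig: "typed_signature small \<Sigma>"
begin

abbreviation "I \<equiv> term_rep small \<Sigma> A"
abbreviation "tcx \<equiv> ctx small (ctys \<Sigma>)"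

lemma representation: "rep_2sig small \<Sigma> A R \<Longrightarrow> representation small R \<Sigma>"
  using univ sig by unfold_locales (auto simp: rep_2sig_def rep_def relative_S_monad_def)

lemma term_leI:
  assumes "tm \<Sigma> V t x" "tm \<Sigma> V t y"
    and "\<And>R. rep_2sig small \<Sigma> A R \<Longrightarrow> representation small R \<Sigma> \<Longrightarrow>
      (representation.interp small R \<Sigma> V t x, representation.interp small R \<Sigma> V t y) \<in>
      leq (obj R (retype (ty_map \<Sigma> R) V) (ty_map \<Sigma> R t))"
  shows "(x, y) \<in> term_le small \<Sigma> A V t"
  using assms representation by (simp add: term_le_def)

lemma term_leD:
  assumes "(x, y) \<in> term_le small \<Sigma> A V t"
  shows "tm \<Sigma> V t x" "tm \<Sigma> V t y"
    "rep_2sig small \<Sigma> A R \<Longrightarrow>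
      (representation.interp small R \<Sigma> V t x, representation.interp small R \<Sigma> V t y) \<in>
      leq (obj R (retype (ty_map \<Sigma> R) V) (ty_map \<Sigma> R t))"
  using assms by (auto simp: term_le_def)

lemma term_le_preorder:
  assumes "tcx V"
  shows "preorder_on {x. tm \<Sigma> V t x} (term_le small \<Sigma> A V t)"
proof -
  have "(x, x) \<in> term_le small \<Sigma> A V t" if "tm \<Sigma> V t x" for x
  proof (rule term_leI[OF that that])
    fix R assume "representation small R \<Sigma>"
    then interpret representation small R \<Sigma> .
    show "(interp V t x, interp V t x) \<in> leq (obj R (retype g V) (g t))"
      using assms that by (intro leq_refl cx_retype interp_carr)
  qed
  moreover have "(x, z) \<in> term_le small \<Sigma> A V t"
    if xy: "(x, y) \<in> term_le small \<Sigma> A V t" and yz: "(y, z) \<in> term_le small \<Sigma> A V t" for x y z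
  proof (rule term_leI[OF term_leD(1)[OF xy] term_leD(2)[OF yz]])
    fix R assume hR: "rep_2sig small \<Sigma> A R" and "representation small R \<Sigma>"
    then interpret representation small R \<Sigma> by blast
    show "(interp V t x, interp V t z) \<in> leq (obj R (retype g V) (g t))"
      using term_leD(3)[OF xy hR] term_leD(3)[OF yz hR] by (rule leq_trans[OF cx_retype[OF assms]])
  qed
  ultimately show ?thesis
    by (auto simp: preorder_on_def refl_on_def trans_def dest: term_leD(1,2))
qed

lemma term_le_refl: "tcx V \<Longrightarrow> tm \<Sigma> V t x \<Longrightarrow> (x, x) \<in> term_le small \<Sigma> A V t"
  using term_le_preorder[of V t] by (simp add: preorder_on_def refl_on_def)

lemma tm_var: "tcx V \<Longrightarrow> v \<in> V t \<Longrightarrow> tm \<Sigma> V t (Tuple [v])"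
  by (cases "t \<in> ctys \<Sigma>") (auto simp: ctx_def intro: tm.var)

lemma fhom_menvs:
  "f \<in> fhom (disc V) (obj I W) \<Longrightarrow> f \<in> menvs \<Sigma> (sub_model \<Sigma>) V W"
  by (auto simp: fhom_def phom_def disc_def menvs_def)

lemma fhom_disc_ext: "f \<in> fhom (disc V) (obj I W) \<Longrightarrow> f t \<in> extensional (V t)"
  by (auto simp: fhom_def phom_def disc_def PiE_def)

lemma tm_sub:
  "tm \<Sigma> V t x \<Longrightarrow> f \<in> menvs \<Sigma> (sub_model \<Sigma>) V W \<Longrightarrow> tm \<Sigma> W t (ev \<Sigma> (sub_model \<Sigma>) W f t x)"
  using ev_mcar[OF sig _ model_sub[OF sig], of V t x W f] by simp

lemma kleisli_interp:
  assumes "representation small R \<Sigma>" "tcx V" "tcx W" "f \<in> menvs \<Sigma> (sub_model \<Sigma>) V W"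
  shows "(\<lambda>t' p. representation.interp small R \<Sigma> W (idx p) (f (idx p) (val p))) \<in>
    kleisli R (retype (ty_map \<Sigma> R) V) (retype (ty_map \<Sigma> R) W)"
proof -
  interpret representation small R \<Sigma> by fact
  show ?thesis
    using assms(2,4) interp_carr[OF assms(3)]
    by (force simp: kleisli_def retype_def menvs_def ctx_def)
qed

text \<open>Interpretation turns substitution into a bind of \<open>R\<close>, which is monotone in
  its argument.\<close>

lemma sub_mono:
  assumes V: "tcx V" and W: "tcx W" and f: "f \<in> menvs \<Sigma> (sub_model \<Sigma>) V W"
    and xy: "(x, y) \<in> term_le small \<Sigma> A V t"
  shows "(ev \<Sigma> (sub_model \<Sigma>) W f t x, ev \<Sigma> (sub_model \<Sigma>) W f t y) \<in> term_le small \<Sigma> A W t"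
proof (intro term_leI tm_sub[OF _ f] term_leD(1,2)[OF xy])
  fix R assume hR: "rep_2sig small \<Sigma> A R" "representation small R \<Sigma>"
  interpret representation small R \<Sigma> by fact
  show "(interp W t (ev \<Sigma> (sub_model \<Sigma>) W f t x), interp W t (ev \<Sigma> (sub_model \<Sigma>) W f t y)) \<in>
      leq (obj R (retype g W) (g t))"
    unfolding interp_sub[OF V W term_leD(1)[OF xy] f] interp_sub[OF V W term_leD(2)[OF xy] f]
    using term_leD(3)[OF xy hR(1)] V W
    by (intro rbind_mono cx_retype kleisli_interp[OF hR(2) V W f])
qed

text \<open>Here the defining property of a reduction monad, monotonicity of \<open>bind\<close> in
  the Kleisli map, is carried over from each \<open>R\<close> to the terms.\<close>

lemma sub_mono_env:
  assumes V: "tcx V" and W: "tcx W"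
    and f: "f \<in> menvs \<Sigma> (sub_model \<Sigma>) V W" "f' \<in> menvs \<Sigma> (sub_model \<Sigma>) V W"
    and le: "\<And>t v. v \<in> V t \<Longrightarrow> (f t v, f' t v) \<in> term_le small \<Sigma> A W t" and x: "tm \<Sigma> V t x"
  shows "(ev \<Sigma> (sub_model \<Sigma>) W f t x, ev \<Sigma> (sub_model \<Sigma>) W f' t x) \<in> term_le small \<Sigma> A W t"
proof (intro term_leI tm_sub[OF x] f)
  fix R assume hR: "rep_2sig small \<Sigma> A R" "representation small R \<Sigma>"
  interpret representation small R \<Sigma> by fact
  show "(interp W t (ev \<Sigma> (sub_model \<Sigma>) W f t x), interp W t (ev \<Sigma> (sub_model \<Sigma>) W f' t x)) \<in>
      leq (obj R (retype g W) (g t))"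
    unfolding interp_sub[OF V W x f(1)] interp_sub[OF V W x f(2)]
  proof (rule rbind_le[OF cx_retype[OF V] cx_retype[OF W]
        kleisli_interp[OF hR(2) V W f(1)] kleisli_interp[OF hR(2) V W f(2)] _ interp_carr[OF V x]])
    fix t' p assume "p \<in> retype g V t'"
    then show "(interp W (idx p) (f (idx p) (val p)), interp W (idx p) (f' (idx p) (val p))) \<in>
        leq (obj R (retype g W) t')"
      using term_leD(3)[OF le hR(1)] by (auto simp: retype_def)
  qed
qed

lemma var_fhom: "tcx V \<Longrightarrow> unit I V \<in> fhom (disc V) (obj I V)"
  unfolding fhom_def phom_def disc_def
  by (auto intro!: tm_var term_le_refl)

lemma bind_fhom:
  assumes "tcx V" "tcx W" "f \<in> fhom (disc V) (obj I W)"
  shows "bind I V W f \<in> fhom (obj I V) (obj I W)"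
proof -
  note f = fhom_menvs[OF assms(3)]
  have "bind I V W f t \<in> phom (obj I V t) (obj I W t)" for t
  proof -
    have "bind I V W f t \<in> carr (obj I V t) \<rightarrow>\<^sub>E carr (obj I W t)"
      using tm_sub[OF _ f] by simp
    moreover have "(bind I V W f t x, bind I V W f t y) \<in> leq (obj I W t)"
      if "(x, y) \<in> leq (obj I V t)" for x y
      using that sub_mono[OF assms(1,2) f, of x y t] term_leD(1,2)[of x y V t] by simp
    ultimately show ?thesis by (auto simp: phom_def simp del: term_rep_simps)
  qed
  then show ?thesis by (simp add: fhom_def)
qed

lemma fcomp_unit_bind:
  assumes "tcx V" "f \<in> fhom (disc V) (obj I W)"
  shows "fcomp V (unit I V) (bind I V W f) = f"
proof (intro ext)
  fix t v
  show "fcomp V (unit I V) (bind I V W f) t v = f t v"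
  proof (cases "v \<in> V t")
    case True
    then have "t \<in> ctys \<Sigma>" using assms(1) by (auto simp: ctx_def)
    then show ?thesis using True by (simp add: fcomp_def compose_def tm.var)
  next
    case False
    then show ?thesis using fhom_disc_ext[OF assms(2), of t]
      by (simp add: fcomp_def compose_def extensional_def)
  qed
qed

lemma bind_bind:
  assumes "f \<in> fhom (disc V) (obj I W)" "h \<in> fhom (disc W) (obj I X)"
  shows "fcomp (carrs (obj I V)) (bind I V W f) (bind I W X h) = bind I V X (fcomp V f (bind I W X h))"
proof (intro ext)
  fix t x
  note f = fhom_menvs[OF assms(1)] and h = fhom_menvs[OF assms(2)]
  show "fcomp (carrs (obj I V)) (bind I V W f) (bind I W X h) t x =
      bind I V X (fcomp V f (bind I W X h)) t x"
  proof (cases "tm \<Sigma> V t x")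
    case True
    have "ev \<Sigma> (sub_model \<Sigma>) X h t (ev \<Sigma> (sub_model \<Sigma>) W f t x) =
        ev \<Sigma> (sub_model \<Sigma>) X (\<lambda>t v. ev \<Sigma> (sub_model \<Sigma>) X h t (f t v)) t x"
      by (rule ev_sub[OF sig model_sub[OF sig] wk_natural_sub[OF sig] True f h]) simp
    also have "\<dots> = ev \<Sigma> (sub_model \<Sigma>) X (fcomp V f (bind I W X h)) t x"
      using f by (intro ev_cong[OF True]) (simp add: fcomp_def compose_def menvs_def)
    finally show ?thesis
      using True tm_sub[OF True f] by (simp add: fcomp_def carrs_def compose_def)
  qed (simp add: fcomp_def carrs_def compose_def)
qed

lemma po_fam_term:
  assumes "tcx V"
  shows "po_fam small (ctys \<Sigma>) (obj I V)"
proof -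
  have "obj I V t = \<lparr>carr = {}, leq = {}\<rparr>" if "t \<notin> ctys \<Sigma>" for t
  proof -
    have "{x. tm \<Sigma> V t x} = {}" "term_le small \<Sigma> A V t = {}"
      using that tm_sort[OF sig, of V t] term_leD(1)[of _ _ V t] by fast+
    then show ?thesis by simp
  qed
  then show ?thesis
    unfolding po_fam_def preo_def using term_le_preorder[OF assms] small_tm[OF univ sig assms] by simp
qed

lemma bind_unit: "bind I V V (unit I V) = fid (carrs (obj I V))"
proof (intro ext)
  fix t x
  show "bind I V V (unit I V) t x = fid (carrs (obj I V)) t x"
    using ev_sub_var[OF sig, of V t x "unit I V"] by (simp add: fid_def carrs_def)
qed

lemma bind_mono:
  assumes "tcx V" "tcx W" "f \<in> fhom (disc V) (obj I W)" "f' \<in> fhom (disc V) (obj I W)"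
    and "fhom_le (disc V) (obj I W) f f'"
  shows "fhom_le (obj I V) (obj I W) (bind I V W f) (bind I V W f')"
  unfolding fhom_le_def
  using sub_mono_env[OF assms(1,2) fhom_menvs[OF assms(3)] fhom_menvs[OF assms(4)]] assms(5)
  by (simp add: fhom_le_def disc_def)

lemma reduction_monad_term: "reduction_monad small I"
  unfolding reduction_monad_def term_rep_simps(1)
  using po_fam_term var_fhom bind_unit bind_fhom fcomp_unit_bind bind_mono bind_bind
  by (intro conjI allI impI ballI) blast+

end


section \<open>Initiality\<close>

text \<open>Restricted at every level, so that uniqueness holds as plain equality of
  records.\<close>

definition canonical :: "('a univ set \<Rightarrow> bool) \<Rightarrow> 'a tsig \<Rightarrow> 'a rep \<Rightarrow> 'a monad_mor" where
  "canonical small \<Sigma> R =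
     \<lparr>tmap = ty_map \<Sigma> R,
      cmap = (\<lambda>V\<in>{V. ctx small (ctys \<Sigma>) V}. \<lambda>t'. \<lambda>p\<in>{pair t x | t x. ty_map \<Sigma> R t = t' \<and> tm \<Sigma> V t x}.
        representation.interp small R \<Sigma> V (idx p) (val p))\<rparr>"

lemma tmap_canonical [simp]: "tmap (canonical small \<Sigma> R) = ty_map \<Sigma> R"
  by (simp add: canonical_def)

lemma cmap_canonical:
  "ctx small (ctys \<Sigma>) V \<Longrightarrow> tm \<Sigma> V t x \<Longrightarrow>
   cmap (canonical small \<Sigma> R) V (ty_map \<Sigma> R t) (pair t x) = representation.interp small R \<Sigma> V t x"
  by (auto simp: canonical_def)

section \<open>Operations on terms and the canonical morphisms\<close>

context term_representation
begin

lemma rbind_term: "tm \<Sigma> V t x \<Longrightarrow> rbind I V W f t x = ev \<Sigma> (sub_model \<Sigma>) W f t x"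
  by (simp add: rbind_def) (rule ev_cong, auto)

text \<open>Weakening in the term monad is a substitution of variables, whereas the substitution
  model weakens by renaming; \<open>ev_sub_eq_ren\<close> reconciles the two.\<close>

lemma wk_term:
  assumes "tm \<Sigma> W t x"
  shows "wk I s W t x = mwk (sub_model \<Sigma>) s W t x"
proof -
  have "wk I s W t x = ev \<Sigma> (sub_model \<Sigma>) (addvar s W) (\<lambda>t v. Tuple [old v]) t x"
    unfolding wk_def rbind_term[OF assms] by (rule ev_cong[OF assms]) simp
  also have "\<dots> = mwk (sub_model \<Sigma>) s W t x"
    by (simp, rule ev_sub_eq_ren[OF sig assms]) (auto simp: menvs_def)
  finally show ?thesis .
qed

lemma rshift_term:
  assumes "tcx V" "f \<in> menvs \<Sigma> (sub_model \<Sigma>) V W" "x \<in> addvar s V t"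
  shows "rshift I s W f t x = mshift (sub_model \<Sigma>) s W f t x"
  using assms(3)
proof (cases rule: addvar_cases)
  case (1 v)
  then have "t \<in> ctys \<Sigma>" using assms(1) by (auto simp: ctx_def)
  then have "tm \<Sigma> W t (f t v)" using assms(2) 1 by (auto simp: menvs_def)
  then show ?thesis using 1 wk_term by simp
qed simp

lemma rshifts_term:
  assumes "tcx V" "set ss \<subseteq> ctys \<Sigma>" "f \<in> menvs \<Sigma> (sub_model \<Sigma>) V W" "x \<in> addvars ss V t"
  shows "rshifts I ss W f t x = mshifts (sub_model \<Sigma>) ss W f t x"
  using assms
proof (induction ss arbitrary: V W f)
  case (Cons s ss)
  have s: "s \<in> ctys \<Sigma>" "set ss \<subseteq> ctys \<Sigma>" using Cons.prems(2) by auto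
  have x: "x \<in> addvars ss (addvar s V) t" using Cons.prems(4) by simp
  have "rshifts I ss (addvar s W) (rshift I s W f) t x =
      rshifts I ss (addvar s W) (mshift (sub_model \<Sigma>) s W f) t x"
    using rshift_term[OF Cons.prems(1,3)] x by (rule rshifts_cong)
  also have "\<dots> = mshifts (sub_model \<Sigma>) ss (addvar s W) (mshift (sub_model \<Sigma>) s W f) t x"
    using mshift_menvs[OF sig model_sub[OF sig] s(1) _ Cons.prems(3)]
    by (intro Cons.IH[OF ctx_addvar[OF univ Cons.prems(1) s(1)] s(2) _ x]) simp
  finally show ?case by simp
qed simp

lemma carr_classic_term:
  "carr (mobj (classic_mod I ds u) V) = {Tuple xs | xs. list_all2 (\<lambda>d x.
     tm \<Sigma> (addvars (map (tinst u) (fst d)) V) (tinst u (snd d)) x) ds xs}"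
  by (simp add: carr_classic_mod)

lemma leq_classic_term:
  "leq (mobj (classic_mod I ds u) V) = {(Tuple xs, Tuple ys) | xs ys.
     length xs = length ds \<and> length ys = length ds \<and> (\<forall>i < length ds. (xs ! i, ys ! i) \<in>
     term_le small \<Sigma> A (addvars (map (tinst u) (fst (ds ! i))) V) (tinst u (snd (ds ! i))))}"
  by (simp add: leq_classic_mod)

lemma classic_hat_term:
  assumes "Tuple xs \<in> carr (mobj (classic_mod I ds u) V)"
  shows "classic_hat I R m ds u V (Tuple xs) =
    Tuple (map2 (\<lambda>d. hat R m (map (tinst u) (fst d)) V (tinst u (snd d))) ds xs)"
  using assms by (simp add: classic_hat_def split_beta)

context
  fixes k u
  assumes k: "k \<in> ars \<Sigma>" and u: "u \<in> vecs (ctys \<Sigma>) (deg \<Sigma> k)"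
begin

text \<open>In each \<open>R\<close> the interpretation of an operation is \<open>oper\<close>
  applied to values of \<open>hat\<close> (\<open>interp_op\<close>); \<open>hat_mono\<close> and
  monotonicity of \<open>oper\<close> give the order there.\<close>

lemma op_mono:
  assumes V: "tcx V" and xy: "(Tuple xs, Tuple ys) \<in> leq (mobj (classic_mod I (ar_dom \<Sigma> k) u) V)"
  shows "(Tuple (k # Tuple u # xs), Tuple (k # Tuple u # ys)) \<in>
    term_le small \<Sigma> A V (tinst u (ar_cod \<Sigma> k))"
proof -
  let ?ss = "\<lambda>d. map (tinst u) (fst d)"
  let ?C = "\<lambda>xs. list_all2 (\<lambda>d x. tm \<Sigma> (addvars (?ss d) V) (tinst u (snd d)) x) (ar_dom \<Sigma> k) xs"
  have len: "length xs = length (ar_dom \<Sigma> k)" "length ys = length (ar_dom \<Sigma> k)"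
    and le: "\<And>i. i < length (ar_dom \<Sigma> k) \<Longrightarrow> (xs ! i, ys ! i) \<in>
     term_le small \<Sigma> A (addvars (?ss (ar_dom \<Sigma> k ! i)) V) (tinst u (snd (ar_dom \<Sigma> k ! i)))"
    using xy unfolding leq_classic_term by auto
  have C: "?C xs" "?C ys"
    using len term_leD(1,2)[OF le] by (auto simp: list_all2_conv_all_nth)
  show ?thesis
  proof (intro term_leI tm.op k u C)
    fix R assume hR: "rep_2sig small \<Sigma> A R" "representation small R \<Sigma>"
    interpret representation small R \<Sigma> by fact
    let ?m = "canonical small \<Sigma> R"
    note m = tmap_canonical cmap_canonical
    let ?h = "\<lambda>xs. map2 (\<lambda>d. hat R ?m (?ss d) V (tinst u (snd d))) (ar_dom \<Sigma> k) xs"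
    have "(hat R ?m (?ss d) V (tinst u (snd d)) (xs ! i), hat R ?m (?ss d) V (tinst u (snd d)) (ys ! i)) \<in>
        leq (obj R (addvars (map g (?ss d)) (retype g V)) (g (tinst u (snd d))))"
      if "i < length (ar_dom \<Sigma> k)" "d = ar_dom \<Sigma> k ! i" for i d
      using that term_leD[OF le[OF that(1)]] hR(1) arity_sorts(1)[OF sig k u, of d]
      by (intro hat_mono[OF m V]) auto
    then have "(Tuple (?h xs), Tuple (?h ys)) \<in>
        leq (mobj (classic_mod R (ar_dom \<Sigma> k) (map g u)) (retype g V))"
      unfolding leq_classic[OF arity(1)[OF k] u] using len by simp
    moreover have "interp V t (Tuple (k # Tuple u # xs)) =
        oper R k (map g u) (retype g V) (Tuple (?h xs))" if "?C xs" for t xs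
      by (rule interp_op[OF _ _ V k u that]) (simp_all add: m)
    ultimately show "(interp V (tinst u (ar_cod \<Sigma> k)) (Tuple (k # Tuple u # xs)),
        interp V (tinst u (ar_cod \<Sigma> k)) (Tuple (k # Tuple u # ys))) \<in>
        leq (obj R (retype g V) (g (tinst u (ar_cod \<Sigma> k))))"
      using oper_phom[OF k u cx_retype[OF V]] C unfolding phom_def by auto
  qed
qed

lemma oper_phom_term:
  assumes "tcx V"
  shows "oper I k u V \<in> phom (mobj (classic_mod I (ar_dom \<Sigma> k) u) V) (obj I V (tinst u (ar_cod \<Sigma> k)))"
proof -
  let ?C = "mobj (classic_mod I (ar_dom \<Sigma> k) u) V"
  have "oper I k u V \<in> carr ?C \<rightarrow>\<^sub>E carr (obj I V (tinst u (ar_cod \<Sigma> k)))"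
    unfolding carr_classic_term by (auto intro: tm.op k u)
  moreover have "(oper I k u V x, oper I k u V y) \<in> leq (obj I V (tinst u (ar_cod \<Sigma> k)))"
    if xy: "(x, y) \<in> leq ?C" for x y
  proof -
    obtain xs ys where [simp]: "x = Tuple xs" "y = Tuple ys"
      using xy unfolding leq_classic_term by blast
    have "x \<in> carr ?C" "y \<in> carr ?C"
      using xy term_leD(1,2) unfolding leq_classic_term carr_classic_term
      by (fastforce simp: list_all2_conv_all_nth)+
    then show ?thesis
      using op_mono[OF assms, of xs ys] xy unfolding carr_classic_term by simp
  qed
  ultimately show ?thesis unfolding phom_def by blast
qed

text \<open>Once the shifts of the derived modules are identified with \<open>mshifts\<close>, this
  is the recursion equation of \<open>ev\<close> for operations.\<close>

lemma oper_bind_term: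
  assumes V: "tcx V" and f: "f \<in> fhom (disc V) (obj I W)"
    and xs: "Tuple xs \<in> carr (mobj (classic_mod I (ar_dom \<Sigma> k) u) V)"
  shows "oper I k u W (mbind (classic_mod I (ar_dom \<Sigma> k) u) V W f (Tuple xs)) =
    bind I V W f (tinst u (ar_cod \<Sigma> k)) (oper I k u V (Tuple xs))"
proof -
  let ?ss = "\<lambda>d. map (tinst u) (fst d)" and ?S = "sub_model \<Sigma>"
  let ?ys = "map2 (\<lambda>d x. ev \<Sigma> ?S (addvars (?ss d) W) (mshifts ?S (?ss d) W f) (tinst u (snd d)) x)
    (ar_dom \<Sigma> k) xs"
  note fS = fhom_menvs[OF f]
  have C: "list_all2 (\<lambda>d x. tm \<Sigma> (addvars (?ss d) V) (tinst u (snd d)) x) (ar_dom \<Sigma> k) xs"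
    using xs unfolding carr_classic_term by simp
  have "map2 (\<lambda>d. rbind I (addvars (?ss d) V) (addvars (?ss d) W) (rshifts I (?ss d) W f)
      (tinst u (snd d))) (ar_dom \<Sigma> k) xs = ?ys"
    using C
  proof (rule map2_cong_all2)
    fix d x assume d: "d \<in> set (ar_dom \<Sigma> k)" and x: "tm \<Sigma> (addvars (?ss d) V) (tinst u (snd d)) x"
    show "rbind I (addvars (?ss d) V) (addvars (?ss d) W) (rshifts I (?ss d) W f) (tinst u (snd d)) x =
        ev \<Sigma> ?S (addvars (?ss d) W) (mshifts ?S (?ss d) W f) (tinst u (snd d)) x"
      unfolding rbind_term[OF x]
      by (intro ev_cong[OF x] ballI) (rule rshifts_term[OF V arity_sorts(1)[OF sig k u d] fS])
  qed
  then have mb: "mbind (classic_mod I (ar_dom \<Sigma> k) u) V W f (Tuple xs) = Tuple ?ys"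
    using mbind_classic_mod[OF fhom_disc_ext[OF f] xs, of W] unfolding teval_term_rep by simp
  have D: "list_all2 (\<lambda>d x. tm \<Sigma> (addvars (?ss d) W) (tinst u (snd d)) x) (ar_dom \<Sigma> k) ?ys"
    using C
  proof (rule list_all2_map2)
    fix d x assume d: "d \<in> set (ar_dom \<Sigma> k)" and x: "tm \<Sigma> (addvars (?ss d) V) (tinst u (snd d)) x"
    show "tm \<Sigma> (addvars (?ss d) W) (tinst u (snd d))
        (ev \<Sigma> ?S (addvars (?ss d) W) (mshifts ?S (?ss d) W f) (tinst u (snd d)) x)"
      using mshifts_menvs[OF sig model_sub[OF sig] arity_sorts(1)[OF sig k u d] _ fS]
      by (intro tm_sub[OF x]) simp
  qed
  \<comment> \<open>Places the term in the set to which \<open>bind I\<close> is restricted.\<close>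
  have "tm \<Sigma> V (tinst u (ar_cod \<Sigma> k)) (Tuple (k # Tuple u # xs))" using k u C by (rule tm.op)
  then show ?thesis unfolding mb using C D by simp
qed

end

lemma rep_term: "rep small \<Sigma> I"
proof -
  have "srep small \<Sigma> I"
    using small_ctys[OF univ] sig
    by (auto simp: srep_def vecs_def typed_signature_def intro!: ctys.intros)
  moreover have "pmod_mor small I (classic_mod I (ar_dom \<Sigma> k) u)
      (fibre (taut I) (tinst u (ar_cod \<Sigma> k))) (oper I k u)"
    if k: "k \<in> ars \<Sigma>" "u \<in> vecs (ctys \<Sigma>) (deg \<Sigma> k)" for k u
  proof -
    have "compose (carr (mobj (classic_mod I (ar_dom \<Sigma> k) u) V)) (oper I k u W)
          (mbind (classic_mod I (ar_dom \<Sigma> k) u) V W f) =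
        compose (carr (mobj (classic_mod I (ar_dom \<Sigma> k) u) V))
          (bind I V W f (tinst u (ar_cod \<Sigma> k))) (oper I k u V)"
      if "tcx V" "f \<in> fhom (disc V) (obj I W)" for V W f
      unfolding compose_def
    proof (rule restrict_ext)
      fix x assume x: "x \<in> carr (mobj (classic_mod I (ar_dom \<Sigma> k) u) V)"
      then obtain xs where "x = Tuple xs" unfolding carr_classic_term by blast
      with oper_bind_term[OF k that] x
      show "oper I k u W (mbind (classic_mod I (ar_dom \<Sigma> k) u) V W f x) =
        bind I V W f (tinst u (ar_cod \<Sigma> k)) (oper I k u V x)" by blast
    qed
    then show ?thesis
      unfolding pmod_mor_def fibre_def taut_def
      using oper_phom_term[OF k] by (simp del: term_rep_simps(3-))
  qed
  ultimately show ?thesis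
    unfolding rep_def relative_S_monad_def using reduction_monad_term
    by (simp del: term_rep_simps(3-))
qed

lemma srep_mor_canonical:
  assumes "representation small R \<Sigma>"
  shows "srep_mor \<Sigma> I R (ty_map \<Sigma> R)"
proof -
  interpret representation small R \<Sigma> by fact
  have "g (Tuple (j # us)) = tyop R j (map g us)"
    if "j \<in> tops \<Sigma>" "us \<in> vecs (ctys \<Sigma>) (tar \<Sigma> j)" for j us
  proof -
    have "Tuple (j # us) \<in> ctys \<Sigma>" using that by (auto simp: vecs_def intro: ctys.intros)
    then have "g (Tuple (j # us)) = tyop R j (map (cty_eval R) us)" by (simp add: ty_map_def)
    also have "map (cty_eval R) us = map g us"
      using that(2) by (auto simp: vecs_def ty_map_def)
    finally show ?thesis .
  qed
  then show ?thesis using g_funcset by (simp add: srep_mor_def)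
qed

text \<open>Monotonicity is where \<open>R\<close> must satisfy \<open>A\<close>, since
  \<open>term_le\<close> is tested against such representations. Units hold by the choice of
  \<open>var_env\<close>, binds by \<open>interp_sub\<close>, operations by
  \<open>interp_op\<close>.\<close>

lemma rep_mor_canonical:
  assumes hR: "rep_2sig small \<Sigma> A R"
  shows "rep_mor small \<Sigma> I R (canonical small \<Sigma> R)"
proof -
  interpret representation small R \<Sigma> using hR by (rule representation)
  let ?m = "canonical small \<Sigma> R"
  have cmap_ext: "cmap ?m \<in> extensional {V. ctx small (tys I) V}"
    by (simp add: canonical_def)
  have hom: "cmap ?m V \<in> fhom (retype_fam g (obj I V)) (obj R (retype g V))" if V: "tcx V" for V
  proof -
    have "cmap ?m V t' \<in> phom (retype_fam g (obj I V) t') (obj R (retype g V) t')" for t'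
    proof -
      have "cmap ?m V t' \<in> carr (retype_fam g (obj I V) t') \<rightarrow>\<^sub>E carr (obj R (retype g V) t')"
        using interp_carr[OF V] V by (auto simp: canonical_def retype_fam_def)
      moreover have "(cmap ?m V t' p, cmap ?m V t' q) \<in> leq (obj R (retype g V) t')"
        if pq: "(p, q) \<in> leq (retype_fam g (obj I V) t')" for p q
      proof -
        obtain t x y where [simp]: "p = pair t x" "q = pair t y" "t' = g t"
          and xy: "(x, y) \<in> term_le small \<Sigma> A V t"
          using pq by (auto simp: retype_fam_def)
        show ?thesis using term_leD[OF xy] hR V by (simp add: cmap_canonical)
      qed
      ultimately show ?thesis unfolding phom_def by blast
    qed
    then show ?thesis by (simp add: fhom_def)
  qed
  have unit: "fcomp (retype g V) (retype_mor g V (unit I V)) (cmap ?m V) = unit R (retype g V)"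
    if V: "tcx V" for V
  proof (intro ext)
    fix t' p
    have "unit R (retype g V) \<in> fhom (disc (retype g V)) (obj R (retype g V))"
      using R cx_retype[OF V] by (simp add: reduction_monad_def)
    then have e: "unit R (retype g V) t' \<in> extensional (retype g V t')" by (rule fhom_extensional)
    show "fcomp (retype g V) (retype_mor g V (unit I V)) (cmap ?m V) t' p = unit R (retype g V) t' p"
    proof (cases "p \<in> retype g V t'")
      case True
      then obtain t v where p: "p = pair t v" "t' = g t" "v \<in> V t" unfolding retype_def by blast
      then show ?thesis
        using True tm_var[OF V p(3)] V
        by (simp add: fcomp_def compose_def retype_mor_def cmap_canonical interp_def var_env_def)
    next
      case False
      then show ?thesis using e by (simp add: fcomp_def compose_def extensional_def)
    qed
  qed
  have bind: "fcomp (retype g (carrs (obj I V))) (retype_mor g (carrs (obj I V)) (bind I V W h)) (cmap ?m W) =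
      fcomp (retype g (carrs (obj I V))) (cmap ?m V)
        (bind R (retype g V) (retype g W) (fcomp (retype g V) (retype_mor g V h) (cmap ?m W)))"
    if V: "tcx V" and W: "tcx W" and h: "h \<in> fhom (disc V) (obj I W)" for V W h
  proof -
    note hS = fhom_menvs[OF h]
    have "bind R (retype g V) (retype g W) (fcomp (retype g V) (retype_mor g V h) (cmap ?m W)) =
        rbind R (retype g V) (retype g W) (fcomp (retype g V) (retype_mor g V h) (cmap ?m W))"
      by (rule bind_eq_rbind) (simp add: fcomp_def)
    also have "\<dots> = rbind R (retype g V) (retype g W) (\<lambda>t' p. interp W (idx p) (h (idx p) (val p)))"
    proof (rule rbind_cong)
      fix t' p assume p': "p \<in> retype g V t'"
      then obtain t v where p: "p = pair t v" "t' = g t" "v \<in> V t" unfolding retype_def by blast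
      then have "t \<in> ctys \<Sigma>" using V by (auto simp: ctx_def)
      then have "tm \<Sigma> W t (h t v)" using hS p(3) by (auto simp: menvs_def)
      then show "fcomp (retype g V) (retype_mor g V h) (cmap ?m W) t' p = interp W (idx p) (h (idx p) (val p))"
        using p p' W by (simp add: fcomp_def compose_def retype_mor_def cmap_canonical)
    qed
    finally have b: "bind R (retype g V) (retype g W) (fcomp (retype g V) (retype_mor g V h) (cmap ?m W)) =
        rbind R (retype g V) (retype g W) (\<lambda>t' p. interp W (idx p) (h (idx p) (val p)))" .
    have "retype_mor g (carrs (obj I V)) (bind I V W h) t' p \<in> retype g (carrs (obj I W)) t' \<and>
        cmap ?m W t' (retype_mor g (carrs (obj I V)) (bind I V W h) t' p) =
        rbind R (retype g V) (retype g W) (\<lambda>t' p. interp W (idx p) (h (idx p) (val p))) t' (cmap ?m V t' p)"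
      if p': "p \<in> retype g (carrs (obj I V)) t'" for t' p
    proof -
      obtain t x where p: "p = pair t x" "t' = g t" "tm \<Sigma> V t x"
        using p' by (auto simp: retype_def carrs_def)
      have "retype_mor g (carrs (obj I V)) (bind I V W h) t' p =
          pair t (ev \<Sigma> (sub_model \<Sigma>) W h t x)"
        using p p' by (simp add: retype_mor_def)
      moreover note tm = tm_sub[OF p(3) hS]
      ultimately show ?thesis
        using interp_sub[OF V W p(3) hS] p V W cmap_canonical[OF W tm] cmap_canonical[OF V p(3)]
        by (simp add: retype_def carrs_def) 
    qed
    then show ?thesis unfolding b by (auto simp: fcomp_def compose_def fun_eq_iff restrict_def)
  qed
  have oper: "hat R ?m [] V (tinst u (ar_cod \<Sigma> k)) (oper I k u V x) =
      oper R k (map g u) (retype g V) (classic_hat I R ?m (ar_dom \<Sigma> k) u V x)"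
    if k: "k \<in> ars \<Sigma>" and u: "u \<in> vecs (ctys \<Sigma>) (deg \<Sigma> k)" and V: "tcx V"
      and x: "x \<in> carr (mobj (classic_mod I (ar_dom \<Sigma> k) u) V)" for k u V x
  proof -
    obtain xs where [simp]: "x = Tuple xs"
      and C: "list_all2 (\<lambda>d x. tm \<Sigma> (addvars (map (tinst u) (fst d)) V) (tinst u (snd d)) x) (ar_dom \<Sigma> k) xs"
      using x unfolding carr_classic_term by blast
    have "hat R ?m [] V (tinst u (ar_cod \<Sigma> k)) (oper I k u V x) =
        interp V (tinst u (ar_cod \<Sigma> k)) (Tuple (k # Tuple u # xs))"
      using C by (simp add: cmap_canonical[OF V tm.op[OF k u C]])
    also have "\<dots> = oper R k (map g u) (retype g V)
        (Tuple (map2 (\<lambda>d. hat R ?m (map (tinst u) (fst d)) V (tinst u (snd d))) (ar_dom \<Sigma> k) xs))"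
      by (rule interp_op[OF _ _ V k u C]) (simp_all add: cmap_canonical)
    finally show ?thesis using x by (simp add: classic_hat_term)
  qed
  show ?thesis
    unfolding rep_mor_def relative_S_monad_mor_def tmap_canonical
    using srep_mor_canonical[OF representation[OF hR]] cmap_ext hom unit bind oper
    by (simp del: term_rep_simps(3-) hat.simps)
qed

end


section \<open>Uniqueness, and validity of the inequations\<close>

context term_representation
begin

text \<open>Compatibility with type operations fixes the map on closed types. Compatibility with
  units then fixes the values on variables, and compatibility with operations fixes all other values
  by induction on terms.\<close>

lemma rep_mor_unique:
  assumes "representation small R \<Sigma>" and m: "rep_mor small \<Sigma> I R m"
  shows "m = canonical small \<Sigma> R"
proof -
  interpret representation small R \<Sigma> by fact
  let ?c = "canonical small \<Sigma> R"
  have mm: "relative_S_monad_mor small \<Sigma> I R m" using m by (simp add: rep_mor_def)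
  then have t: "srep_mor \<Sigma> I R (tmap m)" by (simp add: relative_S_monad_mor_def)
  have "tmap m s = g s" if "s \<in> ctys \<Sigma>" for s
    using that
  proof induction
    case (1 j us)
    then have us: "us \<in> vecs (ctys \<Sigma>) (tar \<Sigma> j)" by (auto simp: vecs_def)
    then have "tmap m (Tuple (j # us)) = tyop R j (map (tmap m) us)"
      using t 1(1) by (auto simp: srep_mor_def)
    also have "map (tmap m) us = map g us" using 1(4) by simp
    also have "tyop R j (map g us) = g (Tuple (j # us))"
      using srep_mor_canonical[OF assms(1)] 1(1) us by (auto simp: srep_mor_def)
    finally show ?case .
  qed
  moreover have "tmap m \<in> extensional (ctys \<Sigma>)" "g \<in> extensional (ctys \<Sigma>)"
    using t g_funcset by (auto simp: srep_mor_def PiE_def)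
  ultimately have tmap: "tmap m = g" by (intro extensionalityI)
  have hom: "cmap m V \<in> fhom (retype_fam g (obj I V)) (obj R (retype g V))"
    and unit: "fcomp (retype g V) (retype_mor g V (unit I V)) (cmap m V) = unit R (retype g V)"
    if "tcx V" for V
    using mm that unfolding relative_S_monad_mor_def tmap by simp_all
  have eq: "cmap m V (g t) (pair t x) = interp V t x" if "tm \<Sigma> V t x" "tcx V" for V t x
    using that
  proof induction
    case (var t v V)
    have p: "pair t v \<in> retype g V (g t)" using var by (auto simp: retype_def)
    have "fcomp (retype g V) (retype_mor g V (unit I V)) (cmap m V) (g t) (pair t v) =
        cmap m V (g t) (pair t (Tuple [v]))"
      using p var by (simp add: fcomp_def compose_def retype_mor_def)
    then show ?case using unit[OF var.prems] by (simp add: interp_def var_env_def)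
  next
    case (op k u V xs)
    have C: "list_all2 (\<lambda>d x. tm \<Sigma> (addvars (map (tinst u) (fst d)) V) (tinst u (snd d)) x)
        (ar_dom \<Sigma> k) xs"
      using op.IH by (rule list_all2_mono) simp
    then have x: "Tuple xs \<in> carr (mobj (classic_mod I (ar_dom \<Sigma> k) u) V)"
      unfolding carr_classic_term by blast
    have "cmap m V (g (tinst u (ar_cod \<Sigma> k))) (pair (tinst u (ar_cod \<Sigma> k)) (oper I k u V (Tuple xs))) =
        oper R k (map g u) (retype g V) (classic_hat I R m (ar_dom \<Sigma> k) u V (Tuple xs))"
      using m x op.hyps op.prems unfolding rep_mor_def tmap
      by (simp del: term_rep_simps(3-) add: tmap)
    also have "oper I k u V (Tuple xs) = Tuple (k # Tuple u # xs)" using C by simp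
    also have "classic_hat I R m (ar_dom \<Sigma> k) u V (Tuple xs) =
        Tuple (map2 (\<lambda>d. hat R m (map (tinst u) (fst d)) V (tinst u (snd d))) (ar_dom \<Sigma> k) xs)"
      using x by (rule classic_hat_term)
    also have "map2 (\<lambda>d. hat R m (map (tinst u) (fst d)) V (tinst u (snd d))) (ar_dom \<Sigma> k) xs =
        map2 (\<lambda>d. hat R ?c (map (tinst u) (fst d)) V (tinst u (snd d))) (ar_dom \<Sigma> k) xs"
      using op.IH
    \<comment> \<open>The induction hypothesis gives the value of \<open>cmap m\<close> in the
      extended context, and by \<open>hat_cong\<close> this determines \<open>hat\<close>.\<close>
    proof (rule map2_cong_all2, elim conjE)
      fix d x
      let ?V = "addvars (map (tinst u) (fst d)) V" and ?t = "tinst u (snd d)"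
      assume d: "d \<in> set (ar_dom \<Sigma> k)" and x: "tm \<Sigma> ?V ?t x"
        and IH: "tcx ?V \<longrightarrow> cmap m ?V (g ?t) (pair ?t x) = interp ?V ?t x"
      have "tcx (addvars ss V)" if "set ss \<subseteq> ctys \<Sigma>" for ss
        using that op.prems by (induction ss arbitrary: V) (simp_all add: ctx_addvar[OF univ])
      then have V: "tcx ?V" using arity_sorts(1)[OF sig op.hyps d] by blast
      show "hat R m (map (tinst u) (fst d)) V ?t x = hat R ?c (map (tinst u) (fst d)) V ?t x"
        by (rule hat_cong) (use IH V cmap_canonical[OF V x] tmap in simp_all)
    qed
    also have "oper R k (map g u) (retype g V) (Tuple \<dots>) =
        interp V (tinst u (ar_cod \<Sigma> k)) (Tuple (k # Tuple u # xs))"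
      by (rule interp_op[OF _ _ op.prems op.hyps C, symmetric]) (simp_all add: cmap_canonical)
    finally show ?case .
  qed
  have cmap_eq: "cmap m V = cmap ?c V" if V: "tcx V" for V
  proof (intro ext)
    fix t' p
    have e: "cmap m V t' \<in> extensional (carr (retype_fam g (obj I V) t'))"
      using hom[OF V] by (auto simp: fhom_def phom_def PiE_def)
    show "cmap m V t' p = cmap ?c V t' p"
    proof (cases "\<exists>t x. p = pair t x \<and> g t = t' \<and> tm \<Sigma> V t x")
      case True
      then show ?thesis using eq cmap_canonical V by metis
    next
      case False
      then have "p \<notin> carr (retype_fam g (obj I V) t')" by (auto simp: retype_fam_def)
      then show ?thesis using False e V by (auto simp: canonical_def extensional_def)
    qed
  qed
  have "cmap m \<in> extensional {V. tcx V}" "cmap ?c \<in> extensional {V. tcx V}"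
    using mm by (simp_all add: relative_S_monad_mor_def canonical_def)
  then have "cmap m = cmap ?c" using cmap_eq by (rule extensionalityI) simp
  then show ?thesis using tmap by simp
qed

text \<open>A half-equation is natural with respect to the canonical morphisms, and its codomain being
  classic, these act on it by maps that reflect the preorder.\<close>

lemma satisfies_term:
  assumes q: "q \<in> A" "classic_inequation small \<Sigma> q"
  shows "satisfies small I q"
proof -
  obtain ds where ds: "dom_arity \<Sigma> (ideg q) ds" "icod q = classic_sigmod ds"
    using q(2) by (auto simp: classic_inequation_def)
  have W: "sigmod small \<Sigma> (ideg q) (idom q)"
    and he: "half_equation small \<Sigma> (ideg q) (idom q) (classic_sigmod ds) (ilhs q)"
      "half_equation small \<Sigma> (ideg q) (idom q) (classic_sigmod ds) (irhs q)"
    using q(2) ds(2) by (auto simp: classic_inequation_def inequation_def)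
  show ?thesis
    unfolding satisfies_def
  proof (intro ballI allI impI)
    fix u V y
    assume "u \<in> vecs (tys I) (ideg q)" "ctx small (tys I) V"
      and y: "y \<in> carr (mobj (smod (idom q) I u) V)"
    then have u: "u \<in> vecs (ctys \<Sigma>) (ideg q)" and V: "tcx V" by simp_all
    have carr: "\<alpha> I u V y \<in> carr (mobj (classic_mod I ds u) V)"
      if "half_equation small \<Sigma> (ideg q) (idom q) (classic_sigmod ds) \<alpha>" for \<alpha>
    proof -
      have "pmod_mor small I (smod (idom q) I u) (classic_mod I ds u) (\<alpha> I u)"
        using that rep_term u by (simp add: half_equation_def classic_sigmod_def)
      then show ?thesis using V y by (auto simp: pmod_mor_def phom_def)
    qed
    obtain xs ys where a: "ilhs q I u V y = Tuple xs" and b: "irhs q I u V y = Tuple ys"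
      using carr[OF he(1)] carr[OF he(2)] unfolding carr_classic_term by blast
    note xs = carr[OF he(1), unfolded a] and ys = carr[OF he(2), unfolded b]
    have len: "length xs = length ds" "length ys = length ds"
      using xs ys unfolding carr_classic_term by (auto dest: list_all2_lengthD)
    have "(xs ! i, ys ! i) \<in>
        term_le small \<Sigma> A (addvars (map (tinst u) (fst (ds ! i))) V) (tinst u (snd (ds ! i)))"
      if i: "i < length ds" for i
    proof -
      let ?d = "ds ! i"
      let ?ss = "map (tinst u) (fst ?d)" and ?t = "tinst u (snd ?d)"
      have tm: "tm \<Sigma> (addvars ?ss V) ?t (xs ! i)" "tm \<Sigma> (addvars ?ss V) ?t (ys ! i)"
        using xs ys i unfolding carr_classic_term by (auto simp: list_all2_conv_all_nth)
      have ss: "set ?ss \<subseteq> ctys \<Sigma>"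
        using ds(1) nth_mem[OF i] tinst_ctys[OF _ u] by (fastforce simp: dom_arity_def split_beta)
      show ?thesis
      proof (rule term_leI[OF tm])
        fix R assume hR: "rep_2sig small \<Sigma> A R" "representation small R \<Sigma>"
        interpret representation small R \<Sigma> by fact
        let ?m = "canonical small \<Sigma> R"
        let ?y = "smor (idom q) I R ?m u V y"
        let ?h = "\<lambda>xs. map2 (\<lambda>d. hat R ?m (map (tinst u) (fst d)) V (tinst u (snd d))) ds xs"
        note m = rep_mor_canonical[OF hR(1)]
        \<comment> \<open>Naturality at the canonical morphism from the terms to \<open>R\<close>:
          the action of the classic codomain turns the value on terms into the value in
          \<open>R\<close> at the image \<open>?y\<close> of \<open>y\<close>.\<close>
        have nat: "classic_hat I R ?m ds u V (\<alpha> I u V y) = \<alpha> R (map g u) (retype g V) ?y"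
          if "half_equation small \<Sigma> (ideg q) (idom q) (classic_sigmod ds) \<alpha>" for \<alpha>
          using that rep_term rep m u V y unfolding half_equation_def
          by (auto simp: classic_sigmod_def)
        have "pmod_mor small I (smod (idom q) I u)
            (pull_mod ?m (smod (idom q) R (map (tmap ?m) u))) (smor (idom q) I R ?m u)"
          using W[unfolded sigmod_def, THEN conjunct2, THEN conjunct1, rule_format, of I R ?m u]
            rep_term rep m u by simp
        then have "?y \<in> carr (mobj (smod (idom q) R (map g u)) (retype g V))"
          using V y by (auto simp: pmod_mor_def phom_def pull_mod_def)
        moreover have "satisfies small R q" using hR(1) q(1) by (simp add: rep_2sig_def)
        ultimately have "(ilhs q R (map g u) (retype g V) ?y, irhs q R (map g u) (retype g V) ?y) \<in>
            leq (mobj (classic_mod R ds (map g u)) (retype g V))"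
          using map_g_vecs[OF u] cx_retype[OF V] ds(2)
          by (simp add: satisfies_def classic_sigmod_def)
        \<comment> \<open>The inequation valid in \<open>R\<close> at \<open>?y\<close> becomes,
          through naturality, a componentwise comparison of the \<open>hat\<close> images of
          \<open>xs\<close> and \<open>ys\<close>.\<close>
        then have "(Tuple (?h xs), Tuple (?h ys)) \<in> leq (mobj (classic_mod R ds (map g u)) (retype g V))"
          unfolding nat[OF he(1), symmetric] nat[OF he(2), symmetric] a b
            classic_hat_term[OF xs] classic_hat_term[OF ys] .
        then have "(hat R ?m ?ss V ?t (xs ! i), hat R ?m ?ss V ?t (ys ! i)) \<in>
            leq (obj R (addvars (map g ?ss) (retype g V)) (g ?t))"
          unfolding leq_classic[OF ds(1) u] using i len by (auto simp del: map_map)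
        then show "(interp (addvars ?ss V) ?t (xs ! i), interp (addvars ?ss V) ?t (ys ! i)) \<in>
            leq (obj R (retype g (addvars ?ss V)) (g ?t))"
          by (intro hat_reflects[OF _ _ V ss tm]) (simp_all add: cmap_canonical)
      qed
    qed
    then show "(ilhs q I u V y, irhs q I u V y) \<in> leq (mobj (smod (icod q) I u) V)"
      unfolding a b ds(2) using len by (simp add: classic_sigmod_def leq_classic_term)
  qed
qed

end

theorem theorem3p28:
  fixes small :: "'a univ set \<Rightarrow> bool" and \<Sigma> :: "'a tsig" and A :: "'a ineq set"
  assumes "set_universe small"
    and "typed_signature small \<Sigma>"
    and "\<forall>q\<in>A. classic_inequation small \<Sigma> q"
  shows "\<exists>I. rep_2sig small \<Sigma> A I \<and>
           (\<forall>R. rep_2sig small \<Sigma> A R \<longrightarrow> (\<exists>!m. rep_mor small \<Sigma> I R m))"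
proof -
  interpret term_representation small \<Sigma> A using assms(1,2) by unfold_locales
  have "rep_2sig small \<Sigma> A I"
    using rep_term satisfies_term assms(3) by (simp add: rep_2sig_def)
  moreover have "\<exists>!m. rep_mor small \<Sigma> I R m" if "rep_2sig small \<Sigma> A R" for R
    using rep_mor_canonical[OF that] rep_mor_unique[OF representation[OF that]] by blast
  ultimately show ?thesis by blast
qed

end
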